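(* Let $m\ge1$, let $u,v$ be words in $\sigma_1^{\pm1},\dots,\sigma_{m-1}^{\pm1}$, let $1\le i\le m-1$, and let $G_{m,+}$, $G_{m,-}$, $G_{m,0}$ be the braid Gauss diagrams of the words $u\sigma_i v$, $u\sigma_i^{-1}v$, $uv$ respectively (a Conway triple). Then for all integers $k\ge1$, $1\le j\le k$ and $n\ge 0$, $$D_{n,k,j}(G_{m,+})-D_{n,k,j}(G_{m,-})=D_{n-1,k,j}(G_{m,0}),$$ with the convention $D_{-1,k,j}:=0$.
   Context: Braid Gauss diagrams. $B_m$ is the Artin braid group with generators $\sigma_1,\dots,\sigma_{m-1}$. For a word $\beta$ in $\sigma_i^{\pm1}$, the closed braid diagram $D$ of $\beta$ is obtained by joining the top and bottom endpoints of the $m$ strands by $m$ parallel closing strands; it represents an oriented link. The Gauss diagram $G$ of $D$ has one oriented circle parametrizing each component of $D$, and for each crossing an arrow joining its two preimages, pointing from the overpassing preimage to the underpassing one, carrying the sign (local writhe) of the crossing. An arc of $G$ is a connected component of the complement in the circles of all arrow endpoints. The braid Gauss diagram $G_m$ is $G$ together with labels $a_1,\dots,a_m$, where $a_i$ is the arc of $G$ containing the preimage of the $i$-th closing strand. The writhe $w(G_m)$ is the sum of the signs of all arrows. Colored braid Gauss diagrams. For $k\ge1$, a colored braid Gauss diagram associated with $k$ and $G_m$ is $G_m$ together with: base points $*_1,\dots,*_k$ placed on arcs $a_{j_1},\dots,a_{j_k}$ with $1=j_1<j_2<\dots<j_k\le m$ (one base point per arc); and, for each remaining labeled arc $a_j$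 ($j\notin\{j_1,\dots,j_k\}$), a number from $\{1,\dots,l\}$, where $l$ is the largest index with $j_l<j$. $\mathfrak{G}_{k,m}$ denotes the set of all such diagrams (empty if $k>m$). Arrow diagrams. An arrow diagram is a finite collection of oriented circles with finitely many arrows joining pairs of distinct points of the circles, up to orientation-preserving diffeomorphisms of the circles; its arcs are the components of the complement of arrow endpoints. Its surface $\Sigma(A)$ is obtained by gluing an oriented disk to each circle and attaching, for each arrow, an untwisted band (1-handle) with that arrow as core, so that $\Sigma(A)$ is oriented. Each arc of $A$ lies on exactly one boundary component of $\Sigma(A)$. $A$ is multibased with $k$ boundary components if $\Sigma(A)$ has exactly $k$ boundary components and base points $*_1,\dots,*_k$ are placed on arcs lying on $k$ pairwise different boundary components; the one containing $*_i$ is the $i$-th boundary component. Traverse the boundary components in the order $i=1,\dots,k$, each starting from $*_i$ in the boundary orientation (which agrees with the circle orientation along arcs). Each band has two sides parallel to its core arrow; $A$ is descending if for every arrow the first time the traversal runs along a side of its band it runs from the tail end to the head end. $\mathcal{D}_{n,k}$ is the set of descending multibased arrow diagrams with $n$ arrows and $k$ boundary components ($\mathcal{D}_{n,k}=\emptyset$ for $n<0$). Pairing. Let $A$ be multibased with $k$ boundary components and $G\in\mathfrak{G}_{k,m}$. A homomorphism $\phi:A\to G$ is a bijection between the circles of $A$ and those of $G$ together with orientation-preserving homeomorphisms of corresponding circles, mapping each base point $*_i$ of $A$ to the base point $*_i$ of $G$, mapping arrows of $A$ injectively onto arrows of $G$ (tail to tail, head to head), and such that every non-based labeled arc of $G$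 colored by a number $j$ is contained in the image of an arc of $A$ lying on the $j$-th boundary component. Homomorphisms are determined by their image set of arrows (their state). The sign $\varepsilon(\phi)$ is the product of signs of the arrows in the image. $\langle A,G\rangle:=\sum_{\phi}\varepsilon(\phi)$, and $\langle A,G\rangle=0$ if $A$ and $G$ have different numbers of circles. For $1\le j\le k$: $D_{n,k,j}(G_m):=\sum_{G\in\mathfrak{G}_{j,m}}\sum_{A\in\mathcal{D}_{n+j-k,j}}\langle A,G\rangle$. *)

theory Defs
  imports Main
begin

text \<open>An arrow diagram is represented by a list of circles; each circle is the
list, in the cyclic order given by the circle orientation, of the arrow
endpoints on it.  An endpoint is a pair (a, b) where a is the arrow index
(arrows are 0,...,N-1) and b = True for the head, b = False for the tail.
Rotating a circle list does not change the diagram (cyclic order); a circle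
with empty list is a circle without arrow endpoints.
Arcs: on a circle c with endpoint list L of length l > 0, the arc (c,t),
t < l, is the arc running from the endpoint L!t to the endpoint L!((t+1) mod l);
on a circle without endpoints the only arc is (c,0), the whole circle.
Base points are recorded by the arcs carrying them: bas!(i-1) is the arc
carrying the base point *_i.\<close>

type_synonym endpt = "nat \<times> bool"
type_synonym arc = "nat \<times> nat"

record adiag =
  cir :: "endpt list list"
  bas :: "arc list"

definition narr :: "adiag \<Rightarrow> nat" where
  "narr A = length (concat (cir A)) div 2"

definition wf_adiag :: "adiag \<Rightarrow> bool" where
  "wf_adiag A \<longleftrightarrow> distinct (concat (cir A)) \<and>
     set (concat (cir A)) = {..<narr A} \<times> UNIV"

definition arcs :: "adiag \<Rightarrow> arc set" where
  "arcs A = {(c,t). c < length (cir A) \<and> t < max 1 (length (cir A ! c))}"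

definition epos :: "adiag \<Rightarrow> endpt \<Rightarrow> nat \<times> nat" where
  "epos A e = (THE p. fst p < length (cir A) \<and> snd p < length (cir A ! fst p)
                     \<and> cir A ! fst p ! snd p = e)"

text \<open>Boundary of the surface \<Sigma>(A): after running along an arc up to its final
endpoint e, the boundary runs along the side of the band of the arrow of e to
the other endpoint e' of that arrow and continues along the arc starting at e'.\<close>
definition next_arc :: "adiag \<Rightarrow> arc \<Rightarrow> arc" where
  "next_arc A \<alpha> = (let (c,t) = \<alpha>; L = cir A ! c in
     if L = [] then \<alpha>
     else (let (a,b) = L ! ((t+1) mod length L) in epos A (a, \<not> b)))"

definition same_comp :: "adiag \<Rightarrow> arc \<Rightarrow> arc \<Rightarrow> bool" where
  "same_comp A \<alpha> \<beta> \<longleftrightarrow> (\<exists>j. (next_arc A ^^ j) \<alpha> = \<beta>)"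

definition bcomps :: "adiag \<Rightarrow> arc set set" where
  "bcomps A = {{\<beta> \<in> arcs A. same_comp A \<alpha> \<beta>} | \<alpha>. \<alpha> \<in> arcs A}"

definition multibased :: "adiag \<Rightarrow> nat \<Rightarrow> bool" where
  "multibased A k \<longleftrightarrow> wf_adiag A \<and> card (bcomps A) = k \<and> length (bas A) = k \<and>
     set (bas A) \<subseteq> arcs A \<and>
     (\<forall>i<k. \<forall>i'<k. i \<noteq> i' \<longrightarrow> \<not> same_comp A (bas A ! i) (bas A ! i'))"

definition arc_ending :: "adiag \<Rightarrow> endpt \<Rightarrow> arc" where
  "arc_ending A e = (let (c,s) = epos A e; l = length (cir A ! c) in (c, (s + l - 1) mod l))"

text \<open>the time at which the traversal (components in order 1..k, each from its
base point) runs along the band side starting at endpoint e: (index of boundary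
component, number of arcs traversed before), ordered lexicographically\<close>
definition comp_index :: "adiag \<Rightarrow> arc \<Rightarrow> nat" where
  "comp_index A \<alpha> = (THE i. i < length (bas A) \<and> same_comp A (bas A ! i) \<alpha>)"

definition jtime :: "adiag \<Rightarrow> endpt \<Rightarrow> nat \<times> nat" where
  "jtime A e = (let \<alpha> = arc_ending A e; i = comp_index A \<alpha> in
                 (i, LEAST j. (next_arc A ^^ j) (bas A ! i) = \<alpha>))"

definition lex_less :: "nat \<times> nat \<Rightarrow> nat \<times> nat \<Rightarrow> bool" where
  "lex_less p q \<longleftrightarrow> fst p < fst q \<or> (fst p = fst q \<and> snd p < snd q)"

definition descending :: "adiag \<Rightarrow> bool" where
  "descending A \<longleftrightarrow> (\<forall>a<narr A. lex_less (jtime A (a, False)) (jtime A (a, True)))"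

text \<open>(\<pi>, \<tau>): circle c of A goes to circle \<pi>!c of B, arrow a of A goes to arrow
\<tau>!a of B.  The homeomorphisms of the circles are determined up to isotopy (rel
the marked points) by the images of the endpoints.\<close>

definition gpos :: "adiag \<Rightarrow> nat list \<Rightarrow> endpt \<Rightarrow> nat" where
  "gpos B \<tau> e = snd (epos B (\<tau> ! fst e, snd e))"

text \<open>the image of the A-arc \<alpha> contains the B-arc \<beta>\<close>
definition covers :: "adiag \<Rightarrow> adiag \<Rightarrow> nat list \<Rightarrow> nat list \<Rightarrow> arc \<Rightarrow> arc \<Rightarrow> bool" where
  "covers A B \<pi> \<tau> \<alpha> \<beta> \<longleftrightarrow> (let (c,t) = \<alpha>; (c',t') = \<beta>; L = cir A ! c in
     c' = \<pi> ! c \<and>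
     (L = [] \<or>
      (let q0 = gpos B \<tau> (L ! t); q1 = gpos B \<tau> (L ! ((t+1) mod length L));
           LB = length (cir B ! c'); d = (q1 + LB - q0) mod LB
       in (t' + LB - q0) mod LB < (if d = 0 then LB else d))))"

definition hom_core :: "adiag \<Rightarrow> adiag \<Rightarrow> nat list \<Rightarrow> nat list \<Rightarrow> bool" where
  "hom_core A B \<pi> \<tau> \<longleftrightarrow>
     length \<pi> = length (cir A) \<and> distinct \<pi> \<and> set \<pi> = {..<length (cir B)} \<and>
     length \<tau> = narr A \<and> distinct \<tau> \<and> set \<tau> \<subseteq> {..<narr B} \<and>
     (\<forall>c<length (cir A). \<forall>e\<in>set (cir A ! c). (\<tau> ! fst e, snd e) \<in> set (cir B ! (\<pi> ! c))) \<and>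
     (\<forall>c<length (cir A). \<exists>r. sorted_wrt (<) (rotate r (map (gpos B \<tau>) (cir A ! c)))) \<and>
     length (bas A) = length (bas B) \<and>
     (\<forall>i<length (bas A). covers A B \<pi> \<tau> (bas A ! i) (bas B ! i))"

definition adiag_iso :: "adiag \<Rightarrow> adiag \<Rightarrow> bool" where
  "adiag_iso A B \<longleftrightarrow> narr A = narr B \<and> (\<exists>\<pi> \<tau>. hom_core A B \<pi> \<tau>)"

definition Dset :: "int \<Rightarrow> nat \<Rightarrow> adiag set" where
  "Dset n k = (if n < 0 then {} else {A. multibased A k \<and> narr A = nat n \<and> descending A})"

definition Dcls :: "int \<Rightarrow> nat \<Rightarrow> adiag set set" where
  "Dcls n k = Dset n k // {(A,B). A \<in> Dset n k \<and> B \<in> Dset n k \<and> adiag_iso A B}"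

text \<open>A braid word is a list of pairs (i, e): (i, True) is \<sigma>_i, (i, False) is
\<sigma>_i^{-1}.  Strands are oriented from top to bottom, positions 1..m from left
to right.  In the letter \<sigma>_i^{\<plusminus>1} the strand going from position i+1 to i passes
over for \<sigma>_i and under for \<sigma>_i^{-1}, so that \<sigma>_i is a positive and \<sigma>_i^{-1} a
negative crossing.  The p-th letter (p = 0,1,...) gives arrow p.\<close>

type_synonym bword = "(nat \<times> bool) list"

definition braid_word :: "nat \<Rightarrow> bword \<Rightarrow> bool" where
  "braid_word m w \<longleftrightarrow> (\<forall>(i,e)\<in>set w. 1 \<le> i \<and> i < m)"

fun pass :: "bword \<Rightarrow> nat \<Rightarrow> nat \<Rightarrow> endpt list \<times> nat" where
  "pass [] p s = ([], s)"
| "pass ((i,e) # w) p s =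
     (if s = i then (let (L, s') = pass w (Suc p) (i+1) in ((p, e) # L, s'))
      else if s = i+1 then (let (L, s') = pass w (Suc p) i in ((p, \<not> e) # L, s'))
      else pass w (Suc p) s)"

definition fslot :: "bword \<Rightarrow> nat \<Rightarrow> nat" where
  "fslot w s = snd (pass w 0 s)"

definition orb :: "bword \<Rightarrow> nat \<Rightarrow> nat set" where
  "orb w s = range (\<lambda>j. (fslot w ^^ j) s)"

definition reps :: "bword \<Rightarrow> nat \<Rightarrow> nat list" where
  "reps w m = filter (\<lambda>s. s = Min (orb w s)) [1..<m+1]"

definition segs :: "bword \<Rightarrow> nat \<Rightarrow> nat \<Rightarrow> endpt list" where
  "segs w s j = concat (map (\<lambda>q. fst (pass w 0 ((fslot w ^^ q) s))) [0..<j])"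

definition cir_of :: "bword \<Rightarrow> nat \<Rightarrow> endpt list" where
  "cir_of w s = segs w s (card (orb w s))"

definition circ_idx :: "bword \<Rightarrow> nat \<Rightarrow> nat \<Rightarrow> nat" where
  "circ_idx w m s = (THE c. c < length (reps w m) \<and> reps w m ! c = Min (orb w s))"

text \<open>the labeled arc a_s containing (the preimage of) the s-th closing strand\<close>
definition lab_arc :: "bword \<Rightarrow> nat \<Rightarrow> nat \<Rightarrow> arc" where
  "lab_arc w m s = (let r = Min (orb w s); l = length (cir_of w r);
       P = length (segs w r (LEAST j. (fslot w ^^ j) r = s))
     in (circ_idx w m s, if l = 0 then 0 else (P + l - 1) mod l))"

definition bgd_cir :: "bword \<Rightarrow> nat \<Rightarrow> endpt list list" where
  "bgd_cir w m = map (cir_of w) (reps w m)"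

definition sgnw :: "bword \<Rightarrow> nat \<Rightarrow> int" where
  "sgnw w p = (if snd (w ! p) then 1 else -1)"

definition writhe :: "bword \<Rightarrow> int" where
  "writhe w = (\<Sum>p<length w. sgnw w p)"

text \<open>(J, col): J = [j_1,...,j_k] the labels of the based arcs (*_i on a_{j_i});
col!(j-1) is the color of a non-based labeled arc a_j (and 0 for based ones).\<close>
definition colorings :: "nat \<Rightarrow> nat \<Rightarrow> (nat list \<times> nat list) set" where
  "colorings k m = {(J, col). length J = k \<and> sorted_wrt (<) J \<and> k \<ge> 1 \<and> J ! 0 = 1 \<and>
       set J \<subseteq> {1..m} \<and> length col = m \<and>
       (\<forall>j\<in>{1..m}. if j \<in> set J then col ! (j-1) = 0
                   else 1 \<le> col ! (j-1) \<and> col ! (j-1) \<le> card {l. l < k \<and> J ! l < j})}"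

definition cgd :: "bword \<Rightarrow> nat \<Rightarrow> nat list \<Rightarrow> adiag" where
  "cgd w m J = \<lparr>cir = bgd_cir w m, bas = map (\<lambda>j. lab_arc w m j) J\<rparr>"

definition homs :: "adiag \<Rightarrow> bword \<Rightarrow> nat \<Rightarrow> nat list \<Rightarrow> nat list \<Rightarrow> (nat list \<times> nat list) set" where
  "homs A w m J col = {(\<pi>, \<tau>). hom_core A (cgd w m J) \<pi> \<tau> \<and>
      (\<forall>j\<in>{1..m}. j \<notin> set J \<longrightarrow>
         (\<exists>\<alpha>\<in>arcs A. covers A (cgd w m J) \<pi> \<tau> \<alpha> (lab_arc w m j) \<and>
                      same_comp A (bas A ! (col ! (j-1) - 1)) \<alpha>))}"

definition pairing :: "adiag \<Rightarrow> bword \<Rightarrow> nat \<Rightarrow> nat list \<Rightarrow> nat list \<Rightarrow> int" where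
  "pairing A w m J col = (\<Sum>(\<pi>,\<tau>)\<in>homs A w m J col. \<Prod>a<narr A. sgnw w (\<tau> ! a))"

definition Dnkj :: "int \<Rightarrow> nat \<Rightarrow> nat \<Rightarrow> nat \<Rightarrow> bword \<Rightarrow> int" where
  "Dnkj n k j m w = (\<Sum>(J,col)\<in>colorings j m.
      \<Sum>X\<in>Dcls (n + int j - int k) j. pairing (SOME A. A \<in> X) w m J col)"

end

theory Submission
  imports Defs
begin

text \<open>
  A homomorphism from a based diagram into the Gauss diagram of a closed braid is determined by
  its state, the set \<open>S\<close> of arrows in its image. The boundary of the surface of a state is the closed
  braid in which the crossings in \<open>S\<close> are smoothed and the others are passed through, so being
  descending with the prescribed number of components is a property of the strand flow
  of the smoothed braid alone, and the invariant becomes a signed count of good states.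
  The states avoiding the distinguished crossing contribute equally for both signs. A state through
  it has opposite signs in the two diagrams, and since the two sides of its band are traversed at
  different times, the crossing is descending for exactly one of the two orientations of its arrow.
  Hence the difference counts the states of the smoothed word once.
\<close>

section \<open>Orbits, order of first visits and factor maps\<close>

text \<open>The obstacle is that the traversals to be compared run at different speeds:
  \<open>next_arc\<close> moves arc by arc along the boundary of the surface, the strand flow moves
  letter by letter, and the flow of \<open>u @ v\<close> has one level less. Traversal times
  therefore do not correspond, but the order of first visits does. The locale \<open>factor\<close>
  isolates what is needed for this: a map between two flows that advances at some points, waits at
  the others, and separates the advancing points. It is used twice, once to identify the surface
  boundary with the smoothed strand flow and once to delete the distinguished smoothed letter.

  A second obstacle is that the sum runs over isomorphism classes with arbitrarily chosen
  representatives and counts pairs of lists (\<pi>, \<tau>). Counting states instead is legitimate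
  because homomorphisms are rigid: every boundary component carries a base point, so the images of
  the base points propagate along the flow to the whole diagram. Two diagrams mapped onto the same
  state of the same based diagram are isomorphic for a similar reason: the state fixes all marked
  positions on the circles.\<close>

definition reach :: "('a \<Rightarrow> 'a) \<Rightarrow> 'a \<Rightarrow> 'a \<Rightarrow> bool" where
  "reach f x y \<longleftrightarrow> (\<exists>j. (f ^^ j) x = y)"

lemma reach_refl [simp]: "reach f x x"
  unfolding reach_def by (rule exI [of _ 0]) simp

lemma reach_trans [trans]: "reach f x y \<Longrightarrow> reach f y z \<Longrightarrow> reach f x z"
  unfolding reach_def by (metis add.commute comp_apply funpow_add)

lemma reach_step: "reach f x (f x)"
  unfolding reach_def by (rule exI [of _ 1]) simp

lemma reach_step': "reach f (f x) y \<Longrightarrow> reach f x y"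
  using reach_step reach_trans by metis

lemma reach_induct [consumes 1, case_names refl step]:
  assumes "reach f x y" "P y" "\<And>x. reach f (f x) y \<Longrightarrow> P (f x) \<Longrightarrow> P x"
  shows "P x"
proof -
  obtain j where "(f ^^ j) x = y" using assms(1) unfolding reach_def by blast
  then show ?thesis
  proof (induction j arbitrary: x)
    case 0 then show ?case using assms(2) by simp
  next
    case (Suc j)
    then have "(f ^^ j) (f x) = y" by (simp add: funpow_swap1)
    with Suc.IH assms(3) show ?case unfolding reach_def by blast
  qed
qed

lemma reach_closed: "reach f x y \<Longrightarrow> x \<in> X \<Longrightarrow> (\<And>z. z \<in> X \<Longrightarrow> f z \<in> X) \<Longrightarrow> y \<in> X"
  by (induction rule: reach_induct) auto

text \<open>An injective self-map of a finite set permutes it, so each orbit is a cycle and leads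
  back to its start.\<close>

lemma reach_sym:
  assumes "inj_on f X" "f ` X \<subseteq> X" "finite X" "x \<in> X" "reach f x y"
  shows "reach f y x"
proof -
  have base: "reach f (f x) x" if "x \<in> X" for x
  proof -
    let ?O = "(\<lambda>j. (f ^^ j) x) ` UNIV"
    have inX: "(f ^^ j) x \<in> X" for j
      by (induction j) (use that assms(2) in auto)
    have "finite ?O"
      using inX assms(3) by (meson finite_subset image_subsetI)
    then obtain a b where ab: "a < b" "(f ^^ a) x = (f ^^ b) x"
      using finite_imageD[of "\<lambda>j. (f ^^ j) x" UNIV] infinite_UNIV_nat
      by (metis (mono_tags, lifting) inj_onI linorder_neqE_nat)
    \<comment> \<open>Two iterates coincide by finiteness; injectivity cancels their common initial
      steps.\<close>
    have "\<exists>d. (f ^^ Suc d) x = x"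
      using ab
    proof (induction a arbitrary: b)
      case 0 then show ?case by (metis funpow_0 gr0_implies_Suc)
    next
      case (Suc a)
      then obtain b' where b': "b = Suc b'" by (cases b) auto
      have "f ((f ^^ a) x) = f ((f ^^ b') x)" using Suc.prems b' by simp
      then have "(f ^^ a) x = (f ^^ b') x" using assms(1) inX by (meson inj_onD)
      then show ?case using Suc b' by simp
    qed
    then show ?thesis unfolding reach_def by (metis funpow_swap1 funpow.simps(2) o_apply)
  qed
  have "x \<in> X \<longrightarrow> reach f y x" using assms(5)
  proof (induction rule: reach_induct)
    case refl then show ?case by simp
  next
    case (step x) then show ?case using base assms(2) reach_trans by (metis image_subset_iff)
  qed
  with assms(4) show ?thesis by simp
qed

text \<open>Some visit to \<open>x\<close> from \<open>b\<close> comes with no visit to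
  \<open>y\<close> up to that moment; \<open>y\<close> may be missed altogether. The inductive form
  transports the order through a factor map one step at a time, without counting steps.\<close>

inductive before :: "('a \<Rightarrow> 'a) \<Rightarrow> 'a \<Rightarrow> 'a \<Rightarrow> 'a \<Rightarrow> bool" for f x y where
  here: "x \<noteq> y \<Longrightarrow> before f x y x"
| later: "b \<noteq> y \<Longrightarrow> before f x y (f b) \<Longrightarrow> before f x y b"

lemma before_iff:
  "before f x y b \<longleftrightarrow> (\<exists>j. (f ^^ j) b = x \<and> (\<forall>l\<le>j. (f ^^ l) b \<noteq> y))"
proof
  assume "before f x y b"
  then show "\<exists>j. (f ^^ j) b = x \<and> (\<forall>l\<le>j. (f ^^ l) b \<noteq> y)"
  proof induction
    case here then show ?case by (intro exI[of _ 0]) simp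
  next
    case (later b)
    then obtain j where j: "(f ^^ j) (f b) = x" "\<forall>l\<le>j. (f ^^ l) (f b) \<noteq> y" by blast
    have "(f ^^ l) b \<noteq> y" if "l \<le> Suc j" for l
      using that j(2) later(1) by (cases l) (auto simp: funpow_swap1)
    with j(1) show ?case by (intro exI[of _ "Suc j"]) (simp add: funpow_swap1)
  qed
next
  assume "\<exists>j. (f ^^ j) b = x \<and> (\<forall>l\<le>j. (f ^^ l) b \<noteq> y)"
  then obtain j where "(f ^^ j) b = x" "\<forall>l\<le>j. (f ^^ l) b \<noteq> y" by blast
  then show "before f x y b"
  proof (induction j arbitrary: b)
    case 0 then show ?case by (auto intro: before.here)
  next
    case (Suc j)
    have "\<forall>l\<le>j. (f ^^ l) (f b) \<noteq> y" using Suc.prems(2)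
      by (metis Suc_le_mono funpow.simps(2) funpow_swap1 o_apply)
    moreover have "(f ^^ j) (f b) = x" using Suc.prems(1) by (simp add: funpow_swap1)
    moreover have "b \<noteq> y" using Suc.prems(2) by (metis funpow_0 le0)
    ultimately show ?case using Suc.IH before.later by metis
  qed
qed

lemma before_reach: "before f x y b \<Longrightarrow> reach f b x"
  unfolding before_iff reach_def by blast

lemma before_total:
  assumes "reach f b x" "x \<noteq> y" shows "before f x y b \<or> before f y x b"
  using assms
  by (induction rule: reach_induct) (metis before.here before.later)+

lemma before_asym:
  assumes "before f x y b" "before f y x b" shows False
  using assms unfolding before_iff by (metis nle_le)

text \<open>The link to the first-visit times in \<open>jtime\<close>. Both points have to be
  reachable, since \<open>LEAST\<close> says nothing about a point that is never visited.\<close>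

lemma before_least_iff:
  assumes "reach f b x" "reach f b y"
  shows "before f x y b \<longleftrightarrow> (LEAST j. (f ^^ j) b = x) < (LEAST j. (f ^^ j) b = y)"
    (is "_ \<longleftrightarrow> ?i < ?j")
proof -
  have i: "(f ^^ ?i) b = x" and j: "(f ^^ ?j) b = y"
    using assms unfolding reach_def by (metis (mono_tags, lifting) LeastI)+
  show ?thesis
  proof
    assume "before f x y b"
    then obtain l where l: "(f ^^ l) b = x" "\<forall>l'\<le>l. (f ^^ l') b \<noteq> y"
      unfolding before_iff by blast
    have "?i \<le> l" using l(1) by (rule Least_le)
    moreover have "l < ?j" using l(2) j by (meson not_le)
    ultimately show "?i < ?j" by simp
  next
    assume "?i < ?j"
    then have "(f ^^ l) b \<noteq> y" if "l \<le> ?i" for l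
      by (rule not_less_Least[OF le_less_trans[OF that]])
    with i show "before f x y b" unfolding before_iff by blast
  qed
qed

text \<open>The relation "traversed earlier" for a traversal that takes the orbits of the base
  points in list order, expressed without component indices or times.\<close>

definition desc_at :: "('a \<Rightarrow> 'a) \<Rightarrow> 'a list \<Rightarrow> 'a \<Rightarrow> 'a \<Rightarrow> bool" where
  "desc_at f bs x y \<longleftrightarrow>
     (\<exists>i<length bs. before f x y (bs ! i) \<and> (\<forall>i'<i. \<not> reach f (bs ! i') y))"

text \<open>On the first base orbit that meets either point, one of the two comes first.\<close>

lemma desc_at_total:
  assumes "\<exists>i<length bs. reach f (bs ! i) x" "\<exists>i<length bs. reach f (bs ! i) y" "x \<noteq> y"
  shows "desc_at f bs x y \<or> desc_at f bs y x"
proof -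
  let ?P = "\<lambda>i. i < length bs \<and> (reach f (bs ! i) x \<or> reach f (bs ! i) y)"
  define i where "i = (LEAST i. ?P i)"
  have i: "?P i" unfolding i_def by (rule LeastI_ex) (use assms in blast)
  have lt: "\<not> reach f (bs ! i') x \<and> \<not> reach f (bs ! i') y" if "i' < i" for i'
    using not_less_Least[of i' ?P] that i unfolding i_def by fastforce
  have "before f x y (bs ! i) \<or> before f y x (bs ! i)"
    using before_total[of f "bs ! i" x y] before_total[of f "bs ! i" y x] i assms(3) by blast
  then show ?thesis unfolding desc_at_def using i lt by blast
qed

text \<open>The two witnessing bases must coincide: if one preceded the other, its orbit would
  contain the point that the later witness excludes from all earlier orbits.\<close>

lemma desc_at_asym:
  assumes "desc_at f bs x y" "desc_at f bs y x" shows False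
proof -
  obtain i where i: "before f x y (bs ! i)" "\<forall>i'<i. \<not> reach f (bs ! i') y"
    using assms(1) unfolding desc_at_def by blast
  obtain j where j: "before f y x (bs ! j)" "\<forall>i'<j. \<not> reach f (bs ! i') x"
    using assms(2) unfolding desc_at_def by blast
  have "i = j" using i j before_reach by (metis linorder_neqE_nat)
  with i j show False using before_asym by metis
qed

text \<open>Common form of "multibased, descending and compatible with the colours" for the surface
  boundary and for the strand flow, so that one transfer lemma serves both.\<close>

definition dgood :: "('a \<Rightarrow> 'a) \<Rightarrow> 'a set \<Rightarrow> 'a list \<Rightarrow> ('a \<times> 'a) set \<Rightarrow> (nat \<times> 'a) set \<Rightarrow> bool" where
  "dgood f X bs P C \<longleftrightarrow>
     (\<forall>x\<in>X. \<exists>i<length bs. reach f (bs ! i) x) \<and>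
     (\<forall>i<length bs. \<forall>i'<length bs. i \<noteq> i' \<longrightarrow> \<not> reach f (bs ! i) (bs ! i')) \<and>
     (\<forall>(x, y)\<in>P. desc_at f bs x y) \<and>
     (\<forall>(i, x)\<in>C. reach f (bs ! i) x)"

text \<open>A semiconjugacy with waiting: a step of \<open>f\<close> is a step of \<open>g\<close>
  at points of \<open>E\<close> and no step elsewhere. The last axiom admits orbits without events
  only if they lie over a fixed point of \<open>g\<close> and fill its fibre; this is how a circle
  without arrows appears.\<close>

locale factor =
  fixes f :: "'a \<Rightarrow> 'a" and g :: "'b \<Rightarrow> 'b" and \<Phi> :: "'a \<Rightarrow> 'b" and X E :: "'a set"
  assumes fX: "x \<in> X \<Longrightarrow> f x \<in> X"
    and symf: "x \<in> X \<Longrightarrow> reach f x y \<Longrightarrow> reach f y x"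
    and event: "x \<in> X \<Longrightarrow> x \<in> E \<Longrightarrow> \<Phi> (f x) = g (\<Phi> x)"
    and nonevent: "x \<in> X \<Longrightarrow> x \<notin> E \<Longrightarrow> \<Phi> (f x) = \<Phi> x"
    and event_inj: "x \<in> X \<Longrightarrow> x \<in> E \<Longrightarrow> y \<in> X \<Longrightarrow> y \<in> E \<Longrightarrow> \<Phi> x = \<Phi> y \<Longrightarrow> x = y"
    and event_hit: "x \<in> X \<Longrightarrow> (\<exists>y\<in>E. reach f x y) \<or>
        (g (\<Phi> x) = \<Phi> x \<and> (\<forall>y\<in>X. \<Phi> y = \<Phi> x \<longrightarrow> reach f x y))"
begin

lemma reach_map:
  assumes "reach f x y" "x \<in> X" shows "reach g (\<Phi> x) (\<Phi> y)"
proof -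
  have "x \<in> X \<longrightarrow> reach g (\<Phi> x) (\<Phi> y)"
    using assms(1)
  proof (induction rule: reach_induct)
    case refl then show ?case by simp
  next
    case (step x) then show ?case using fX event nonevent reach_step' by metis
  qed
  with assms show ?thesis by simp
qed

lemma reach_X: "reach f x y \<Longrightarrow> x \<in> X \<Longrightarrow> y \<in> X"
  using reach_closed fX by metis

text \<open>Waiting for the next event leaves \<Phi> unchanged, so no point outside the fibre of
  \<open>x\<close> is met meanwhile. Hence an order statement that holds at the event already holds
  at \<open>x\<close>.\<close>

lemma next_event:
  assumes "reach f x y" "y \<in> E" "x \<in> X"
  shows "\<exists>e\<in>E. reach f x e \<and> \<Phi> e = \<Phi> x \<and>
           (\<forall>z w. \<Phi> x \<noteq> \<Phi> z \<longrightarrow> before f w z e \<longrightarrow> before f w z x)"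
proof -
  have "x \<in> X \<longrightarrow> (\<exists>e\<in>E. reach f x e \<and> \<Phi> e = \<Phi> x \<and>
           (\<forall>z w. \<Phi> x \<noteq> \<Phi> z \<longrightarrow> before f w z e \<longrightarrow> before f w z x))"
    using assms(1)
  proof (induction rule: reach_induct)
    case refl then show ?case using assms(2) reach_refl by metis
  next
    case (step x)
    show ?case
    proof (cases "x \<in> E")
      case True then show ?thesis using reach_refl by metis
    next
      case False
      show ?thesis
      proof
        assume x: "x \<in> X"
        then obtain e where e: "e \<in> E" "reach f (f x) e" "\<Phi> e = \<Phi> x"
          "\<forall>z w. \<Phi> x \<noteq> \<Phi> z \<longrightarrow> before f w z e \<longrightarrow> before f w z (f x)"
          using step nonevent[OF x False] fX by metis
        then show "\<exists>e\<in>E. reach f x e \<and> \<Phi> e = \<Phi> x \<and>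
           (\<forall>z w. \<Phi> x \<noteq> \<Phi> z \<longrightarrow> before f w z e \<longrightarrow> before f w z x)"
          using reach_step' before.later by metis
      qed
    qed
  qed
  with assms show ?thesis by simp
qed

text \<open>Both points wait for an event of their common fibre, and there is only one; reversing
  one of the two paths joins them. If one of them meets no event, the last axiom of the locale
  applies.\<close>

lemma fibre_connected:
  assumes "x \<in> X" "y \<in> X" "\<Phi> x = \<Phi> y" shows "reach f x y"
proof -
  consider "\<exists>e\<in>E. reach f x e" "\<exists>e\<in>E. reach f y e" | "reach f x y" | "reach f y x"
    using event_hit assms by metis
  then show ?thesis
  proof cases
    case 1
    obtain e where e: "e \<in> E" "reach f x e" "\<Phi> e = \<Phi> x" using 1(1) next_event assms(1) by metis
    obtain d where d: "d \<in> E" "reach f y d" "\<Phi> d = \<Phi> y" using 1(2) next_event assms(2) by metis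
    have "e = d" using e d event_inj reach_X assms by metis
    then show ?thesis using e d symf assms reach_trans by metis
  qed (use symf assms in auto)
qed

lemma reach_iff:
  assumes "b \<in> X" "x \<in> X" shows "reach g (\<Phi> b) (\<Phi> x) \<longleftrightarrow> reach f b x"
proof
  assume r: "reach g (\<Phi> b) (\<Phi> x)"
  \<comment> \<open>The claim is made for the whole fibre because the lift of a step of
    \<open>g\<close> starts at the event of the fibre and not at the given point.\<close>
  have "\<forall>b\<in>X. \<Phi> b = B \<longrightarrow> reach f b x" if "reach g B (\<Phi> x)" for B
    using that
  proof (induction rule: reach_induct)
    case refl then show ?case using fibre_connected assms by metis
  next
    case (step B)
    show ?case
    proof (intro ballI impI)
      fix b assume b: "b \<in> X" "\<Phi> b = B"
      consider "\<exists>e\<in>E. reach f b e" | "g (\<Phi> b) = \<Phi> b" using event_hit b by metis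
      then show "reach f b x"
      proof cases
        case 1
        then obtain e where e: "e \<in> E" "reach f b e" "\<Phi> e = B" using next_event b by metis
        then have "\<Phi> (f e) = g B" "f e \<in> X" using event fX reach_X b by metis+
        then have "reach f (f e) x" using step by metis
        then show ?thesis using e reach_step' reach_trans by metis
      next
        \<comment> \<open>At a fixed point of \<open>g\<close> the induction hypothesis speaks about
          the same fibre.\<close>
        case 2 then show ?thesis using step b by metis
      qed
    qed
  qed
  then show "reach f b x" using r assms by blast
qed (use reach_map assms in auto)

text \<open>An event is the only event of its fibre, so a visit of \<open>g\<close> to its image is,
  after the pending wait, a visit of \<open>f\<close> to the event itself. Among other points of a
  fibre the order is lost under \<Phi>.\<close>

lemma before_map_iff:
  assumes "b \<in> X" "x \<in> X" "x \<in> E" "y \<in> X" "y \<in> E"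
  shows "before g (\<Phi> x) (\<Phi> y) (\<Phi> b) \<longleftrightarrow> before f x y b"
proof
  assume "before f x y b"
  then have "b \<in> X \<longrightarrow> before g (\<Phi> x) (\<Phi> y) (\<Phi> b)"
  proof induction
    case here then show ?case using assms event_inj before.here by metis
  next
    case (later b)
    then show ?case using fX event nonevent event_inj assms before.later by metis
  qed
  with assms show "before g (\<Phi> x) (\<Phi> y) (\<Phi> b)" by simp
next
  assume r: "before g (\<Phi> x) (\<Phi> y) (\<Phi> b)"
  have "\<forall>b\<in>X. \<Phi> b = B \<longrightarrow> before f x y b" if "before g (\<Phi> x) (\<Phi> y) B" for B
    using that
  proof induction
    case here
    show ?case
    proof (intro ballI impI)
      fix b assume b: "b \<in> X" "\<Phi> b = \<Phi> x"
      then have "reach f b x" using fibre_connected assms by metis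
      then obtain e where e: "e \<in> E" "reach f b e" "\<Phi> e = \<Phi> b"
        "\<forall>z w. \<Phi> b \<noteq> \<Phi> z \<longrightarrow> before f w z e \<longrightarrow> before f w z b"
        using next_event assms b by metis
      have "e = x" using e b assms event_inj reach_X by metis
      moreover have "before f x y x" using here before.here by metis
      ultimately show "before f x y b" using e(4) b here by metis
    qed
  next
    case (later B)
    show ?case
    proof (intro ballI impI)
      fix b assume b: "b \<in> X" "\<Phi> b = B"
      consider "\<exists>e\<in>E. reach f b e" | "g (\<Phi> b) = \<Phi> b" using event_hit b by metis
      then show "before f x y b"
      proof cases
        case 1
        then obtain e where e: "e \<in> E" "reach f b e" "\<Phi> e = \<Phi> b"
          "\<forall>z w. \<Phi> b \<noteq> \<Phi> z \<longrightarrow> before f w z e \<longrightarrow> before f w z b"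
          using next_event b by metis
        then have "\<Phi> (f e) = g B" "f e \<in> X" using event fX reach_X b by metis+
        then have "before f x y (f e)" using later by metis
        moreover have "e \<noteq> y" using e b later by metis
        ultimately have "before f x y e" using before.later by metis
        then show ?thesis using e(4) b later by metis
      next
        case 2 then show ?thesis using later b by metis
      qed
    qed
  qed
  then show "before f x y b" using r assms by blast
qed

lemma desc_at_map_iff:
  assumes "set bs \<subseteq> X" "x \<in> X" "x \<in> E" "y \<in> X" "y \<in> E"
  shows "desc_at g (map \<Phi> bs) (\<Phi> x) (\<Phi> y) \<longleftrightarrow> desc_at f bs x y"
proof -
  have "bs ! i \<in> X" if "i < length bs" for i using that assms(1) by auto
  then show ?thesis unfolding desc_at_def
    using before_map_iff reach_iff assms by (auto cong: conj_cong)
qed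

text \<open>Only the points of \<open>P\<close> have to be events, because only they are compared in
  order; bases and coloured points enter through reachability and may be waiting points.\<close>

lemma dgood_map_iff:
  assumes "set bs \<subseteq> X" "P \<subseteq> (X \<inter> E) \<times> (X \<inter> E)" "C \<subseteq> {..<length bs} \<times> X"
  shows "dgood g (\<Phi> ` X) (map \<Phi> bs) (map_prod \<Phi> \<Phi> ` P) (map_prod id \<Phi> ` C) \<longleftrightarrow> dgood f X bs P C"
proof -
  have bs: "bs ! i \<in> X" if "i < length bs" for i using that assms(1) by auto
  have "(\<forall>x\<in>\<Phi> ` X. \<exists>i<length bs. reach g (map \<Phi> bs ! i) x) \<longleftrightarrow>
      (\<forall>x\<in>X. \<exists>i<length bs. reach f (bs ! i) x)"
    using bs reach_iff by (auto cong: conj_cong)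
  moreover have "(\<forall>i<length bs. \<forall>i'<length bs. i \<noteq> i' \<longrightarrow> \<not> reach g (map \<Phi> bs ! i) (map \<Phi> bs ! i'))
     \<longleftrightarrow> (\<forall>i<length bs. \<forall>i'<length bs. i \<noteq> i' \<longrightarrow> \<not> reach f (bs ! i) (bs ! i'))"
    using bs reach_iff by (auto cong: conj_cong)
  moreover have "(\<forall>(x, y)\<in>map_prod \<Phi> \<Phi> ` P. desc_at g (map \<Phi> bs) x y) \<longleftrightarrow>
     (\<forall>(x, y)\<in>P. desc_at f bs x y)"
  proof -
    have "desc_at g (map \<Phi> bs) (\<Phi> (fst z)) (\<Phi> (snd z)) \<longleftrightarrow> desc_at f bs (fst z) (snd z)" if "z \<in> P" for z
      using desc_at_map_iff[OF assms(1)] subsetD[OF assms(2) that] by (simp add: mem_Times_iff)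
    then show ?thesis by (simp add: case_prod_beta)
  qed
  moreover have "(\<forall>(i, x)\<in>map_prod id \<Phi> ` C. reach g (map \<Phi> bs ! i) x) \<longleftrightarrow>
     (\<forall>(i, x)\<in>C. reach f (bs ! i) x)"
  proof -
    have "reach g (map \<Phi> bs ! fst z) (\<Phi> (snd z)) \<longleftrightarrow> reach f (bs ! fst z) (snd z)" if "z \<in> C" for z
      using reach_iff bs subsetD[OF assms(3) that] by (simp add: mem_Times_iff)
    then show ?thesis by (simp add: case_prod_beta)
  qed
  ultimately show ?thesis unfolding dgood_def by simp
qed

end

section \<open>Homomorphisms of diagrams as circular coverings\<close>

text \<open>Turns distinctness of the concatenated circles into a unique place (circle, position)
  for each endpoint.\<close>

lemma distinct_concat_nth:
  assumes "distinct (concat xss)" "c < length xss" "t < length (xss ! c)"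
    "c' < length xss" "t' < length (xss ! c')" "xss ! c ! t = xss ! c' ! t'"
  shows "c = c' \<and> t = t'"
  using assms
proof (induction xss arbitrary: c c')
  case Nil then show ?case by simp
next
  case (Cons xs xss)
  have disj: "set xs \<inter> \<Union> (set ` set xss) = {}" and d: "distinct xs" "distinct (concat xss)"
    using Cons.prems(1) by auto
  have mem: "xss ! i ! s \<in> \<Union> (set ` set xss)" if "i < length xss" "s < length (xss ! i)" for i s
    using that by (meson UN_I nth_mem)
  show ?case
  proof (cases c)
    case 0
    show ?thesis
    proof (cases c')
      case 0 then show ?thesis using \<open>c = 0\<close> d(1) Cons.prems by (simp add: nth_eq_iff_index_eq)
    next
      case (Suc j)
      then show ?thesis using \<open>c = 0\<close> mem[of j t'] disj Cons.prems
        by (metis IntI Suc_less_eq empty_iff length_Cons nth_Cons_0 nth_Cons_Suc nth_mem)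
    qed
  next
    case (Suc i)
    show ?thesis
    proof (cases c')
      case 0 then show ?thesis using Suc mem[of i t] disj Cons.prems
        by (metis IntI Suc_less_eq empty_iff length_Cons nth_Cons_0 nth_Cons_Suc nth_mem)
    next
      case (Suc j)
      then show ?thesis using \<open>c = Suc i\<close> Cons.IH[OF d(2), of i j] Cons.prems by simp
    qed
  qed
qed

lemma wf_adiag_nth_eq:
  assumes "wf_adiag A" "c < length (cir A)" "t < length (cir A ! c)"
    "c' < length (cir A)" "t' < length (cir A ! c')" "cir A ! c ! t = cir A ! c' ! t'"
  shows "c = c' \<and> t = t'"
  using distinct_concat_nth[of "cir A"] assms unfolding wf_adiag_def by blast

lemma epos_nth:
  assumes "wf_adiag A" "c < length (cir A)" "t < length (cir A ! c)"
  shows "epos A (cir A ! c ! t) = (c, t)"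
  unfolding epos_def
proof (rule the_equality)
  fix p assume "fst p < length (cir A) \<and> snd p < length (cir A ! fst p) \<and> cir A ! fst p ! snd p = cir A ! c ! t"
  then show "p = (c, t)" using wf_adiag_nth_eq assms by (metis prod.collapse)
qed (use assms in simp)

lemma wf_adiag_in_iff:
  assumes "wf_adiag A"
  shows "(\<exists>c t. c < length (cir A) \<and> t < length (cir A ! c) \<and> cir A ! c ! t = (a, b)) \<longleftrightarrow> a < narr A"
proof -
  have "a < narr A \<longleftrightarrow> (a, b) \<in> set (concat (cir A))"
    using assms unfolding wf_adiag_def by simp
  also have "\<dots> \<longleftrightarrow> (\<exists>c<length (cir A). (a, b) \<in> set (cir A ! c))"
    by (auto simp: in_set_conv_nth[of _ "cir A"]) (metis nth_mem)
  finally show ?thesis by (auto simp: in_set_conv_nth)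
qed

lemma wf_adiag_nth:
  assumes "wf_adiag A" "c < length (cir A)" "t < length (cir A ! c)"
  shows "fst (cir A ! c ! t) < narr A"
  using wf_adiag_in_iff[OF assms(1), of "fst (cir A ! c ! t)" "snd (cir A ! c ! t)"] assms by auto

lemma eposE:
  assumes "wf_adiag A" "a < narr A"
  obtains c t where "c < length (cir A)" "t < length (cir A ! c)" "cir A ! c ! t = (a, b)"
    "epos A (a, b) = (c, t)"
  using wf_adiag_in_iff[OF assms(1), of a b] assms epos_nth by metis

lemma Suc_pred_mod: "s < l \<Longrightarrow> ((s + l - 1) mod l + 1) mod l = (s::nat)"
  by (cases s) (auto simp: mod_Suc)

lemma arc_endingE:
  assumes "wf_adiag A" "a < narr A"
  obtains c t where "c < length (cir A)" "t < length (cir A ! c)"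
    "cir A ! c ! ((t + 1) mod length (cir A ! c)) = (a, b)" "arc_ending A (a, b) = (c, t)"
proof -
  obtain c s where cs: "c < length (cir A)" "s < length (cir A ! c)" "cir A ! c ! s = (a, b)"
    "epos A (a, b) = (c, s)" using eposE[OF assms] by metis
  let ?l = "length (cir A ! c)" let ?t = "(s + ?l - 1) mod ?l"
  have "?t < ?l" using cs by (intro mod_less_divisor) auto
  moreover have "cir A ! c ! ((?t + 1) mod ?l) = (a, b)" using cs Suc_pred_mod[of s ?l] by simp
  moreover have "arc_ending A (a, b) = (c, ?t)" unfolding arc_ending_def by (simp add: cs Let_def)
  ultimately show ?thesis using cs that by blast
qed

lemma arc_ending_arcs: "wf_adiag A \<Longrightarrow> a < narr A \<Longrightarrow> arc_ending A (a, b) \<in> arcs A"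
  by (erule (1) arc_endingE[of A a b]) (auto simp: arcs_def)

lemma arc_ending_inj:
  assumes "wf_adiag A" "a < narr A" "a' < narr A" "arc_ending A (a, b) = arc_ending A (a', b')"
  shows "a = a' \<and> b = b'"
  using arc_endingE[OF assms(1,2), of b] arc_endingE[OF assms(1,3), of b'] assms(4)
  by (metis Pair_inject)

text \<open>Arcs are indexed by their initial endpoint, so the place of the other end of the band
  already is the next arc.\<close>

lemma next_arc_ending:
  assumes "wf_adiag A" "a < narr A"
  shows "next_arc A (arc_ending A (a, b)) = epos A (a, \<not> b)"
  by (rule arc_endingE[OF assms, of b]) (auto simp: next_arc_def Let_def)

lemma next_arc_Nil: "cir A ! c = [] \<Longrightarrow> next_arc A (c, t) = (c, t)"
  by (simp add: next_arc_def)

section \<open>Cyclic distances and marked positions on a circle\<close>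

definition cdist :: "nat \<Rightarrow> nat \<Rightarrow> nat \<Rightarrow> nat" where
  "cdist l a b = (b + l - a) mod l"

lemma cdist_if: "a < l \<Longrightarrow> b < l \<Longrightarrow> cdist l a b = (if a \<le> b then b - a else b + l - a)"
  unfolding cdist_def by (auto simp: mod_if)

lemma cdist_self [simp]: "a < l \<Longrightarrow> cdist l a a = 0"
  by (simp add: cdist_if)

lemma cdist_inj: "a < l \<Longrightarrow> a' < l \<Longrightarrow> b < l \<Longrightarrow> cdist l a b = cdist l a' b \<Longrightarrow> a = a'"
  by (auto simp: cdist_if split: if_splits)

lemma cdist_0: "a < l \<Longrightarrow> b < l \<Longrightarrow> cdist l a b = 0 \<Longrightarrow> a = b"
  by (auto simp: cdist_if split: if_splits)

text \<open>A circle with a single mark has an arc of full length, so distance 0 to the next mark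
  counts as a whole turn; this is the final case distinction in \<open>covers\<close>.\<close>

definition gap :: "nat \<Rightarrow> nat \<Rightarrow> nat \<Rightarrow> nat" where
  "gap l a b = (if cdist l a b = 0 then l else cdist l a b)"

text \<open>In an increasing list the cyclic successor is the nearest mark ahead; the only irregular
  step is from the last entry back to the first.\<close>

lemma sorted_gap:
  assumes "sorted_wrt (<) qs" "set qs \<subseteq> {..<l}" "t < length qs" "s < length qs"
  shows "cdist l (qs ! t) (qs ! s) = 0 \<or>
    gap l (qs ! t) (qs ! ((t + 1) mod length qs)) \<le> cdist l (qs ! t) (qs ! s)"
proof -
  have lt: "qs ! i < l" if "i < length qs" for i using assms(2) that by (metis lessThan_iff nth_mem subsetD)
  have mono: "qs ! i < qs ! j" if "i < j" "j < length qs" for i j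
    using assms(1) that by (simp add: sorted_wrt_nth_less)
  let ?u = "(t + 1) mod length qs"
  have u: "?u < length qs" using assms(3) by (intro mod_less_divisor) auto
  consider "s = t" | "s < t" "?u = t + 1" | "s < t" "?u = 0" "t + 1 = length qs"
    | "t < s" "?u = t + 1"
    using assms(3,4) by (metis Suc_eq_plus1 Suc_lessI linorder_neqE_nat mod_less mod_self not_less_eq)
  then show ?thesis
  proof cases
    case 1 then show ?thesis using lt assms(3) by simp
  next
    case 2
    then have "qs ! s < qs ! t" "qs ! t < qs ! ?u" using mono u assms(3) by auto
    then show ?thesis using lt[OF assms(3)] lt[OF assms(4)] lt[OF u] by (simp add: cdist_if gap_def)
  next
    case 3
    then have "qs ! s < qs ! t" "qs ! ?u \<le> qs ! s" "qs ! ?u < qs ! t"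
      using mono[of 0 s] mono[of s t] mono[of 0 t] assms(3,4) by (cases "s = 0"; simp)+
    then show ?thesis using lt[OF assms(3)] lt[OF assms(4)] lt[OF u] by (simp add: cdist_if gap_def)
  next
    case 4
    then have "qs ! t < qs ! ?u" "qs ! ?u \<le> qs ! s"
      using mono u assms(3,4) by (auto simp: le_less) (metis Suc_lessI)
    then show ?thesis using lt[OF assms(3)] lt[OF assms(4)] lt[OF u] by (simp add: cdist_if gap_def)
  qed
qed

lemma rotate_sorted_gap:
  assumes "sorted_wrt (<) (rotate r qs)" "set qs \<subseteq> {..<l}" "t < length qs" "q \<in> set qs"
  shows "cdist l (qs ! t) q = 0 \<or>
    gap l (qs ! t) (qs ! ((t + 1) mod length qs)) \<le> cdist l (qs ! t) q"
proof -
  let ?n = "length qs"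
  have ex: "\<exists>i<?n. (r + i) mod ?n = j" if "j < ?n" for j
  proof -
    \<comment> \<open>Adding \<open>?n - r mod ?n\<close> undoes the rotation by \<open>r\<close>
      without leaving the natural numbers.\<close>
    have "(r + (j + (?n - r mod ?n)) mod ?n) mod ?n = (r mod ?n + (j + (?n - r mod ?n))) mod ?n"
      by (simp add: mod_simps)
    also have "\<dots> = (j + ?n) mod ?n"
      using mod_less_divisor[of ?n r] that by (metis (no_types, opaque_lifting) add.left_commute le_add_diff_inverse less_imp_le_nat gr_implies_not0 gr0I)
    finally have "(r + (j + (?n - r mod ?n)) mod ?n) mod ?n = j" using that by simp
    moreover have "(j + (?n - r mod ?n)) mod ?n < ?n" using that by (intro mod_less_divisor) auto
    ultimately show ?thesis by blast
  qed
  obtain s where s: "s < ?n" "q = qs ! s" using assms(4) by (metis in_set_conv_nth)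
  obtain t' where t': "t' < ?n" "(r + t') mod ?n = t" using ex assms(3) by blast
  obtain s' where s': "s' < ?n" "(r + s') mod ?n = s" using ex s by blast
  have u: "(r + (t' + 1) mod ?n) mod ?n = (t + 1) mod ?n"
    using t'(2) by (metis add.assoc mod_add_left_eq mod_add_right_eq)
  have ult: "(t' + 1) mod ?n < ?n" using assms(3) by (intro mod_less_divisor) auto
  show ?thesis
    using sorted_gap[OF assms(1), of l t' s'] assms(2) t' s' s u ult by (simp add: nth_rotate)
qed

text \<open>A homomorphism without its base points, so that covering arcs are available before base
  points are chosen; the diagram of a state receives its base points in this way.\<close>

definition precore :: "adiag \<Rightarrow> adiag \<Rightarrow> nat list \<Rightarrow> nat list \<Rightarrow> bool" where
  "precore A B \<pi> \<tau> \<longleftrightarrow>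
     length \<pi> = length (cir A) \<and> distinct \<pi> \<and> set \<pi> = {..<length (cir B)} \<and>
     length \<tau> = narr A \<and> distinct \<tau> \<and> set \<tau> \<subseteq> {..<narr B} \<and>
     (\<forall>c<length (cir A). \<forall>e\<in>set (cir A ! c). (\<tau> ! fst e, snd e) \<in> set (cir B ! (\<pi> ! c))) \<and>
     (\<forall>c<length (cir A). \<exists>r. sorted_wrt (<) (rotate r (map (gpos B \<tau>) (cir A ! c))))"

lemma hom_core_iff:
  "hom_core A B \<pi> \<tau> \<longleftrightarrow> precore A B \<pi> \<tau> \<and> length (bas A) = length (bas B) \<and>
     (\<forall>i<length (bas A). covers A B \<pi> \<tau> (bas A ! i) (bas B ! i))"
  unfolding hom_core_def precore_def by blast

locale prehom =
  fixes A B \<pi> \<tau>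
  assumes wfA: "wf_adiag A" and wfB: "wf_adiag B" and core: "precore A B \<pi> \<tau>"
begin

lemma len_\<pi>: "length \<pi> = length (cir A)" and dist_\<pi>: "distinct \<pi>"
  and set_\<pi>: "set \<pi> = {..<length (cir B)}" and len_\<tau>: "length \<tau> = narr A"
  and dist_\<tau>: "distinct \<tau>" and set_\<tau>: "set \<tau> \<subseteq> {..<narr B}"
  using core unfolding precore_def by auto

lemma \<pi>_lt: "c < length (cir A) \<Longrightarrow> \<pi> ! c < length (cir B)"
  using len_\<pi> set_\<pi> by (metis lessThan_iff nth_mem)

lemma \<pi>_inj: "c < length (cir A) \<Longrightarrow> d < length (cir A) \<Longrightarrow> \<pi> ! c = \<pi> ! d \<Longrightarrow> c = d"
  using len_\<pi> dist_\<pi> by (metis nth_eq_iff_index_eq)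

lemma \<pi>_surj: "c' < length (cir B) \<Longrightarrow> \<exists>c<length (cir A). \<pi> ! c = c'"
  using len_\<pi> set_\<pi> by (metis in_set_conv_nth lessThan_iff)

lemma \<tau>_lt: "a < narr A \<Longrightarrow> \<tau> ! a < narr B"
  using len_\<tau> set_\<tau> by (metis lessThan_iff nth_mem subsetD)

lemma gpos_props:
  assumes "c < length (cir A)" "e \<in> set (cir A ! c)"
  shows "gpos B \<tau> e < length (cir B ! (\<pi> ! c))"
    and "cir B ! (\<pi> ! c) ! gpos B \<tau> e = (\<tau> ! fst e, snd e)"
proof -
  have "(\<tau> ! fst e, snd e) \<in> set (cir B ! (\<pi> ! c))" using core assms unfolding precore_def by blast
  then obtain q where q: "q < length (cir B ! (\<pi> ! c))" "cir B ! (\<pi> ! c) ! q = (\<tau> ! fst e, snd e)"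
    by (metis in_set_conv_nth)
  then have "gpos B \<tau> e = q"
    unfolding gpos_def using epos_nth[OF wfB \<pi>_lt[OF assms(1)] q(1)] by simp
  with q show "gpos B \<tau> e < length (cir B ! (\<pi> ! c))"
    and "cir B ! (\<pi> ! c) ! gpos B \<tau> e = (\<tau> ! fst e, snd e)" by auto
qed

definition qs :: "nat \<Rightarrow> nat list" where
  "qs c = map (gpos B \<tau>) (cir A ! c)"

lemma length_qs [simp]: "length (qs c) = length (cir A ! c)"
  by (simp add: qs_def)

lemma qs_lt: "c < length (cir A) \<Longrightarrow> t < length (cir A ! c) \<Longrightarrow> qs c ! t < length (cir B ! (\<pi> ! c))"
  using gpos_props(1) by (simp add: qs_def)

lemma cir_qs:
  "c < length (cir A) \<Longrightarrow> t < length (cir A ! c) \<Longrightarrow>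
   cir B ! (\<pi> ! c) ! (qs c ! t) = (\<tau> ! fst (cir A ! c ! t), snd (cir A ! c ! t))"
  using gpos_props(2) by (simp add: qs_def)

text \<open>\<open>A\<close> contains both ends of each of its arrows, and the unique place of an
  endpoint in \<open>B\<close> decides which circle of \<open>A\<close> it comes from. Hence the
  marks depend on the state alone, which is the source of rigidity.\<close>

lemma set_qs:
  assumes "c < length (cir A)"
  shows "set (qs c) = {q. q < length (cir B ! (\<pi> ! c)) \<and> fst (cir B ! (\<pi> ! c) ! q) \<in> set \<tau>}"
proof (intro set_eqI iffI)
  fix q assume "q \<in> set (qs c)"
  then obtain t where t: "t < length (cir A ! c)" "q = qs c ! t" by (metis in_set_conv_nth length_qs)
  moreover have "\<tau> ! fst (cir A ! c ! t) \<in> set \<tau>"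
    using wf_adiag_nth[OF wfA assms t(1)] len_\<tau> by simp
  ultimately show "q \<in> {q. q < length (cir B ! (\<pi> ! c)) \<and> fst (cir B ! (\<pi> ! c) ! q) \<in> set \<tau>}"
    using qs_lt assms cir_qs by simp
next
  fix q assume "q \<in> {q. q < length (cir B ! (\<pi> ! c)) \<and> fst (cir B ! (\<pi> ! c) ! q) \<in> set \<tau>}"
  then have q: "q < length (cir B ! (\<pi> ! c))" "fst (cir B ! (\<pi> ! c) ! q) \<in> set \<tau>" by auto
  then obtain a where a: "a < narr A" "fst (cir B ! (\<pi> ! c) ! q) = \<tau> ! a"
    using len_\<tau> by (metis in_set_conv_nth)
  obtain d t where d: "d < length (cir A)" "t < length (cir A ! d)"
     "cir A ! d ! t = (a, snd (cir B ! (\<pi> ! c) ! q))"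
    using eposE[OF wfA a(1)] by metis
  have "cir B ! (\<pi> ! d) ! (qs d ! t) = cir B ! (\<pi> ! c) ! q"
    using cir_qs[OF d(1,2)] d(3) a(2) by (simp add: prod_eq_iff)
  then have "\<pi> ! d = \<pi> ! c \<and> qs d ! t = q"
    using wf_adiag_nth_eq[OF wfB] \<pi>_lt d qs_lt assms q(1) by metis
  then show "q \<in> set (qs c)" using \<pi>_inj d assms by (metis length_qs nth_mem)
qed

lemma qs_inj:
  assumes "c < length (cir A)" "t < length (cir A ! c)" "s < length (cir A ! c)" "qs c ! t = qs c ! s"
  shows "t = s"
proof -
  have "\<tau> ! fst (cir A ! c ! t) = \<tau> ! fst (cir A ! c ! s)" "snd (cir A ! c ! t) = snd (cir A ! c ! s)"
    using cir_qs[OF assms(1,2)] cir_qs[OF assms(1,3)] assms(4) by auto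
  then have "cir A ! c ! t = cir A ! c ! s"
    using len_\<tau> dist_\<tau> wf_adiag_nth[OF wfA assms(1,2)] wf_adiag_nth[OF wfA assms(1,3)]
    by (simp add: prod_eq_iff nth_eq_iff_index_eq)
  then show ?thesis using wf_adiag_nth_eq[OF wfA] assms by blast
qed

lemma gap_qs:
  assumes "c < length (cir A)" "t < length (cir A ! c)" "q \<in> set (qs c)"
  shows "cdist (length (cir B ! (\<pi> ! c))) (qs c ! t) q = 0 \<or>
    gap (length (cir B ! (\<pi> ! c))) (qs c ! t) (qs c ! ((t + 1) mod length (cir A ! c)))
      \<le> cdist (length (cir B ! (\<pi> ! c))) (qs c ! t) q"
proof -
  obtain r where "sorted_wrt (<) (rotate r (qs c))" using core assms(1) unfolding precore_def qs_def by blast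
  moreover have "set (qs c) \<subseteq> {..<length (cir B ! (\<pi> ! c))}" using set_qs assms(1) by auto
  ultimately show ?thesis using rotate_sorted_gap[of r "qs c"] assms by simp
qed

lemma covers_gap:
  assumes "t < length (cir A ! c)"
  shows "covers A B \<pi> \<tau> (c, t) (c', t') \<longleftrightarrow> c' = \<pi> ! c \<and>
     cdist (length (cir B ! c')) (qs c ! t) t'
       < gap (length (cir B ! c')) (qs c ! t) (qs c ! ((t + 1) mod length (cir A ! c)))"
proof -
  have "(t + 1) mod length (cir A ! c) < length (cir A ! c)" using assms by (intro mod_less_divisor) auto
  then show ?thesis using assms
    by (auto simp: covers_def gap_def cdist_def qs_def Let_def)
qed

text \<open>The image of the arc starting at \<open>q\<close> contains a point exactly if \<open>q\<close> is the last
  marked position cyclically at or before it.\<close>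

lemma covers_least:
  assumes "c < length (cir A)" "t < length (cir A ! c)" "t' < length (cir B ! (\<pi> ! c))"
  shows "covers A B \<pi> \<tau> (c, t) (\<pi> ! c, t') \<longleftrightarrow>
    (\<forall>q\<in>set (qs c). cdist (length (cir B ! (\<pi> ! c))) (qs c ! t) t'
         \<le> cdist (length (cir B ! (\<pi> ! c))) q t')"
proof -
  let ?l = "length (cir B ! (\<pi> ! c))" let ?u = "(t + 1) mod length (cir A ! c)"
  have u: "?u < length (cir A ! c)" using assms(2) by (intro mod_less_divisor) auto
  have l: "qs c ! t < ?l" "qs c ! ?u < ?l" using qs_lt assms u by auto
  show ?thesis
  proof
    assume "covers A B \<pi> \<tau> (c, t) (\<pi> ! c, t')"
    then have cv: "cdist ?l (qs c ! t) t' < gap ?l (qs c ! t) (qs c ! ?u)" using covers_gap assms(2) by simp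
    show "\<forall>q\<in>set (qs c). cdist ?l (qs c ! t) t' \<le> cdist ?l q t'"
    proof
      fix q assume q: "q \<in> set (qs c)"
      then have "q < ?l" using set_qs assms(1) by simp
      then show "cdist ?l (qs c ! t) t' \<le> cdist ?l q t'"
        using gap_qs[OF assms(1,2) q] cv l assms(3) by (auto simp: cdist_if split: if_splits)
    qed
  next
    assume least: "\<forall>q\<in>set (qs c). cdist ?l (qs c ! t) t' \<le> cdist ?l q t'"
    have "qs c ! ?u \<in> set (qs c)" using u by simp
    then have "cdist ?l (qs c ! t) t' \<le> cdist ?l (qs c ! ?u) t'" using least by blast
    then have "cdist ?l (qs c ! t) t' < gap ?l (qs c ! t) (qs c ! ?u)"
      using l assms(3) by (auto simp: gap_def cdist_if split: if_splits)
    then show "covers A B \<pi> \<tau> (c, t) (\<pi> ! c, t')" using covers_gap assms(2) by simp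
  qed
qed

lemma covers_fst: "covers A B \<pi> \<tau> \<alpha> \<beta> \<Longrightarrow> fst \<beta> = \<pi> ! fst \<alpha>"
  by (auto simp: covers_def Let_def split: prod.splits)

text \<open>The covering arc starts at the mark with the smallest distance to \<beta>, and distances
  to a fixed position separate the marks. On a circle without marks the single arc covers
  everything.\<close>

lemma ex1_covers:
  assumes "\<beta> \<in> arcs B"
  shows "\<exists>!\<alpha>. \<alpha> \<in> arcs A \<and> covers A B \<pi> \<tau> \<alpha> \<beta>"
proof -
  obtain c' t' where \<beta>: "\<beta> = (c', t')" by fastforce
  have c': "c' < length (cir B)" "t' < max 1 (length (cir B ! c'))" using assms \<beta> by (auto simp: arcs_def)
  obtain c where c: "c < length (cir A)" "\<pi> ! c = c'" using \<pi>_surj c' by blast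
  show ?thesis
  proof (cases "cir A ! c = []")
    case True
    show ?thesis
    proof (rule ex1I[of _ "(c, 0)"])
      show "(c, 0) \<in> arcs A \<and> covers A B \<pi> \<tau> (c, 0) \<beta>"
        using c True \<beta> by (auto simp: arcs_def covers_def)
      fix \<alpha> assume a: "\<alpha> \<in> arcs A \<and> covers A B \<pi> \<tau> \<alpha> \<beta>"
      then have "fst \<alpha> < length (cir A)" "\<pi> ! fst \<alpha> = c'" using covers_fst \<beta> by (auto simp: arcs_def)
      then have "fst \<alpha> = c" using c \<pi>_inj by metis
      then show "\<alpha> = (c, 0)" using a True by (auto simp: arcs_def)
    qed
  next
    case False
    then have ne: "set (qs c) \<noteq> {}" by (simp add: qs_def)
    let ?l = "length (cir B ! c')"
    have "cir B ! c' \<noteq> []"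
    proof -
      obtain q where "q \<in> set (qs c)" using ne by (metis all_not_in_conv)
      then have "q < length (cir B ! c')" using set_qs[OF c(1)] c(2) by blast
      then show ?thesis by auto
    qed
    then have t': "t' < ?l" using c'(2) by (cases "cir B ! c'") auto
    define M where "M = Min ((\<lambda>q. cdist ?l q t') ` set (qs c))"
    have "M \<in> (\<lambda>q. cdist ?l q t') ` set (qs c)" unfolding M_def using ne by (intro Min_in) auto
    then obtain t where t: "t < length (cir A ! c)" "cdist ?l (qs c ! t) t' = M"
      by (auto simp: in_set_conv_nth)
    have le: "M \<le> cdist ?l q t'" if "q \<in> set (qs c)" for q unfolding M_def using that by simp
    show ?thesis
    proof (rule ex1I[of _ "(c, t)"])
      show "(c, t) \<in> arcs A \<and> covers A B \<pi> \<tau> (c, t) \<beta>"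
        using c t t' le \<beta> covers_least[OF c(1) t(1)] by (auto simp: arcs_def)
      fix \<alpha> assume a: "\<alpha> \<in> arcs A \<and> covers A B \<pi> \<tau> \<alpha> \<beta>"
      obtain d s where ds: "\<alpha> = (d, s)" by fastforce
      have "fst \<alpha> < length (cir A)" "\<pi> ! fst \<alpha> = c'" using a covers_fst \<beta> by (auto simp: arcs_def)
      then have d: "d = c" using c \<pi>_inj ds by auto
      have s: "s < length (cir A ! c)" using a ds d False by (cases "cir A ! c") (auto simp: arcs_def)
      have "cdist ?l (qs c ! s) t' \<le> cdist ?l (qs c ! t) t'"
        using a ds d \<beta> covers_least[OF c(1) s] t' t c by auto
      then have "cdist ?l (qs c ! s) t' = cdist ?l (qs c ! t) t'" using t(2) le[of "qs c ! s"] s by simp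
      then have "qs c ! s = qs c ! t" using cdist_inj t' qs_lt[OF c(1)] s t c by metis
      then show "\<alpha> = (c, t)" using ds d qs_inj c s t by metis
    qed
  qed
qed

definition cov :: "arc \<Rightarrow> arc" where
  "cov \<beta> = (THE \<alpha>. \<alpha> \<in> arcs A \<and> covers A B \<pi> \<tau> \<alpha> \<beta>)"

lemma cov_arcs: "\<beta> \<in> arcs B \<Longrightarrow> cov \<beta> \<in> arcs A"
  and covers_cov: "\<beta> \<in> arcs B \<Longrightarrow> covers A B \<pi> \<tau> (cov \<beta>) \<beta>"
  unfolding cov_def using theI'[OF ex1_covers] by auto

lemma cov_iff:
  assumes "\<beta> \<in> arcs B" "\<alpha> \<in> arcs A" shows "covers A B \<pi> \<tau> \<alpha> \<beta> \<longleftrightarrow> cov \<beta> = \<alpha>"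
  using ex1_covers[OF assms(1)] cov_arcs[OF assms(1)] covers_cov[OF assms(1)] assms(2) by blast

lemma \<pi>_cov: "\<beta> \<in> arcs B \<Longrightarrow> \<pi> ! fst (cov \<beta>) = fst \<beta>"
  using covers_cov covers_fst by metis

lemma nth_arcs: "c < length (cir B) \<Longrightarrow> t < length (cir B ! c) \<Longrightarrow> (c, t) \<in> arcs B"
  by (auto simp: arcs_def)

lemma cov_start:
  assumes "c' < length (cir B)" "t' < length (cir B ! c')" "cir B ! c' ! t' = (\<tau> ! a, b)" "a < narr A"
  shows "cov (c', t') = epos A (a, b)"
proof -
  obtain c t where c: "c < length (cir A)" "t < length (cir A ! c)" "cir A ! c ! t = (a, b)"
    "epos A (a, b) = (c, t)" using eposE[OF wfA assms(4)] by metis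
  have "\<pi> ! c = c' \<and> qs c ! t = t'"
    using wf_adiag_nth_eq[OF wfB] cir_qs[OF c(1,2)] c assms \<pi>_lt qs_lt by (metis fst_conv snd_conv)
  then have "covers A B \<pi> \<tau> (c, t) (c', t')"
    using covers_least[OF c(1,2), of t'] assms by auto
  then show ?thesis using cov_iff nth_arcs assms c by (auto simp: arcs_def)
qed

lemma cov_end:
  assumes "c' < length (cir B)" "t' < length (cir B ! c')"
    "cir B ! c' ! ((t' + 1) mod length (cir B ! c')) = (\<tau> ! a, b)" "a < narr A"
  shows "cov (c', t') = arc_ending A (a, b)"
proof -
  let ?l = "length (cir B ! c')" let ?u' = "(t' + 1) mod ?l"
  obtain c t where c: "c < length (cir A)" "t < length (cir A ! c)"
    "cir A ! c ! ((t + 1) mod length (cir A ! c)) = (a, b)"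
    "arc_ending A (a, b) = (c, t)" using arc_endingE[OF wfA assms(4)] by metis
  let ?u = "(t + 1) mod length (cir A ! c)"
  have u: "?u < length (cir A ! c)" using c(2) by (intro mod_less_divisor) auto
  have u': "?u' < ?l" using assms(2) by (intro mod_less_divisor) auto
  have eq: "\<pi> ! c = c' \<and> qs c ! ?u = ?u'"
    using wf_adiag_nth_eq[OF wfB, of "\<pi> ! c" "qs c ! ?u" c' ?u'] cir_qs[OF c(1) u] c assms \<pi>_lt[OF c(1)] qs_lt[OF c(1) u] u'
    by simp
  have q0: "qs c ! t < ?l" using qs_lt c eq by metis
  have "cdist ?l (qs c ! t) t' < gap ?l (qs c ! t) (qs c ! ?u)"
  \<comment> \<open>At the last position the next endpoint has index 0, and the distance is taken
    across the seam of the list.\<close>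
  proof (cases "t' + 1 = ?l")
    case True
    then have "?u' = 0" by simp
    moreover have "0 < ?l" using assms(2) by linarith
    ultimately show ?thesis using eq True q0 assms(2) by (auto simp: gap_def cdist_if split: if_splits)
  next
    case False
    then have "?u' = t' + 1" using assms(2) by simp
    then show ?thesis using eq q0 assms(2) u' by (auto simp: gap_def cdist_if split: if_splits)
  qed
  then have "covers A B \<pi> \<tau> (c, t) (c', t')" using covers_gap c(2) eq by simp
  then show ?thesis using cov_iff nth_arcs assms c by (auto simp: arcs_def)
qed

text \<open>Moving past an unmarked endpoint raises the distance from every mark by one, so the
  nearest mark stays nearest: a crossing outside the state is invisible in \<open>A\<close>.\<close>

lemma cov_skip:
  assumes "c' < length (cir B)" "t' < length (cir B ! c')"
    "fst (cir B ! c' ! ((t' + 1) mod length (cir B ! c'))) \<notin> set \<tau>"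
  shows "cov (c', (t' + 1) mod length (cir B ! c')) = cov (c', t')"
proof -
  let ?l = "length (cir B ! c')" let ?u' = "(t' + 1) mod ?l"
  have u': "?u' < ?l" using assms(2) by (intro mod_less_divisor) auto
  obtain c t where ct: "cov (c', t') = (c, t)" by fastforce
  have cc: "(c, t) \<in> arcs A" "covers A B \<pi> \<tau> (c, t) (c', t')"
    using cov_arcs covers_cov nth_arcs assms ct by metis+
  have c: "c < length (cir A)" "\<pi> ! c = c'" using cc covers_fst by (auto simp: arcs_def)
  have "covers A B \<pi> \<tau> (c, t) (c', ?u')"
  proof (cases "cir A ! c = []")
    case True then show ?thesis using c by (auto simp: covers_def)
  next
    case False
    then have t: "t < length (cir A ! c)" using cc by (cases "cir A ! c") (auto simp: arcs_def)
    have least: "\<forall>q\<in>set (qs c). cdist ?l (qs c ! t) t' \<le> cdist ?l q t'"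
      using covers_least[OF c(1) t, of t'] cc c assms by simp
    have q: "q < ?l \<and> q \<noteq> ?u'" if "q \<in> set (qs c)" for q
      using set_qs[OF c(1)] that assms(3) c by auto
    have suc: "cdist ?l q ?u' = cdist ?l q t' + 1" if "q < ?l" "q \<noteq> ?u'" for q
    proof (cases "t' + 1 = ?l")
      case True
      then have "?u' = 0" by simp
      moreover have "0 < ?l" using assms(2) by linarith
      ultimately show ?thesis using True that assms(2) by (auto simp: cdist_if split: if_splits)
    next
      case False
      then have "?u' = t' + 1" using assms(2) by simp
      then show ?thesis using that u' assms(2) by (auto simp: cdist_if split: if_splits)
    qed
    have "qs c ! t \<in> set (qs c)" using t by simp
    then have "\<forall>r\<in>set (qs c). cdist ?l (qs c ! t) ?u' \<le> cdist ?l r ?u'"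
      using least suc q by auto
    then show ?thesis using covers_least[OF c(1) t, of ?u'] c u' by simp
  qed
  then show ?thesis using cov_iff nth_arcs assms u' ct cc by metis
qed

end

section \<open>The circles of a closed braid\<close>

text \<open>The orbit size is the least period, so a circle read off by that many turns closes up
  and repeats no strand.\<close>

lemma funpow_card_orbit:
  assumes "inj f" "finite (range (\<lambda>j. (f ^^ j) r))"
  defines "n \<equiv> card (range (\<lambda>j. (f ^^ j) r))"
  shows "(f ^^ n) r = r" "inj_on (\<lambda>q. (f ^^ q) r) {..<n}"
    "(\<lambda>q. (f ^^ q) r) ` {..<n} = range (\<lambda>j. (f ^^ j) r)" "0 < n"
proof -
  have "\<exists>d>0. (f ^^ d) r = r"
  proof -
    let ?O = "range (\<lambda>j. (f ^^ j) r)"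
    have "(f ^^ 0) r \<in> ?O" by (rule rangeI)
    moreover have "f ` ?O \<subseteq> ?O"
    proof (clarify)
      fix j have "(f ^^ Suc j) r \<in> ?O" by (rule rangeI)
      then show "f ((f ^^ j) r) \<in> ?O" by simp
    qed
    moreover have "inj_on f ?O" using assms(1) inj_on_subset by blast
    ultimately have "reach f (f r) r"
      using reach_sym[of f ?O r "f r"] assms(2) reach_step[of f r] by simp
    then obtain j where "(f ^^ j) (f r) = r" unfolding reach_def by blast
    then have "(f ^^ Suc j) r = r" by (simp add: funpow_swap1)
    then show ?thesis by blast
  qed
  define d where "d = (LEAST d. 0 < d \<and> (f ^^ d) r = r)"
  have d: "0 < d" "(f ^^ d) r = r"
    unfolding d_def using LeastI_ex[OF \<open>\<exists>d>0. (f ^^ d) r = r\<close>] by auto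
  have dmin: "\<not> (0 < e \<and> (f ^^ e) r = r)" if "e < d" for e
    using not_less_Least[OF that[unfolded d_def]] .
  have inj: "inj_on (\<lambda>q. (f ^^ q) r) {..<d}"
  proof (rule linorder_inj_onI)
    fix a b assume ab: "a < b" "a \<in> {..<d}" "b \<in> {..<d}"
    show "(f ^^ a) r \<noteq> (f ^^ b) r"
    proof
      assume "(f ^^ a) r = (f ^^ b) r"
      also have "(f ^^ b) r = (f ^^ a) ((f ^^ (b - a)) r)"
        using ab(1) by (metis comp_apply funpow_add le_add_diff_inverse less_imp_le)
      finally have "(f ^^ (b - a)) r = r"
        using assms(1) by (metis injD inj_fn)
      moreover have "b - a < d" "0 < b - a" using ab by auto
      ultimately show False using dmin[of "b - a"] by blast
    qed
  qed auto
  have im: "(\<lambda>q. (f ^^ q) r) ` {..<d} = range (\<lambda>j. (f ^^ j) r)"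
  proof (intro equalityI subsetI)
    fix x assume "x \<in> range (\<lambda>j. (f ^^ j) r)"
    then obtain j where "x = (f ^^ j) r" by blast
    also have "(f ^^ j) r = (f ^^ (j mod d)) r" using d(2) by (metis funpow_mod_eq)
    finally show "x \<in> (\<lambda>q. (f ^^ q) r) ` {..<d}" using d(1) by auto
  qed auto
  have "n = d" unfolding n_def im[symmetric] using card_image[OF inj] by simp
  then show "(f ^^ n) r = r" "inj_on (\<lambda>q. (f ^^ q) r) {..<n}"
    "(\<lambda>q. (f ^^ q) r) ` {..<n} = range (\<lambda>j. (f ^^ j) r)" "0 < n"
    using d inj im by auto
qed

section \<open>Strands of a braid word, level by level\<close>

definition swp :: "nat \<Rightarrow> nat \<Rightarrow> nat" where
  "swp i x = (if x = i then Suc i else if x = Suc i then i else x)"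

lemma swp_swp [simp]: "swp i (swp i x) = x"
  by (simp add: swp_def)

lemma inj_swp: "inj (swp i)"
  by (metis injI swp_swp)

lemma swp_in: "1 \<le> i \<Longrightarrow> i < m \<Longrightarrow> x \<in> {1..m} \<Longrightarrow> swp i x \<in> {1..m}"
  by (auto simp: swp_def)

text \<open>Position, just above letter \<open>p\<close>, of the strand that starts at
  \<open>s\<close>. The function \<open>pass\<close> hides these intermediate levels, on which the
  strand flow lives.\<close>

fun ppos :: "bword \<Rightarrow> nat \<Rightarrow> nat \<Rightarrow> nat" where
  "ppos w 0 s = s"
| "ppos w (Suc p) s = swp (fst (w ! p)) (ppos w p s)"

definition touches :: "bword \<Rightarrow> nat \<Rightarrow> nat \<Rightarrow> bool" where
  "touches w p x \<longleftrightarrow> x = fst (w ! p) \<or> x = Suc (fst (w ! p))"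

text \<open>The Boolean that \<open>pass\<close> records: \<open>True\<close> on the under strand,
  where the head of the arrow lies.\<close>

definition side :: "bword \<Rightarrow> nat \<Rightarrow> nat \<Rightarrow> bool" where
  "side w p x = (if x = fst (w ! p) then snd (w ! p) else \<not> snd (w ! p))"

text \<open>Inverse of \<open>side\<close>: the position above the letter at which the strand
  carrying the end \<open>b\<close> comes in.\<close>

definition entry :: "bword \<Rightarrow> nat \<Rightarrow> bool \<Rightarrow> nat" where
  "entry w p b = (if snd (w ! p) = b then fst (w ! p) else Suc (fst (w ! p)))"

lemma touches_side_iff: "touches w p x \<and> side w p x = b \<longleftrightarrow> x = entry w p b"
  by (auto simp: touches_def side_def entry_def)

text \<open>Where one strand enters a letter, the other one leaves it. Hence keeping the position at
  a smoothed letter amounts to the jump along the band to the other end of the arrow.\<close>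

lemma swp_entry: "swp (fst (w ! p)) (entry w p b) = entry w p (\<not> b)"
  by (auto simp: swp_def entry_def)

fun plist :: "bword \<Rightarrow> nat \<Rightarrow> nat \<Rightarrow> endpt list" where
  "plist w 0 s = []"
| "plist w (Suc p) s = plist w p s @
     (if touches w p (ppos w p s) then [(p, side w p (ppos w p s))] else [])"

text \<open>\<open>pass\<close> recurses on the first letter and \<open>plist\<close> on the last,
  so their agreement is proved for every split of the word.\<close>

lemma pass_drop:
  "p \<le> length w \<Longrightarrow> pass w 0 s = (plist w p s @ fst (pass (drop p w) p (ppos w p s)),
      snd (pass (drop p w) p (ppos w p s)))"
proof (induction p)
  case 0 then show ?case by simp
next
  case (Suc p)
  obtain i e where ie: "w ! p = (i, e)" by fastforce
  have d: "drop p w = (i, e) # drop (Suc p) w" using Suc.prems ie by (metis Cons_nth_drop_Suc Suc_le_lessD)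
  show ?case using Suc by (auto simp: d ie touches_def side_def swp_def Let_def split: prod.splits)
qed

lemma pass_eq: "pass w 0 s = (plist w (length w) s, ppos w (length w) s)"
  using pass_drop[of "length w" w s] by simp

lemma fslot_eq: "fslot w = ppos w (length w)"
  by (rule ext) (simp add: fslot_def pass_eq)

lemma inj_ppos: "inj (ppos w p)"
proof (induction p)
  case 0 then show ?case by (simp add: inj_def)
next
  case (Suc p)
  moreover have "ppos w (Suc p) = swp (fst (w ! p)) \<circ> ppos w p" by auto
  ultimately show ?case using inj_swp inj_compose by metis
qed

lemma ppos_eq_iff [simp]: "ppos w p s = ppos w p t \<longleftrightarrow> s = t"
  using inj_ppos by (rule inj_eq)

lemma inj_fslot: "inj (fslot w)"
  by (simp add: fslot_eq inj_ppos)

lemma distinct_concat_map: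
  assumes "distinct xs" "\<And>x. x \<in> set xs \<Longrightarrow> distinct (F x)"
    "\<And>x y. x \<in> set xs \<Longrightarrow> y \<in> set xs \<Longrightarrow> x \<noteq> y \<Longrightarrow> set (F x) \<inter> set (F y) = {}"
  shows "distinct (concat (map F xs))"
  using assms
proof (induction xs)
  case (Cons x xs)
  have "set (F x) \<inter> (\<Union>y\<in>set xs. set (F y)) = {}" using Cons.prems(1,3) by fastforce
  then show ?case using Cons by simp
qed simp

lemma set_plist: "set (plist w q s) = {(p, b). p < q \<and> ppos w p s = entry w p b}"
proof (induction q)
  case (Suc q)
  have "set (if touches w q (ppos w q s) then [(q, side w q (ppos w q s))] else [])
     = {(p, b). p = q \<and> ppos w p s = entry w p b}"
    using touches_side_iff[of w q "ppos w q s"] by auto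
  then show ?case using Suc by (auto simp: less_Suc_eq)
qed simp

lemma distinct_plist: "distinct (plist w q s)"
  by (induction q) (auto simp: set_plist)

lemma plist_prefix: "p \<le> q \<Longrightarrow> \<exists>zs. plist w q s = plist w p s @ zs"
  by (induction q) (auto simp: le_Suc_eq)

lemma nth_plist:
  assumes "p < q" "touches w p (ppos w p s)"
  shows "length (plist w p s) < length (plist w q s)"
    "plist w q s ! length (plist w p s) = (p, side w p (ppos w p s))"
proof -
  obtain zs where "plist w q s = plist w (Suc p) s @ zs" using plist_prefix assms(1) Suc_leI by metis
  then show "length (plist w p s) < length (plist w q s)"
    "plist w q s ! length (plist w p s) = (p, side w p (ppos w p s))"
    using assms(2) by (auto simp: nth_append)
qed

section \<open>Circles and labeled arcs of the Gauss diagram\<close>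

locale braid =
  fixes w :: bword and m :: nat
  assumes bw: "braid_word m w"
begin

abbreviation "f \<equiv> fslot w"

lemma letter: "p < length w \<Longrightarrow> 1 \<le> fst (w ! p) \<and> fst (w ! p) < m"
  proof -
  assume "p < length w"
  then have "w ! p \<in> set w" by simp
  with bw[unfolded braid_word_def] have "case w ! p of (i, e) \<Rightarrow> 1 \<le> i \<and> i < m" by (rule bspec)
  then show ?thesis by (simp add: case_prod_beta)
qed

lemma ppos_in: "p \<le> length w \<Longrightarrow> s \<in> {1..m} \<Longrightarrow> ppos w p s \<in> {1..m}"
proof (induction p)
  case (Suc p) then show ?case using letter[of p] swp_in[of "fst (w ! p)" m "ppos w p s"] by simp
qed simp

lemma ppos_surj: "p \<le> length w \<Longrightarrow> x \<in> {1..m} \<Longrightarrow> \<exists>s\<in>{1..m}. ppos w p s = x"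
proof -
  assume p: "p \<le> length w" and x: "x \<in> {1..m}"
  have "ppos w p ` {1..m} = {1..m}"
    proof (rule endo_inj_surj)
    show "ppos w p ` {1..m} \<subseteq> {1..m}" using ppos_in[OF p] by blast
    show "inj_on (ppos w p) {1..m}" using inj_ppos inj_on_subset by blast
  qed simp
  then show ?thesis using x by (metis imageE)
qed

lemma entry_in: "p < length w \<Longrightarrow> entry w p b \<in> {1..m}"
  using letter[of p] by (auto simp: entry_def)

lemma f_in: "s \<in> {1..m} \<Longrightarrow> f s \<in> {1..m}"
  using ppos_in by (simp add: fslot_eq)

lemma funpow_in: "s \<in> {1..m} \<Longrightarrow> (f ^^ j) s \<in> {1..m}"
  by (induction j) (use f_in in auto)

lemma orb_reach: "t \<in> orb w s \<longleftrightarrow> reach f s t"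
  unfolding orb_def reach_def by auto

lemma orb_sub: "s \<in> {1..m} \<Longrightarrow> orb w s \<subseteq> {1..m}"
  unfolding orb_def using funpow_in by blast

lemma finite_orb: "s \<in> {1..m} \<Longrightarrow> finite (orb w s)"
  using orb_sub finite_subset by blast

lemma f_sym: "s \<in> {1..m} \<Longrightarrow> reach f s t \<Longrightarrow> reach f t s"
  using reach_sym[of f "{1..m}"] inj_fslot f_in inj_on_subset
  by (metis finite_atLeastAtMost image_subset_iff subset_UNIV)

lemma orb_eq: "s \<in> {1..m} \<Longrightarrow> t \<in> orb w s \<Longrightarrow> orb w t = orb w s"
proof -
  assume s: "s \<in> {1..m}" and "t \<in> orb w s"
  then have "reach f s t" "reach f t s" using orb_reach f_sym[OF s] by auto
  then show "orb w t = orb w s"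
    using reach_trans[of f s t] reach_trans[of f t s] by (auto simp: orb_reach)
qed

lemma self_orb: "s \<in> orb w s"
  by (simp add: orb_reach)

definition rp :: "nat \<Rightarrow> nat" where "rp s = Min (orb w s)"

lemma rp_orb: "s \<in> {1..m} \<Longrightarrow> rp s \<in> orb w s"
  unfolding rp_def using finite_orb self_orb by (metis Min_in empty_iff)

lemma rp_in: "s \<in> {1..m} \<Longrightarrow> rp s \<in> {1..m}"
  using rp_orb orb_sub by blast

lemma orb_rp: "s \<in> {1..m} \<Longrightarrow> orb w (rp s) = orb w s"
  using rp_orb orb_eq by blast

lemma orb_rp_mem: "s \<in> {1..m} \<Longrightarrow> s \<in> orb w (rp s)"
  using orb_rp self_orb by blast

lemma set_reps: "set (reps w m) = rp ` {1..m}"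
proof (intro equalityI subsetI)
  fix x assume "x \<in> set (reps w m)"
  then show "x \<in> rp ` {1..m}" unfolding reps_def rp_def by auto
next
  fix x assume "x \<in> rp ` {1..m}"
  then obtain s where s: "s \<in> {1..m}" "x = rp s" by blast
  then have "x = Min (orb w x)" "x \<in> set [1..<m + 1]" using orb_rp[of s] rp_in[of s] by (auto simp: rp_def)
  then show "x \<in> set (reps w m)" unfolding reps_def set_filter by blast
qed

lemma rp_rep: "r \<in> set (reps w m) \<Longrightarrow> rp r = r" and rep_in: "r \<in> set (reps w m) \<Longrightarrow> r \<in> {1..m}"
  unfolding reps_def rp_def by auto

lemma distinct_reps: "distinct (reps w m)"
  unfolding reps_def by simp

lemma circ_idx:
  assumes "s \<in> {1..m}"
  shows "circ_idx w m s < length (reps w m)" "reps w m ! circ_idx w m s = rp s"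
proof -
  have "rp s \<in> set (reps w m)" using set_reps assms by blast
  then have "\<exists>!c. c < length (reps w m) \<and> reps w m ! c = Min (orb w s)"
    using distinct_reps by (metis in_set_conv_nth nth_eq_iff_index_eq rp_def)
  then have "circ_idx w m s < length (reps w m) \<and> reps w m ! circ_idx w m s = Min (orb w s)"
    unfolding circ_idx_def by (rule theI')
  then show "circ_idx w m s < length (reps w m)" "reps w m ! circ_idx w m s = rp s"
    by (auto simp: rp_def)
qed

lemma circ_idx_orb: "s \<in> {1..m} \<Longrightarrow> t \<in> {1..m} \<Longrightarrow> circ_idx w m s = circ_idx w m t \<Longrightarrow> t \<in> orb w s"
  using circ_idx(2) orb_rp self_orb by metis

lemma circ_idx_eq: "s \<in> {1..m} \<Longrightarrow> t \<in> orb w s \<Longrightarrow> circ_idx w m t = circ_idx w m s"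
  unfolding circ_idx_def using orb_eq by auto

lemma length_bgd: "length (bgd_cir w m) = length (reps w m)"
  by (simp add: bgd_cir_def)

lemma bgd_nth: "s \<in> {1..m} \<Longrightarrow> bgd_cir w m ! circ_idx w m s = cir_of w (rp s)"
  using circ_idx by (simp add: bgd_cir_def)

lemma segs_Suc: "segs w r (Suc j) = segs w r j @ plist w (length w) ((f ^^ j) r)"
  by (simp add: segs_def pass_eq)

lemma segs_0 [simp]: "segs w r 0 = []"
  by (simp add: segs_def)

lemma segs_prefix: "j \<le> k \<Longrightarrow> \<exists>zs. segs w r k = segs w r j @ zs"
proof (induction k)
  case (Suc k) then show ?case by (cases "j = Suc k") (auto simp: segs_Suc)
qed simp

lemma orbit_facts:
  assumes "r \<in> {1..m}"
  shows "(f ^^ card (orb w r)) r = r" "inj_on (\<lambda>q. (f ^^ q) r) {..<card (orb w r)}"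
    "(\<lambda>q. (f ^^ q) r) ` {..<card (orb w r)} = orb w r" "0 < card (orb w r)"
  using funpow_card_orbit[OF inj_fslot, of w r] finite_orb[OF assms] unfolding orb_def by auto

definition steps :: "nat \<Rightarrow> nat" where "steps s = (LEAST j. (f ^^ j) (rp s) = s)"

lemma steps:
  assumes "s \<in> {1..m}"
  shows "(f ^^ steps s) (rp s) = s" "steps s < card (orb w (rp s))"
proof -
  have "s \<in> (\<lambda>q. (f ^^ q) (rp s)) ` {..<card (orb w (rp s))}"
    using orbit_facts(3) rp_in assms orb_rp_mem by metis
  then obtain q where q: "q < card (orb w (rp s))" "(f ^^ q) (rp s) = s" by auto
  then show "(f ^^ steps s) (rp s) = s" "steps s < card (orb w (rp s))"
    unfolding steps_def by (metis (mono_tags, lifting) LeastI, metis (mono_tags, lifting) Least_le le_less_trans)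
qed

lemma steps_unique: "s \<in> {1..m} \<Longrightarrow> q < card (orb w (rp s)) \<Longrightarrow> (f ^^ q) (rp s) = s \<Longrightarrow> steps s = q"
  using orbit_facts(2)[OF rp_in] steps by (metis inj_onD lessThan_iff)

text \<open>Number of endpoints between the representative strand of the circle and strand
  \<open>s\<close>. The labeled arc begins one endpoint earlier, cyclically.\<close>

definition start :: "nat \<Rightarrow> nat" where "start s = length (segs w (rp s) (steps s))"

definition clen :: "nat \<Rightarrow> nat" where "clen s = length (cir_of w (rp s))"

lemma lab_arc_eq:
  "lab_arc w m s = (circ_idx w m s, if clen s = 0 then 0 else (start s + clen s - 1) mod clen s)"
  unfolding lab_arc_def start_def steps_def clen_def rp_def by (simp add: Let_def)

lemma cir_of_split:
  assumes "s \<in> {1..m}"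
  shows "\<exists>zs. cir_of w (rp s) = segs w (rp s) (steps s) @ plist w (length w) s @ zs"
proof -
  obtain zs where "cir_of w (rp s) = segs w (rp s) (Suc (steps s)) @ zs"
    using segs_prefix steps(2)[OF assms] unfolding cir_of_def by (metis Suc_leI)
  then show ?thesis using steps(1)[OF assms] by (simp add: segs_Suc)
qed

lemma nth_cir_of:
  assumes "s \<in> {1..m}" "p < length w" "touches w p (ppos w p s)"
  shows "start s + length (plist w p s) < clen s"
    "cir_of w (rp s) ! (start s + length (plist w p s)) = (p, side w p (ppos w p s))"
  using cir_of_split[OF assms(1)] nth_plist[OF assms(2,3)]
  by (auto simp: start_def clen_def nth_append)

definition succ_arc :: "arc \<Rightarrow> arc" where
  "succ_arc \<beta> = (fst \<beta>, (snd \<beta> + 1) mod length (bgd_cir w m ! fst \<beta>))"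

text \<open>The arc of the Gauss diagram through the point at position \<open>x\<close> above the letter \<open>p\<close>.\<close>

fun lev :: "nat \<Rightarrow> nat \<Rightarrow> arc" where
  "lev 0 x = lab_arc w m x"
| "lev (Suc p) x = (let y = swp (fst (w ! p)) x in
     if touches w p y then succ_arc (lev p y) else lev p y)"

text \<open>An arc is indexed by its initial endpoint, so its index is the number of endpoints met
  so far minus one; the summand \<open>clen s\<close> keeps the subtraction within the natural
  numbers. A circle without endpoints has the single arc 0.\<close>

lemma lev_ppos:
  assumes "s \<in> {1..m}" "p \<le> length w"
  shows "lev p (ppos w p s) = (circ_idx w m s,
     if clen s = 0 then 0 else (start s + length (plist w p s) + clen s - 1) mod clen s)"
  using assms(2)
proof (induction p)
  case 0 then show ?case by (simp add: lab_arc_eq)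
next
  case (Suc p)
  let ?k = "start s + length (plist w p s)"
  show ?case
  proof (cases "touches w p (ppos w p s)")
    case True
    then have lt: "?k < clen s" using nth_cir_of assms(1) Suc.prems by simp
    have "((?k + clen s - 1) mod clen s + 1) mod clen s = (?k + 1 + clen s - 1) mod clen s"
      using lt by (simp add: mod_simps)
    moreover have "clen s \<noteq> 0" using lt by linarith
    ultimately show ?thesis using Suc True bgd_nth[OF assms(1)]
      by (simp add: succ_arc_def flip: clen_def)
  next
    case False
    then show ?thesis using Suc by simp
  qed
qed

lemma fst_lev:
  assumes "s \<in> {1..m}" "p \<le> length w" shows "fst (lev p (ppos w p s)) = circ_idx w m s"
  by (simp add: lev_ppos[OF assms])

lemma lev_arcs:
  assumes "x \<in> {1..m}" "p \<le> length w"
  shows "fst (lev p x) < length (bgd_cir w m)"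
    "snd (lev p x) < max 1 (length (bgd_cir w m ! fst (lev p x)))"
proof -
  obtain s where s: "s \<in> {1..m}" "x = ppos w p s" using ppos_surj assms by metis
  show "fst (lev p x) < length (bgd_cir w m)"
    using s assms fst_lev circ_idx(1) length_bgd by metis
  show "snd (lev p x) < max 1 (length (bgd_cir w m ! fst (lev p x)))"
    unfolding s(2) lev_ppos[OF s(1) assms(2)]
    using bgd_nth[OF s(1)] mod_less_divisor[of "clen s" "start s + length (plist w p s) + clen s - 1"]
    by (cases "clen s = 0") (auto simp: less_max_iff_disj simp flip: clen_def)
qed

lemma lev_end:
  assumes "x \<in> {1..m}" "p < length w" "touches w p x"
  shows "snd (lev p x) < length (bgd_cir w m ! fst (lev p x))"
    "bgd_cir w m ! fst (lev p x) ! snd (succ_arc (lev p x)) = (p, side w p x)"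
proof -
  obtain s where s: "s \<in> {1..m}" "x = ppos w p s" using ppos_surj assms(1,2) less_imp_le by metis
  let ?k = "start s + length (plist w p s)"
  have k: "?k < clen s" "cir_of w (rp s) ! ?k = (p, side w p x)"
    using nth_cir_of[OF s(1) assms(2)] assms(3) s(2) by auto
  have lev: "lev p x = (circ_idx w m s, (?k + clen s - 1) mod clen s)"
    using lev_ppos[OF s(1), of p] assms(2) s(2) k(1) by simp
  show "snd (lev p x) < length (bgd_cir w m ! fst (lev p x))"
    using k(1) unfolding lev by (simp add: bgd_nth[OF s(1)] flip: clen_def)
  have "snd (succ_arc (lev p x)) = ?k"
    unfolding succ_arc_def lev using Suc_pred_mod[OF k(1)] by (simp add: bgd_nth[OF s(1)] flip: clen_def)
  then show "bgd_cir w m ! fst (lev p x) ! snd (succ_arc (lev p x)) = (p, side w p x)"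
    using k(2) lev by (simp add: bgd_nth[OF s(1)])
qed

text \<open>The bottom of the braid is glued to its top. The next turn either continues along the
  circle list or returns to the representative, where the count restarts at 0 after exactly
  \<open>clen\<close> endpoints; modulo \<open>clen\<close> this makes no difference.\<close>

lemma lev_length:
  assumes "x \<in> {1..m}" shows "lev (length w) x = lab_arc w m x"
proof -
  obtain s where s: "s \<in> {1..m}" "x = f s" using ppos_surj[of "length w" x] assms unfolding fslot_eq by blast
  have orb: "f s \<in> orb w s" by (simp add: orb_reach reach_step)
  have rp: "rp (f s) = rp s" using orb_eq[OF s(1) orb] by (simp add: rp_def)
  have c: "circ_idx w m (f s) = circ_idx w m s" using circ_idx_eq s(1) orb by blast
  have cl: "clen (f s) = clen s" by (simp add: clen_def rp)
  let ?n = "card (orb w (rp s))"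
  have it: "(f ^^ Suc (steps s)) (rp s) = f s" using steps(1)[OF s(1)] by simp
  have "start (f s) = start s + length (plist w (length w) s) \<or>
     start (f s) = 0 \<and> start s + length (plist w (length w) s) = clen s"
  proof (cases "Suc (steps s) < ?n")
    case True
    then have "steps (f s) = Suc (steps s)"
      using steps_unique[OF f_in[OF s(1)]] it rp by metis
    then show ?thesis using steps(1)[OF s(1)] by (simp add: start_def rp segs_Suc)
  next
    case False
    then have n: "Suc (steps s) = ?n" using steps(2)[OF s(1)] by simp
    then have "f s = rp s" using orbit_facts(1)[OF rp_in[OF s(1)]] it by metis
    then have "steps (f s) = 0"
      using steps_unique[OF f_in[OF s(1)], of 0] orbit_facts(4)[OF rp_in[OF s(1)]] rp by auto
    moreover have "clen s = start s + length (plist w (length w) s)"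
      using steps(1)[OF s(1)] unfolding clen_def cir_of_def n[symmetric] by (simp add: start_def segs_Suc)
    ultimately show ?thesis by (simp add: start_def)
  qed
  moreover have "(clen s + clen s - 1) mod clen s = (clen s - 1) mod clen s"
    using mod_add_self2[of "clen s - 1" "clen s"] by (cases "clen s = 0") auto
  ultimately show ?thesis
    unfolding s(2) lab_arc_eq c cl using lev_ppos[OF s(1), of "length w"]
    by (auto simp: fslot_eq)
qed

lemma set_cir_of:
  assumes "r \<in> {1..m}"
  shows "set (cir_of w r) = {(p, b). p < length w \<and> (\<exists>s\<in>orb w r. ppos w p s = entry w p b)}"
proof -
  have "set (cir_of w r) = (\<Union>s\<in>(\<lambda>q. (f ^^ q) r) ` {..<card (orb w r)}. set (plist w (length w) s))"
    by (auto simp: cir_of_def segs_def pass_eq)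
  then show ?thesis unfolding orbit_facts(3)[OF assms] set_plist by blast
qed

lemma distinct_cir_of:
  assumes "r \<in> {1..m}" shows "distinct (cir_of w r)"
  unfolding cir_of_def segs_def
proof (rule distinct_concat_map)
  fix x y assume "x \<in> set [0..<card (orb w r)]" "y \<in> set [0..<card (orb w r)]" "x \<noteq> y"
  then have "(f ^^ x) r \<noteq> (f ^^ y) r" using orbit_facts(2)[OF assms] by (auto dest: inj_onD)
  then show "set (fst (pass w 0 ((f ^^ x) r))) \<inter> set (fst (pass w 0 ((f ^^ y) r))) = {}"
    by (auto simp: pass_eq set_plist) (metis ppos_eq_iff)
qed (auto simp: pass_eq distinct_plist)

text \<open>An endpoint determines the strand that enters its letter there, and distinct
  representatives have disjoint orbits.\<close>

lemma distinct_bgd: "distinct (concat (bgd_cir w m))"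
  unfolding bgd_cir_def
proof (rule distinct_concat_map)
  fix x y assume xy: "x \<in> set (reps w m)" "y \<in> set (reps w m)" "x \<noteq> y"
  have d: "s \<noteq> t" if "s \<in> orb w x" "t \<in> orb w y" for s t
  proof
    assume "s = t"
    have "orb w x = orb w s" "orb w t = orb w y"
      using orb_eq[OF rep_in[OF xy(1)] that(1)] orb_eq[OF rep_in[OF xy(2)] that(2)] by auto
    then have "rp x = rp y" using \<open>s = t\<close> by (simp add: rp_def)
    then show False using xy rp_rep by simp
  qed
  have "a \<notin> set (cir_of w y)" if "a \<in> set (cir_of w x)" for a
    proof -
    obtain p b where a: "a = (p, b)" by fastforce
    have "s = t" if "ppos w p s = entry w p b" "ppos w p t = entry w p b" for s t
      using that ppos_eq_iff by metis
    then show ?thesis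
      using that d unfolding set_cir_of[OF rep_in[OF xy(1)]] set_cir_of[OF rep_in[OF xy(2)]] a by blast
  qed
  then show "set (cir_of w x) \<inter> set (cir_of w y) = {}" by blast
qed (auto simp: distinct_reps distinct_cir_of dest: rep_in)

lemma set_bgd: "set (concat (bgd_cir w m)) = {..<length w} \<times> UNIV"
proof -
  have "(p, b) \<in> set (concat (bgd_cir w m)) \<longleftrightarrow> p < length w" for p b
  proof
    assume "(p, b) \<in> set (concat (bgd_cir w m))"
    then show "p < length w" unfolding bgd_cir_def using rep_in by (auto simp: set_cir_of)
  next
    assume p: "p < length w"
    then obtain s where s: "s \<in> {1..m}" "ppos w p s = entry w p b"
      using ppos_surj entry_in less_imp_le by metis
    then have "(p, b) \<in> set (cir_of w (rp s))"
      using p orb_rp_mem set_cir_of[OF rp_in[OF s(1)]] by blast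
    then show "(p, b) \<in> set (concat (bgd_cir w m))"
      unfolding bgd_cir_def using set_reps s(1) by auto
  qed
  then show ?thesis by auto
qed

lemma narr_bgd: "cir B = bgd_cir w m \<Longrightarrow> narr B = length w"
  using distinct_card[OF distinct_bgd] set_bgd
  by (simp add: narr_def card_cartesian_product)

lemma wf_bgd: "cir B = bgd_cir w m \<Longrightarrow> wf_adiag B"
  using narr_bgd distinct_bgd set_bgd by (simp add: wf_adiag_def)

end

section \<open>The strand flow of a state\<close>

text \<open>The closing strands are steps of their own, from level \<open>length w\<close> to level
  0. Only the strand index of a letter enters, never its sign, which is what makes the words of a
  Conway triple comparable.\<close>

definition fstep :: "bword \<Rightarrow> nat set \<Rightarrow> nat \<times> nat \<Rightarrow> nat \<times> nat" where
  "fstep w S = (\<lambda>(p, x). if p < length w then (Suc p, if p \<in> S then x else swp (fst (w ! p)) x)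
     else if p = length w then (0, x) else (p, x))"

definition states :: "bword \<Rightarrow> nat \<Rightarrow> (nat \<times> nat) set" where
  "states w m = {..length w} \<times> {1..m}"

text \<open>The points from which the boundary of the surface runs along a side of a band.\<close>

definition events :: "bword \<Rightarrow> nat set \<Rightarrow> (nat \<times> nat) set" where
  "events w S = {(p, x). p \<in> S \<and> p < length w \<and> touches w p x}"

text \<open>The tail end comes first, as a descending diagram demands.\<close>

definition crossings :: "bword \<Rightarrow> nat set \<Rightarrow> ((nat \<times> nat) \<times> (nat \<times> nat)) set" where
  "crossings w S = (\<lambda>p. ((p, entry w p False), (p, entry w p True))) ` S"

text \<open>Colours number the base points from 1, lists from 0. The point \<open>(0, j)\<close>
  lies on the arc labeled by the closing strand \<open>j\<close>.\<close>

definition colour_pts :: "nat \<Rightarrow> nat list \<Rightarrow> nat list \<Rightarrow> (nat \<times> nat \<times> nat) set" where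
  "colour_pts m J col = (\<lambda>j. (col ! (j - 1) - 1, (0, j))) ` ({1..m} - set J)"

definition good :: "bword \<Rightarrow> nat \<Rightarrow> nat set \<Rightarrow> nat list \<Rightarrow> nat list \<Rightarrow> bool" where
  "good w m S J col \<longleftrightarrow>
     dgood (fstep w S) (states w m) (map (Pair 0) J) (crossings w S) (colour_pts m J col)"

context braid begin

lemma fstep_states: "z \<in> states w m \<Longrightarrow> fstep w S z \<in> states w m"
  using letter[of "fst z"] swp_in[of "fst (w ! fst z)" m "snd z"]
  by (cases z) (auto simp: states_def fstep_def)

lemma inj_fstep: "inj_on (fstep w S) (states w m)"
proof (rule inj_onI)
  fix y z assume "y \<in> states w m" "z \<in> states w m" "fstep w S y = fstep w S z"
  then show "y = z"
    by (cases y; cases z) (auto simp: states_def fstep_def split: if_splits dest: injD[OF inj_swp])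
qed

lemma fstep_sym: "z \<in> states w m \<Longrightarrow> reach (fstep w S) z y \<Longrightarrow> reach (fstep w S) y z"
  proof (rule reach_sym[OF inj_fstep])
  show "fstep w S ` states w m \<subseteq> states w m" using fstep_states by blast
  show "finite (states w m)" by (simp add: states_def)
qed

lemma reach_level: "p \<le> length w \<Longrightarrow> reach (fstep w {}) (0, s) (p, ppos w p s)"
proof (induction p)
  case (Suc p)
  then have "fstep w {} (p, ppos w p s) = (Suc p, ppos w (Suc p) s)" by (simp add: fstep_def)
  then show ?case
    using reach_trans[OF Suc.IH reach_step] Suc.prems by simp
qed simp

lemma reach_turn: "reach (fstep w {}) (0, s) (0, (f ^^ j) s)"
proof (induction j)
  case (Suc j)
  note Suc
  also have "reach (fstep w {}) (0, (f ^^ j) s) (length w, f ((f ^^ j) s))"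
    using reach_level[of "length w"] by (simp add: fslot_eq)
  also have "reach (fstep w {}) (length w, f ((f ^^ j) s)) (0, (f ^^ Suc j) s)"
    using reach_step[of "fstep w {}" "(length w, f ((f ^^ j) s))"] by (simp add: fstep_def)
  finally show ?case .
qed simp

text \<open>With nothing smoothed the flow follows the circles of the Gauss diagram: back to level
  0, around by whole turns, and down to the target level.\<close>

lemma reach_circle:
  assumes "(p, x) \<in> states w m" "(q, y) \<in> states w m" "fst (lev p x) = fst (lev q y)"
  shows "reach (fstep w {}) (p, x) (q, y)"
proof -
  have p: "p \<le> length w" "x \<in> {1..m}" and q: "q \<le> length w" "y \<in> {1..m}"
    using assms by (auto simp: states_def)
  obtain s where s: "s \<in> {1..m}" "ppos w p s = x" using ppos_surj[OF p] by blast
  obtain t where t: "t \<in> {1..m}" "ppos w q t = y" using ppos_surj[OF q] by blast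
  have "circ_idx w m s = circ_idx w m t" using fst_lev s t p q assms(3) by metis
  then have "t \<in> orb w s" using circ_idx_orb s t by blast
  then obtain j where j: "t = (f ^^ j) s" unfolding orb_def by blast
  have "(0, s) \<in> states w m" using s by (simp add: states_def)
  then have "reach (fstep w {}) (p, x) (0, s)" using fstep_sym reach_level[OF p(1), of s] s(2) by blast
  also have "reach (fstep w {}) (0, s) (0, t)" using reach_turn j by simp
  also have "reach (fstep w {}) (0, t) (q, y)" using reach_level[OF q(1), of t] t(2) by simp
  finally show ?thesis .
qed

text \<open>An orbit that avoids the smoothed crossings cannot notice the smoothing: at a letter in
  \<open>S\<close>, away from its two strands, the swap is the identity.\<close>

lemma reach_no_event:
  assumes "reach (fstep w {}) y z" "\<And>e. reach (fstep w S) y e \<Longrightarrow> e \<notin> events w S"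
  shows "reach (fstep w S) y z"
proof -
  have "(\<forall>e. reach (fstep w S) y e \<longrightarrow> e \<notin> events w S) \<longrightarrow> reach (fstep w S) y z"
    using assms(1)
  proof (induction rule: reach_induct)
    case (step y)
    show ?case
    proof
      assume ne: "\<forall>e. reach (fstep w S) y e \<longrightarrow> e \<notin> events w S"
      then have "y \<notin> events w S" using reach_refl[of "fstep w S" y] by blast
      then have eq: "fstep w {} y = fstep w S y"
        by (cases y) (auto simp: fstep_def events_def touches_def swp_def)
      have "\<forall>e. reach (fstep w S) (fstep w {} y) e \<longrightarrow> e \<notin> events w S"
        using ne reach_step'[of "fstep w S" y] unfolding eq by blast
      then have "reach (fstep w S) (fstep w S y) z" using step.IH unfolding eq by blast
      then show "reach (fstep w S) y z" by (rule reach_step')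
    qed
  qed simp
  with assms(2) show ?thesis by blast
qed

end

section \<open>The surface boundary as a factor of the strand flow\<close>

locale braid_hom = braid w m + prehom A B \<pi> \<tau>
  for w m A B \<pi> \<tau> +
  assumes cirB: "cir B = bgd_cir w m"
begin

abbreviation "S \<equiv> set \<tau>"

definition pt :: "nat \<times> nat \<Rightarrow> arc" where
  "pt z = cov (lev (fst z) (snd z))"

lemma narrB: "narr B = length w"
  using narr_bgd cirB by blast

lemma S_lt: "p \<in> S \<Longrightarrow> p < length w"
  using set_\<tau> narrB by auto

lemma lev_in_arcs: "z \<in> states w m \<Longrightarrow> lev (fst z) (snd z) \<in> arcs B"
  using lev_arcs[of "snd z" "fst z"] by (auto simp: states_def arcs_def cirB case_prod_beta)

lemma pt_arcs: "z \<in> states w m \<Longrightarrow> pt z \<in> arcs A"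
  using lev_in_arcs cov_arcs by (simp add: pt_def)

lemma \<pi>_pt: "z \<in> states w m \<Longrightarrow> \<pi> ! fst (pt z) = fst (lev (fst z) (snd z))"
  using lev_in_arcs \<pi>_cov by (simp add: pt_def)

lemma lev_split:
  assumes "x \<in> {1..m}" "p < length w" "touches w p x"
  obtains c t where "lev p x = (c, t)" "c < length (cir B)" "t < length (cir B ! c)"
    "cir B ! c ! ((t + 1) mod length (cir B ! c)) = (p, side w p x)"
    "succ_arc (lev p x) = (c, (t + 1) mod length (cir B ! c))"
    "(t + 1) mod length (cir B ! c) < length (cir B ! c)"
proof -
  obtain c t where ct: "lev p x = (c, t)" by fastforce
  have t: "t < length (cir B ! c)" using lev_end(1)[OF assms] ct cirB by simp
  show ?thesis
  proof (rule that[OF ct])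
    show "c < length (cir B)" using lev_arcs[OF assms(1)] assms(2) ct cirB by (metis fst_conv less_imp_le)
    show "t < length (cir B ! c)" using t .
    show "cir B ! c ! ((t + 1) mod length (cir B ! c)) = (p, side w p x)"
      using lev_end(2)[OF assms] ct cirB by (simp add: succ_arc_def)
    show "succ_arc (lev p x) = (c, (t + 1) mod length (cir B ! c))" using ct cirB by (simp add: succ_arc_def)
    have "0 < length (cir B ! c)" using t by linarith
    then show "(t + 1) mod length (cir B ! c) < length (cir B ! c)" by (rule mod_less_divisor)
  qed
qed

text \<open>Above the letter the point lies on the arc that ends at the end \<open>b\<close>. Below
  it, at the same position, the strand that came in at the other end leaves, so the arc there starts
  at that other end.\<close>

lemma pt_event:
  assumes "x \<in> {1..m}" "a < narr A" "x = entry w (\<tau> ! a) b"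
  shows "pt (\<tau> ! a, x) = arc_ending A (a, b)" "pt (Suc (\<tau> ! a), x) = epos A (a, \<not> b)"
proof -
  let ?p = "\<tau> ! a" let ?y = "swp (fst (w ! ?p)) x"
  have p: "?p < length w" using assms(2) \<tau>_lt narrB by simp
  have x: "touches w ?p x" "side w ?p x = b" using touches_side_iff assms(3) by metis+
  have "?y = entry w ?p (\<not> b)" using assms(3) swp_entry by simp
  then have y: "touches w ?p ?y" "side w ?p ?y = (\<not> b)" using touches_side_iff by metis+
  have yin: "?y \<in> {1..m}" using swp_in letter[OF p] assms(1) by blast
  obtain c t where ct: "lev ?p x = (c, t)" "c < length (cir B)" "t < length (cir B ! c)"
    "cir B ! c ! ((t + 1) mod length (cir B ! c)) = (?p, side w ?p x)"
    "succ_arc (lev ?p x) = (c, (t + 1) mod length (cir B ! c))"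
    "(t + 1) mod length (cir B ! c) < length (cir B ! c)" by (rule lev_split[OF assms(1) p x(1)])
  have "cov (c, t) = arc_ending A (a, b)"
    by (rule cov_end[OF ct(2,3) _ assms(2)]) (use ct(4) x(2) in simp)
  then show "pt (?p, x) = arc_ending A (a, b)" using ct(1) by (simp add: pt_def)
  obtain d u where du: "lev ?p ?y = (d, u)" "d < length (cir B)" "u < length (cir B ! d)"
    "cir B ! d ! ((u + 1) mod length (cir B ! d)) = (?p, side w ?p ?y)"
    "succ_arc (lev ?p ?y) = (d, (u + 1) mod length (cir B ! d))"
    "(u + 1) mod length (cir B ! d) < length (cir B ! d)" by (rule lev_split[OF yin p y(1)])
  have "cov (d, (u + 1) mod length (cir B ! d)) = epos A (a, \<not> b)"
    by (rule cov_start[OF du(2,6) _ assms(2)]) (use du(4) y(2) in simp)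
  moreover have "lev (Suc ?p) x = succ_arc (lev ?p ?y)" using y(1) by (simp add: Let_def)
  ultimately show "pt (Suc ?p, x) = epos A (a, \<not> b)" using du(5) by (simp add: pt_def)
qed

lemma eventE:
  assumes "z \<in> events w S"
  obtains a b where "a < narr A" "z = (\<tau> ! a, entry w (\<tau> ! a) b)"
proof -
  obtain p x where z: "z = (p, x)" by fastforce
  then have "p \<in> S" "touches w p x" using assms by (auto simp: events_def)
  then obtain a where "a < narr A" "\<tau> ! a = p" using len_\<tau> by (metis in_set_conv_nth)
  moreover have "x = entry w p (side w p x)" using touches_side_iff \<open>touches w p x\<close> by blast
  ultimately show ?thesis using that z by blast
qed

lemma fstep_event: "z \<in> events w S \<Longrightarrow> fstep w S z = (Suc (fst z), snd z)"
  by (auto simp: events_def fstep_def)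

lemma pt_next_event:
  assumes "z \<in> states w m" "z \<in> events w S"
  shows "pt (fstep w S z) = next_arc A (pt z)"
proof -
  obtain a b where ab: "a < narr A" "z = (\<tau> ! a, entry w (\<tau> ! a) b)" using eventE assms(2) by metis
  then have "entry w (\<tau> ! a) b \<in> {1..m}" using assms(1) by (simp add: states_def)
  from pt_event[OF this ab(1) HOL.refl] show ?thesis
    using next_arc_ending[OF wfA ab(1), of b] ab(2) fstep_event[OF assms(2)] by simp
qed

text \<open>There are three ways to wait: on a closing strand, beside a letter on other strands, and
  at a crossing outside the state, which \<open>cov_skip\<close> makes invisible.\<close>

lemma pt_nonevent:
  assumes "z \<in> states w m" "z \<notin> events w S"
  shows "pt (fstep w S z) = pt z"
proof -
  obtain p x where z: "z = (p, x)" by fastforce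
  have px: "p \<le> length w" "x \<in> {1..m}" using assms(1) z by (auto simp: states_def)
  consider "p = length w" | "p < length w" "\<not> touches w p x" | "p < length w" "touches w p x" "p \<notin> S"
    using px assms(2) z by (fastforce simp: events_def)
  then show ?thesis
  proof cases
    case 1 then show ?thesis using lev_length[OF px(2)] z by (simp add: pt_def fstep_def)
  next
    case 2
    then have "swp (fst (w ! p)) x = x" by (auto simp: touches_def swp_def)
    then show ?thesis using 2 z by (simp add: pt_def fstep_def)
  next
    case 3
    have "fstep w S z = (Suc p, swp (fst (w ! p)) x)" using 3 z by (simp add: fstep_def)
    moreover have "lev (Suc p) (swp (fst (w ! p)) x) = succ_arc (lev p x)" using 3 by (simp add: Let_def)
    moreover have "cov (succ_arc (lev p x)) = cov (lev p x)"
    proof -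
      obtain c t where ct: "lev p x = (c, t)" "c < length (cir B)" "t < length (cir B ! c)"
        "cir B ! c ! ((t + 1) mod length (cir B ! c)) = (p, side w p x)"
        "succ_arc (lev p x) = (c, (t + 1) mod length (cir B ! c))"
        "(t + 1) mod length (cir B ! c) < length (cir B ! c)" by (rule lev_split[OF px(2) 3(1,2)])
      have "cov (c, (t + 1) mod length (cir B ! c)) = cov (c, t)"
        by (rule cov_skip[OF ct(2,3)]) (use ct(4) 3(3) in simp)
      then show ?thesis unfolding ct(5) unfolding ct(1) .
    qed
    ultimately show ?thesis using z by (simp add: pt_def)
  qed
qed

lemma circle_event:
  assumes "a < narr A" "c < length (cir A)" "(a, b) \<in> set (cir A ! c)"
  shows "(\<tau> ! a, entry w (\<tau> ! a) b) \<in> states w m \<inter> events w S"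
    "fst (lev (\<tau> ! a) (entry w (\<tau> ! a) b)) = \<pi> ! c"
proof -
  let ?p = "\<tau> ! a" let ?x = "entry w ?p b"
  have p: "?p < length w" "?p \<in> S" using assms(1) \<tau>_lt narrB len_\<tau> by auto
  have x: "?x \<in> {1..m}" using entry_in p by blast
  have t: "touches w ?p ?x" "side w ?p ?x = b" using touches_side_iff by metis+
  then show "(?p, ?x) \<in> states w m \<inter> events w S" using p x by (auto simp: states_def events_def)
  obtain d s where ds: "lev ?p ?x = (d, s)" "d < length (cir B)" "s < length (cir B ! d)"
    "cir B ! d ! ((s + 1) mod length (cir B ! d)) = (?p, side w ?p ?x)"
    "succ_arc (lev ?p ?x) = (d, (s + 1) mod length (cir B ! d))"
    "(s + 1) mod length (cir B ! d) < length (cir B ! d)" by (rule lev_split[OF x p(1) t(1)])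
  have "d = \<pi> ! c"
    using wf_adiag_nth_eq[OF wfB ds(2,6) \<pi>_lt[OF assms(2)] gpos_props(1)[OF assms(2,3)]]
      gpos_props(2)[OF assms(2,3)] ds(4) t(2) by simp
  then show "fst (lev ?p ?x) = \<pi> ! c" using ds by simp
qed

text \<open>\<open>pt\<close> is the factor map from braid points to arcs of \<open>A\<close>. The
  delicate axiom is the last one: an orbit without events sweeps a whole circle of the Gauss
  diagram, over which the circle of \<open>A\<close> turns out to be empty.\<close>

sublocale factor "fstep w S" "next_arc A" pt "states w m" "events w S"
proof
  fix z assume z: "z \<in> states w m"
  show "fstep w S z \<in> states w m" using fstep_states z .
  show "reach (fstep w S) y z" if "reach (fstep w S) z y" for y using fstep_sym z that .
  show "pt (fstep w S z) = next_arc A (pt z)" if "z \<in> events w S" using pt_next_event z that .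
  show "pt (fstep w S z) = pt z" if "z \<notin> events w S" using pt_nonevent z that .
  show "z = y" if y: "z \<in> events w S" "y \<in> states w m" "y \<in> events w S" "pt z = pt y" for y
  proof -
    obtain a b where ab: "a < narr A" "z = (\<tau> ! a, entry w (\<tau> ! a) b)" using eventE y(1) by metis
    obtain c d where cd: "c < narr A" "y = (\<tau> ! c, entry w (\<tau> ! c) d)" using eventE y(3) by metis
    have "pt z = arc_ending A (a, b)" "pt y = arc_ending A (c, d)"
      using pt_event(1)[OF _ ab(1)] pt_event(1)[OF _ cd(1)] z y(2) ab(2) cd(2) by (auto simp: states_def)
    then have "a = c \<and> b = d" using arc_ending_inj[OF wfA ab(1) cd(1)] y(4) by metis
    then show ?thesis using ab cd by simp
  qed
  show "(\<exists>y\<in>events w S. reach (fstep w S) z y) \<or> (next_arc A (pt z) = pt z \<and>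
      (\<forall>y\<in>states w m. pt y = pt z \<longrightarrow> reach (fstep w S) z y))"
  proof (cases "\<exists>y\<in>events w S. reach (fstep w S) z y")
    case False
    then have ne: "\<And>e. reach (fstep w S) z e \<Longrightarrow> e \<notin> events w S" by blast
    have conn: "reach (fstep w S) z y" if "y \<in> states w m" "fst (lev (fst z) (snd z)) = fst (lev (fst y) (snd y))" for y
      using reach_no_event[OF reach_circle ne] z that by (metis prod.collapse)
    obtain c t where ct: "pt z = (c, t)" by fastforce
    have c: "c < length (cir A)" "\<pi> ! c = fst (lev (fst z) (snd z))"
      using pt_arcs[OF z] \<pi>_pt[OF z] ct by (auto simp: arcs_def)
    \<comment> \<open>An endpoint here would be an event on the same Gauss circle, which the orbit
      sweeps completely.\<close>
    have "cir A ! c = []"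
    proof (rule ccontr)
      assume nil: "cir A ! c \<noteq> []"
      obtain a b where ab: "cir A ! c ! 0 = (a, b)" by fastforce
      then have mem: "(a, b) \<in> set (cir A ! c)" using nil by (metis length_greater_0_conv nth_mem)
      have a: "a < narr A" using wf_adiag_nth[OF wfA c(1), of 0] nil ab by simp
      let ?y = "(\<tau> ! a, entry w (\<tau> ! a) b)"
      have "?y \<in> states w m" "?y \<in> events w S" "fst (lev (fst ?y) (snd ?y)) = \<pi> ! c"
        using circle_event[OF a c(1) mem] by auto
      then have "reach (fstep w S) z ?y" using conn c(2) by metis
      then show False using ne \<open>?y \<in> events w S\<close> by blast
    qed
    then have "next_arc A (pt z) = pt z" unfolding ct by (rule next_arc_Nil)
    moreover have "reach (fstep w S) z y" if "y \<in> states w m" "pt y = pt z" for y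
      using conn[OF that(1)] \<pi>_pt[OF z] \<pi>_pt[OF that(1)] that(2) by simp
    ultimately show ?thesis by blast
  qed blast
qed

lemma pt_image: "pt ` states w m = arcs A"
proof (intro equalityI subsetI)
  fix \<alpha> assume "\<alpha> \<in> pt ` states w m" then show "\<alpha> \<in> arcs A" using pt_arcs by blast
next
  fix \<alpha> assume \<alpha>: "\<alpha> \<in> arcs A"
  obtain c t where ct: "\<alpha> = (c, t)" by fastforce
  have c: "c < length (cir A)" "t < max 1 (length (cir A ! c))" using \<alpha> ct by (auto simp: arcs_def)
  show "\<alpha> \<in> pt ` states w m"
  proof (cases "cir A ! c = []")
    case True
    \<comment> \<open>A circle without marks has one arc, so any point over it will do; the top of
      its representative strand is one.\<close>
    let ?r = "reps w m ! (\<pi> ! c)"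
    have lt: "\<pi> ! c < length (reps w m)" using \<pi>_lt[OF c(1)] cirB length_bgd by simp
    then have r: "?r \<in> set (reps w m)" by simp
    have rin: "?r \<in> {1..m}" using rep_in[OF r] .
    have "reps w m ! circ_idx w m ?r = ?r" using circ_idx(2)[OF rin] rp_rep[OF r] by simp
    then have ci: "circ_idx w m ?r = \<pi> ! c"
      using distinct_reps circ_idx(1)[OF rin] lt by (metis nth_eq_iff_index_eq)
    have st: "(0, ?r) \<in> states w m" using rin by (auto simp: states_def)
    have "\<pi> ! fst (pt (0, ?r)) = \<pi> ! c" using \<pi>_pt[OF st] ci lab_arc_eq[of ?r] by simp
    then have "fst (pt (0, ?r)) = c" using \<pi>_inj pt_arcs[OF st] c(1) by (auto simp: arcs_def)
    then have "pt (0, ?r) = \<alpha>" using pt_arcs[OF st] True c(2) ct by (auto simp: arcs_def)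
    then show ?thesis using st by blast
  next
    case False
    then have t: "t < length (cir A ! c)" using c(2) by (cases "cir A ! c") auto
    obtain a b where ab: "cir A ! c ! t = (a, b)" by fastforce
    have a: "a < narr A" using wf_adiag_nth[OF wfA c(1) t] ab by simp
    \<comment> \<open>The arc starting at the end \<open>b\<close> is seen just below the letter, at
      the position where the other end came in; hence the negation.\<close>
    let ?x = "entry w (\<tau> ! a) (\<not> b)"
    have p: "\<tau> ! a < length w" using \<tau>_lt[OF a] narrB by simp
    then have x: "?x \<in> {1..m}" using entry_in by blast
    have "pt (Suc (\<tau> ! a), ?x) = \<alpha>" using pt_event(2)[OF x a HOL.refl] epos_nth[OF wfA c(1) t] ab ct by simp
    moreover have "(Suc (\<tau> ! a), ?x) \<in> states w m" using p x by (auto simp: states_def)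
    ultimately show ?thesis by blast
  qed
qed

definition dpairs :: "(arc \<times> arc) set" where
  "dpairs = (\<lambda>a. (arc_ending A (a, False), arc_ending A (a, True))) ` {..<narr A}"

lemma pt_crossings: "map_prod pt pt ` crossings w S = dpairs"
proof -
  have "S = (!) \<tau> ` {..<narr A}" using len_\<tau> by (auto simp: set_conv_nth)
  moreover have "pt (\<tau> ! a, entry w (\<tau> ! a) b) = arc_ending A (a, b)" if "a < narr A" for a b
    using pt_event(1)[OF _ that HOL.refl] entry_in \<tau>_lt[OF that] narrB by simp
  ultimately show ?thesis unfolding crossings_def dpairs_def by (auto simp: image_image)
qed

lemma crossings_sub: "crossings w S \<subseteq> (states w m \<inter> events w S) \<times> (states w m \<inter> events w S)"
proof -
  have "(p, entry w p b) \<in> states w m \<inter> events w S" if "p \<in> S" for p b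
    using S_lt[OF that] that entry_in touches_side_iff[of w p "entry w p b" b]
    by (auto simp: states_def events_def)
  then show ?thesis by (auto simp: crossings_def)
qed

text \<open>Reversibility is inherited from the flow, where it follows from injectivity, by lifting
  both arcs to braid points.\<close>

lemma next_arc_sym: "\<alpha> \<in> arcs A \<Longrightarrow> reach (next_arc A) \<alpha> \<beta> \<Longrightarrow> reach (next_arc A) \<beta> \<alpha>"
proof -
  assume \<alpha>: "\<alpha> \<in> arcs A" and r: "reach (next_arc A) \<alpha> \<beta>"
  have "next_arc A \<gamma> \<in> arcs A" if g: "\<gamma> \<in> arcs A" for \<gamma>
  proof -
    obtain z where z: "z \<in> states w m" "\<gamma> = pt z"
      using g[folded pt_image] by blast
    consider "\<exists>e\<in>events w S. reach (fstep w S) z e" | "next_arc A (pt z) = pt z" using event_hit[OF z(1)] by blast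
    then show ?thesis
    proof cases
      case 1
      then obtain e where e: "e \<in> events w S" "reach (fstep w S) z e" "pt e = pt z"
        using next_event[OF _ _ z(1)] by blast
      then have est: "e \<in> states w m" using reach_X[OF e(2) z(1)] by simp
      have "next_arc A \<gamma> = pt (fstep w S e)" "fstep w S e \<in> states w m"
        using event[OF est e(1)] e(3) z(2) fX[OF est] by auto
      then show ?thesis using pt_arcs by simp
    next
      case 2 then show ?thesis using g z by simp
    qed
  qed
  then have "\<beta> \<in> arcs A" using reach_closed[OF r \<alpha>] by blast
  obtain z where z: "z \<in> states w m" "\<beta> = pt z"
    using \<open>\<beta> \<in> arcs A\<close>[folded pt_image] by blast
  obtain y where y: "y \<in> states w m" "\<alpha> = pt y"
    using \<alpha>[folded pt_image] by blast
  have "reach (fstep w S) y z" using r reach_iff[OF y(1) z(1)] y(2) z(2) by simp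
  then show "reach (next_arc A) \<beta> \<alpha>" using symf[OF y(1)] reach_iff[OF z(1) y(1)] y(2) z(2) by simp
qed

end

section \<open>Boundary components and traversal times\<close>

lemma same_comp_reach: "same_comp A = reach (next_arc A)"
  by (intro ext) (simp add: same_comp_def reach_def)

lemma finite_arcs: "finite (arcs A)"
proof -
  have "arcs A = Sigma {..<length (cir A)} (\<lambda>c. {..<max 1 (length (cir A ! c))})"
    by (auto simp: arcs_def)
  then show ?thesis by simp
qed

definition comp_of :: "adiag \<Rightarrow> arc \<Rightarrow> arc set" where
  "comp_of A \<alpha> = {\<beta> \<in> arcs A. same_comp A \<alpha> \<beta>}"

lemma bcomps_eq: "bcomps A = comp_of A ` arcs A"
  unfolding bcomps_def comp_of_def by auto

text \<open>Bases in pairwise different components inject into the finite set of components, so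
  having the right number of them means missing no component.\<close>

lemma bases_cover_iff:
  assumes sym: "\<And>\<alpha> \<beta>. \<alpha> \<in> arcs A \<Longrightarrow> same_comp A \<alpha> \<beta> \<Longrightarrow> same_comp A \<beta> \<alpha>"
    and bas: "set (bas A) \<subseteq> arcs A"
    and sep: "\<forall>i<length (bas A). \<forall>i'<length (bas A). i \<noteq> i' \<longrightarrow> \<not> same_comp A (bas A ! i) (bas A ! i')"
  shows "card (bcomps A) = length (bas A) \<longleftrightarrow>
    (\<forall>\<alpha>\<in>arcs A. \<exists>i<length (bas A). same_comp A (bas A ! i) \<alpha>)"
proof -
  let ?f = "\<lambda>i. comp_of A (bas A ! i)"
  have b: "bas A ! i \<in> arcs A" if "i < length (bas A)" for i using bas that by auto
  have self: "\<alpha> \<in> comp_of A \<alpha>" if "\<alpha> \<in> arcs A" for \<alpha> using that by (simp add: comp_of_def same_comp_reach)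
  have inj: "inj_on ?f {..<length (bas A)}"
  proof (rule inj_onI, rule ccontr)
    fix i j assume ij: "i \<in> {..<length (bas A)}" "j \<in> {..<length (bas A)}" "?f i = ?f j" "i \<noteq> j"
    then have "bas A ! j \<in> ?f i" using self[OF b, of j] by simp
    then show False using sep ij by (simp add: comp_of_def)
  qed
  have sub: "?f ` {..<length (bas A)} \<subseteq> bcomps A" unfolding bcomps_eq using b by auto
  have fin: "finite (bcomps A)" unfolding bcomps_eq using finite_arcs by simp
  show ?thesis
  proof
    assume "card (bcomps A) = length (bas A)"
    then have eq: "?f ` {..<length (bas A)} = bcomps A"
      using card_image[OF inj] card_subset_eq[OF fin sub] by simp
    show "\<forall>\<alpha>\<in>arcs A. \<exists>i<length (bas A). same_comp A (bas A ! i) \<alpha>"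
    proof
      fix \<alpha> assume \<alpha>: "\<alpha> \<in> arcs A"
      then have "comp_of A \<alpha> \<in> ?f ` {..<length (bas A)}" unfolding eq bcomps_eq by (rule imageI)
      then obtain i where i: "i < length (bas A)" "comp_of A \<alpha> = ?f i" by auto
      then have "\<alpha> \<in> ?f i" using self[OF \<alpha>] by simp
      then show "\<exists>i<length (bas A). same_comp A (bas A ! i) \<alpha>" using i(1) by (auto simp: comp_of_def)
    qed
  next
    assume c: "\<forall>\<alpha>\<in>arcs A. \<exists>i<length (bas A). same_comp A (bas A ! i) \<alpha>"
    have "comp_of A \<alpha> \<in> ?f ` {..<length (bas A)}" if \<alpha>: "\<alpha> \<in> arcs A" for \<alpha>
    proof -
      obtain i where i: "i < length (bas A)" "same_comp A (bas A ! i) \<alpha>" using bspec[OF c \<alpha>] by blast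
      have "same_comp A \<alpha> (bas A ! i)" using sym[OF b[OF i(1)] i(2)] .
      have "same_comp A \<alpha> \<beta> \<longleftrightarrow> same_comp A (bas A ! i) \<beta>" for \<beta>
        using \<open>same_comp A \<alpha> (bas A ! i)\<close> i(2) reach_trans[of "next_arc A" \<alpha> "bas A ! i" \<beta>]
          reach_trans[of "next_arc A" "bas A ! i" \<alpha> \<beta>]
        unfolding same_comp_reach by blast
      then have "comp_of A \<alpha> = ?f i" unfolding comp_of_def by simp
      then show ?thesis using i(1) by blast
    qed
    then have "bcomps A \<subseteq> ?f ` {..<length (bas A)}" unfolding bcomps_eq by (rule image_subsetI)
    then have "bcomps A = ?f ` {..<length (bas A)}" using sub by (rule equalityI)
    then show "card (bcomps A) = length (bas A)" using card_image[OF inj] by simp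
  qed
qed

text \<open>When the bases represent every component once, the component index is well defined and a
  side on a later component is never met from the earlier base. Within one component, first visits
  are compared by their \<open>LEAST\<close> times.\<close>

lemma jtime_less_iff:
  assumes sym: "\<And>\<alpha> \<beta>. \<alpha> \<in> arcs A \<Longrightarrow> same_comp A \<alpha> \<beta> \<Longrightarrow> same_comp A \<beta> \<alpha>"
    and bas: "set (bas A) \<subseteq> arcs A"
    and sep: "\<forall>i<length (bas A). \<forall>i'<length (bas A). i \<noteq> i' \<longrightarrow> \<not> same_comp A (bas A ! i) (bas A ! i')"
    and cov: "\<forall>\<alpha>\<in>arcs A. \<exists>i<length (bas A). same_comp A (bas A ! i) \<alpha>"
    and e: "arc_ending A e \<in> arcs A" "arc_ending A e' \<in> arcs A"
  shows "lex_less (jtime A e) (jtime A e') \<longleftrightarrow>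
    desc_at (next_arc A) (bas A) (arc_ending A e) (arc_ending A e')"
proof -
  let ?x = "arc_ending A e" let ?y = "arc_ending A e'" let ?g = "next_arc A"
  have b: "bas A ! i \<in> arcs A" if "i < length (bas A)" for i using bas that by auto
  have unique: "i = j" if "i < length (bas A)" "j < length (bas A)" "same_comp A (bas A ! i) \<alpha>" "same_comp A (bas A ! j) \<alpha>" for i j \<alpha>
  proof (rule ccontr)
    assume "i \<noteq> j"
    moreover have "same_comp A (bas A ! i) (bas A ! j)"
      using reach_trans[OF that(3)[unfolded same_comp_reach] sym[OF b[OF that(2)] that(4), unfolded same_comp_reach]]
      unfolding same_comp_reach .
    ultimately show False using sep that(1,2) by blast
  qed
  have idx: "comp_index A \<alpha> = i" if "i < length (bas A)" "same_comp A (bas A ! i) \<alpha>" for i \<alpha>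
    unfolding comp_index_def by (rule the_equality) (use that unique in blast)+
  obtain i where i: "i < length (bas A)" "same_comp A (bas A ! i) ?x" using cov e by blast
  obtain j where j: "j < length (bas A)" "same_comp A (bas A ! j) ?y" using cov e by blast
  have jx: "jtime A e = (i, LEAST l. (?g ^^ l) (bas A ! i) = ?x)"
    and jy: "jtime A e' = (j, LEAST l. (?g ^^ l) (bas A ! j) = ?y)"
    using idx i j by (auto simp: jtime_def Let_def)
  have d: "desc_at ?g (bas A) ?x ?y \<longleftrightarrow> before ?g ?x ?y (bas A ! i) \<and> i \<le> j"
  proof
    assume "desc_at ?g (bas A) ?x ?y"
    then obtain k where k: "k < length (bas A)" "before ?g ?x ?y (bas A ! k)"
      "\<forall>l<k. \<not> reach ?g (bas A ! l) ?y" unfolding desc_at_def by blast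
    have "k = i" using unique[OF k(1) i(1) _ i(2)] before_reach[OF k(2)] by (simp add: same_comp_reach)
    then show "before ?g ?x ?y (bas A ! i) \<and> i \<le> j"
      using k j(2) unfolding same_comp_reach by (metis not_less)
  next
    assume a: "before ?g ?x ?y (bas A ! i) \<and> i \<le> j"
    have "\<not> reach ?g (bas A ! l) ?y" if "l < i" for l
      using unique[of l j ?y] that a i(1) j unfolding same_comp_reach by force
    then show "desc_at ?g (bas A) ?x ?y" unfolding desc_at_def using a i(1) by blast
  qed
  consider "i < j" | "i = j" | "j < i" by linarith
  then show ?thesis
  proof cases
    case 1
    have "\<not> reach ?g (bas A ! i) ?y" using unique[of i j ?y] i j 1 unfolding same_comp_reach by force
    then have "before ?g ?x ?y (bas A ! i)"
      using i(2) before_total[of ?g "bas A ! i" ?x ?y] before_reach unfolding same_comp_reach by metis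
    then show ?thesis unfolding d jx jy using 1 by (simp add: lex_less_def)
  next
    case 2
    then show ?thesis unfolding d jx jy
      using before_least_iff[of ?g "bas A ! i" ?x ?y] i j by (simp add: lex_less_def same_comp_reach)
  next
    case 3 then show ?thesis unfolding d jx jy by (simp add: lex_less_def)
  qed
qed

lemma dgood_colours:
  "dgood f X bs P C \<longleftrightarrow> dgood f X bs P {} \<and> (\<forall>(i, x)\<in>C. reach f (bs ! i) x)"
  by (auto simp: dgood_def)

lemma multibased_descending_iff:
  assumes sym: "\<And>\<alpha> \<beta>. \<alpha> \<in> arcs A \<Longrightarrow> same_comp A \<alpha> \<beta> \<Longrightarrow> same_comp A \<beta> \<alpha>"
    and bas: "set (bas A) \<subseteq> arcs A" and wf: "wf_adiag A"
  shows "multibased A (length (bas A)) \<and> descending A \<longleftrightarrow>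
    dgood (next_arc A) (arcs A) (bas A)
     ((\<lambda>a. (arc_ending A (a, False), arc_ending A (a, True))) ` {..<narr A}) {}"
    (is "?L \<longleftrightarrow> ?R")
proof -
  let ?sep = "\<forall>i<length (bas A). \<forall>i'<length (bas A). i \<noteq> i' \<longrightarrow> \<not> same_comp A (bas A ! i) (bas A ! i')"
  let ?cov = "\<forall>\<alpha>\<in>arcs A. \<exists>i<length (bas A). same_comp A (bas A ! i) \<alpha>"
  have "?L \<longleftrightarrow> ?sep \<and> ?cov \<and> descending A"
    unfolding multibased_def using bases_cover_iff[OF sym bas] bas wf by auto
  also have "\<dots> \<longleftrightarrow> ?sep \<and> ?cov \<and> (\<forall>a<narr A. desc_at (next_arc A) (bas A) (arc_ending A (a, False)) (arc_ending A (a, True)))"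
    unfolding descending_def using jtime_less_iff[OF sym bas] arc_ending_arcs[OF wf] by (auto cong: conj_cong)
  also have "\<dots> \<longleftrightarrow> ?R"
    unfolding dgood_def by (auto simp: same_comp_reach)
  finally show ?thesis .
qed

context braid_hom begin

text \<open>The factor map carries the conditions on the surface of \<open>A\<close> to conditions
  on the flow, in which only the state remains.\<close>

lemma good_iff:
  assumes "set J \<subseteq> {1..m}" "bas A = map (\<lambda>j. pt (0, j)) J"
    "\<forall>j\<in>{1..m} - set J. col ! (j - 1) - 1 < length J"
  shows "multibased A (length J) \<and> descending A \<and>
     (\<forall>j\<in>{1..m}. j \<notin> set J \<longrightarrow> same_comp A (bas A ! (col ! (j - 1) - 1)) (pt (0, j)))
     \<longleftrightarrow> good w m S J col"
proof -
  have st: "(0, j) \<in> states w m" if "j \<in> {1..m}" for j using that by (simp add: states_def)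
  have bas: "set (bas A) \<subseteq> arcs A" using assms(1,2) pt_arcs st by auto
  have len: "length (bas A) = length J" using assms(2) by simp
  have "good w m S J col \<longleftrightarrow> dgood (next_arc A) (pt ` states w m) (map pt (map (Pair 0) J))
     (map_prod pt pt ` crossings w S) (map_prod id pt ` colour_pts m J col)"
    unfolding good_def
  proof (rule dgood_map_iff[symmetric, OF _ crossings_sub])
    show "set (map (Pair 0) J) \<subseteq> states w m" using assms(1) st by auto
    show "colour_pts m J col \<subseteq> {..<length (map (Pair 0) J)} \<times> states w m"
      using assms(3) st by (auto simp: colour_pts_def)
  qed
  also have "\<dots> \<longleftrightarrow> dgood (next_arc A) (arcs A) (bas A) dpairs {} \<and>
      (\<forall>(i, x)\<in>map_prod id pt ` colour_pts m J col. reach (next_arc A) (bas A ! i) x)"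
    unfolding pt_image pt_crossings dgood_colours[where C = "map_prod id pt ` colour_pts m J col"]
    using assms(2) by (simp add: comp_def)
  also have "dgood (next_arc A) (arcs A) (bas A) dpairs {} \<longleftrightarrow> multibased A (length J) \<and> descending A"
    unfolding dpairs_def len[symmetric]
    by (rule multibased_descending_iff[symmetric, OF _ bas wfA]) (simp add: same_comp_reach next_arc_sym)
  also have "(\<forall>(i, x)\<in>map_prod id pt ` colour_pts m J col. reach (next_arc A) (bas A ! i) x) \<longleftrightarrow>
     (\<forall>j\<in>{1..m}. j \<notin> set J \<longrightarrow> same_comp A (bas A ! (col ! (j - 1) - 1)) (pt (0, j)))"
    by (auto simp: colour_pts_def same_comp_reach)
  finally show ?thesis by blast
qed

end

section \<open>Rigidity and composition of homomorphisms\<close>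

text \<open>Inverts indexing into a distinct list, and thereby the maps \<pi> and \<tau>, which are
  stored as lists.\<close>

definition idx :: "'a list \<Rightarrow> 'a \<Rightarrow> nat" where
  "idx xs y = (SOME i. i < length xs \<and> xs ! i = y)"

lemma idx: assumes "y \<in> set xs" shows "idx xs y < length xs" "xs ! idx xs y = y"
proof -
  have "\<exists>i. i < length xs \<and> xs ! i = y" using assms by (metis in_set_conv_nth)
  then have "idx xs y < length xs \<and> xs ! idx xs y = y" unfolding idx_def by (rule someI_ex)
  then show "idx xs y < length xs" "xs ! idx xs y = y" by auto
qed

lemma idx_nth: "distinct xs \<Longrightarrow> i < length xs \<Longrightarrow> idx xs (xs ! i) = i"
  using idx[of "xs ! i" xs] by (simp add: nth_eq_iff_index_eq)

lemma map_idx: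
  assumes "distinct xs" "distinct ys" "set xs = set ys"
  shows "distinct (map (idx ys) xs)" "set (map (idx ys) xs) = {..<length ys}"
proof -
  have inj: "inj_on (idx ys) (set xs)"
    using idx(2)[of _ ys] assms(3) by (intro inj_onI) metis
  then show "distinct (map (idx ys) xs)" using assms(1) by (simp add: distinct_map)
  have "i \<in> idx ys ` set xs" if "i < length ys" for i
    using idx_nth[OF assms(2) that] that assms(3) by (metis image_eqI nth_mem)
  moreover have "idx ys ` set xs \<subseteq> {..<length ys}" using idx(1)[of _ ys] assms(3) by auto
  ultimately show "set (map (idx ys) xs) = {..<length ys}" by auto
qed

lemma rotate_inverse: "\<exists>k. rotate k (rotate r xs) = xs"
proof (cases "xs = []")
  case False
  let ?n = "length xs"
  have "(?n - r mod ?n + r) mod ?n = 0"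
    using False mod_less_divisor[of ?n r]
    by (metis add.commute le_add_diff_inverse length_greater_0_conv less_imp_le mod_add_left_eq mod_self)
  then have "rotate (?n - r mod ?n) (rotate r xs) = xs"
    unfolding rotate_rotate by (subst rotate_conv_mod) simp
  then show ?thesis by blast
qed simp

lemma wf_adiag_mem:
  assumes "wf_adiag A" "c < length (cir A)" "e \<in> set (cir A ! c)" shows "fst e < narr A"
  using assms(3) wf_adiag_nth[OF assms(1,2)] by (metis in_set_conv_nth)

abbreviation emap :: "nat list \<Rightarrow> endpt \<Rightarrow> endpt" where
  "emap \<tau> e \<equiv> (\<tau> ! fst e, snd e)"

lemma sorted_positions:
  assumes "wf_adiag A" "c < length (cir A)"
  shows "map (\<lambda>e. snd (epos A e)) (cir A ! c) = [0..<length (cir A ! c)]"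
  by (rule nth_equalityI) (use epos_nth[OF assms] in auto)

lemma arcs_nth: "(c, t) \<in> arcs A \<Longrightarrow> c < length (cir A) \<and> (cir A ! c \<noteq> [] \<longrightarrow> t < length (cir A ! c))"
  by (cases "cir A ! c") (auto simp: arcs_def)

context prehom begin

lemma map_qs: "c < length (cir A) \<Longrightarrow> map ((!) (cir B ! (\<pi> ! c))) (qs c) = map (emap \<tau>) (cir A ! c)"
  by (rule nth_equalityI) (auto simp: cir_qs)

lemma covers_same:
  assumes "(c, t) \<in> arcs A" "cir A ! c \<noteq> []" "(c', t') \<in> arcs B" "covers A B \<pi> \<tau> (c, t) (c', t')"
  shows "qs c ! t \<in> set (qs c)" "c' = \<pi> ! c"
    "\<forall>q\<in>set (qs c). cdist (length (cir B ! c')) (qs c ! t) t' \<le> cdist (length (cir B ! c')) q t'"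
    "t' < length (cir B ! c')" "qs c ! t < length (cir B ! c')" "t < length (cir A ! c)"
proof -
  have c: "c < length (cir A)" and t: "t < length (cir A ! c)" using arcs_nth[OF assms(1)] assms(2) by auto
  show c': "c' = \<pi> ! c" using covers_fst[OF assms(4)] by simp
  show q: "qs c ! t \<in> set (qs c)" using t by simp
  show lt: "qs c ! t < length (cir B ! c')" using qs_lt[OF c t] c' by simp
  then show t': "t' < length (cir B ! c')" using arcs_nth[OF assms(3)] by fastforce
  show "\<forall>q\<in>set (qs c). cdist (length (cir B ! c')) (qs c ! t) t' \<le> cdist (length (cir B ! c')) q t'"
    using covers_least[OF c t, of t'] assms(4) t' c' by simp
  show "t < length (cir A ! c)" using t .
qed

end

text \<open>Both diagrams put the same marks on every circle of \<open>B\<close>, so after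
  relabeling by the inverse of \<tau>' their circles agree up to rotation. Their base arcs agree
  because both start at the nearest mark before the same base arc of \<open>B\<close>.\<close>

lemma hom_core_common_target:
  assumes wf: "wf_adiag A" "wf_adiag A'" "wf_adiag B"
    and hom: "hom_core A B \<pi> \<tau>" "hom_core A' B \<pi>' \<tau>'" and im: "set \<tau> = set \<tau>'"
    and bas: "set (bas A) \<subseteq> arcs A" "set (bas A') \<subseteq> arcs A'" "set (bas B) \<subseteq> arcs B"
  shows "narr A = narr A'" "hom_core A A' (map (idx \<pi>') \<pi>) (map (idx \<tau>') \<tau>)"
proof -
  interpret h: prehom A B \<pi> \<tau> using wf hom by unfold_locales (auto simp: hom_core_iff)
  interpret h': prehom A' B \<pi>' \<tau>' using wf hom by unfold_locales (auto simp: hom_core_iff)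
  let ?\<pi> = "map (idx \<pi>') \<pi>" let ?\<rho> = "map (idx \<tau>') \<tau>"
  show narr: "narr A = narr A'"
    using im h.len_\<tau> h'.len_\<tau> h.dist_\<tau> h'.dist_\<tau> by (metis distinct_card)
  have \<pi>: "?\<pi> ! c < length (cir A')" "\<pi>' ! (?\<pi> ! c) = \<pi> ! c" if "c < length (cir A)" for c
    using idx[of "\<pi> ! c" \<pi>'] that h.len_\<pi> h'.len_\<pi> h.\<pi>_lt[OF that] h'.set_\<pi> by auto
  have \<rho>: "?\<rho> ! a < narr A'" "\<tau>' ! (?\<rho> ! a) = \<tau> ! a" if "a < narr A" for a
    using idx[of "\<tau> ! a" \<tau>'] nth_mem[of a \<tau>] that h.len_\<tau> h'.len_\<tau> im by auto
  have T: "emap \<tau> e = emap \<tau>' (emap ?\<rho> e)" if "fst e < narr A" for e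
    using \<rho>(2)[OF that] by simp
  have T'inj: "inj_on (emap \<tau>') ({..<narr A'} \<times> UNIV)"
    using h'.dist_\<tau> h'.len_\<tau> by (auto simp: inj_on_def nth_eq_iff_index_eq)
  have LA: "fst ` set (cir A ! c) \<subseteq> {..<narr A}" if "c < length (cir A)" for c
    using wf_adiag_mem[OF wf(1) that] by blast
  have LA': "fst ` set (cir A' ! c) \<subseteq> {..<narr A'}" if "c < length (cir A')" for c
    using wf_adiag_mem[OF wf(2) that] by blast
  have qq: "set (h.qs c) = set (h'.qs (?\<pi> ! c))" if "c < length (cir A)" for c
    unfolding h.set_qs[OF that] h'.set_qs[OF \<pi>(1)[OF that]] im \<pi>(2)[OF that] ..
  have rot: "\<exists>k. rotate k (map (emap ?\<rho>) (cir A ! c)) = cir A' ! (?\<pi> ! c)" if c: "c < length (cir A)" for c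
  proof -
    let ?d = "?\<pi> ! c"
    note d = \<pi>[OF c]
    obtain r where r: "sorted_wrt (<) (rotate r (h.qs c))" using h.core c unfolding precore_def h.qs_def by blast
    obtain r' where r': "sorted_wrt (<) (rotate r' (h'.qs ?d))" using h'.core d(1) unfolding precore_def h'.qs_def by blast
    have "rotate r (h.qs c) = rotate r' (h'.qs ?d)"
      using r r' qq[OF c] by (intro strict_sorted_equal) auto
    then have "map ((!) (cir B ! (\<pi> ! c))) (rotate r (h.qs c)) = map ((!) (cir B ! (\<pi>' ! ?d))) (rotate r' (h'.qs ?d))"
      using d(2) by simp
    then have "rotate r (map (emap \<tau>) (cir A ! c)) = rotate r' (map (emap \<tau>') (cir A' ! ?d))"
      using h.map_qs[OF c] h'.map_qs[OF d(1)] by (simp add: rotate_map flip: rotate_map)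
    moreover have "map (emap \<tau>) (cir A ! c) = map (emap \<tau>') (map (emap ?\<rho>) (cir A ! c))"
      using T LA[OF c] by auto
    ultimately have me: "map (emap \<tau>') (rotate r (map (emap ?\<rho>) (cir A ! c))) = map (emap \<tau>') (rotate r' (cir A' ! ?d))"
      by (simp add: rotate_map)
    have "set (map (emap ?\<rho>) (cir A ! c)) \<subseteq> {..<narr A'} \<times> UNIV"
    proof
      fix y assume "y \<in> set (map (emap ?\<rho>) (cir A ! c))"
      then obtain e where e: "e \<in> set (cir A ! c)" "y = emap ?\<rho> e" by auto
      have "fst e < narr A" using e(1) LA[OF c] by auto
      then show "y \<in> {..<narr A'} \<times> UNIV" using \<rho>(1)[of "fst e"] e(2) by simp
    qed
    moreover have "set (cir A' ! ?d) \<subseteq> {..<narr A'} \<times> UNIV" using LA'[OF d(1)] by auto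
    ultimately have "inj_on (emap \<tau>') (set (rotate r (map (emap ?\<rho>) (cir A ! c))) \<union> set (rotate r' (cir A' ! ?d)))"
      unfolding set_rotate by (intro inj_on_subset[OF T'inj] Un_least)
    with me have "rotate r (map (emap ?\<rho>) (cir A ! c)) = rotate r' (cir A' ! ?d)"
      by (rule map_inj_on)
    moreover obtain k where "rotate k (rotate r' (cir A' ! ?d)) = cir A' ! ?d" using rotate_inverse by blast
    ultimately have "rotate k (rotate r (map (emap ?\<rho>) (cir A ! c))) = cir A' ! ?d" by simp
    then show ?thesis unfolding rotate_rotate by blast
  qed
  have gpos: "gpos A' ?\<rho> e = snd (epos A' (emap ?\<rho> e))" for e by (simp add: gpos_def)
  have core: "precore A A' ?\<pi> ?\<rho>"
    unfolding precore_def
  proof (intro conjI allI impI ballI)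
    show "length ?\<pi> = length (cir A)" "length ?\<rho> = narr A" using h.len_\<pi> h.len_\<tau> by auto
    show "distinct ?\<pi>" "set ?\<pi> = {..<length (cir A')}"
      using map_idx[OF h.dist_\<pi> h'.dist_\<pi>] h.set_\<pi> h'.set_\<pi> h'.len_\<pi> by auto
    show "distinct ?\<rho>" "set ?\<rho> \<subseteq> {..<narr A'}"
      using map_idx[OF h.dist_\<tau> h'.dist_\<tau> im] h'.len_\<tau> by auto
  next
    fix c e assume ce: "c < length (cir A)" "e \<in> set (cir A ! c)"
    obtain k where k: "rotate k (map (emap ?\<rho>) (cir A ! c)) = cir A' ! (?\<pi> ! c)" using rot[OF ce(1)] by blast
    have "emap ?\<rho> e \<in> set (rotate k (map (emap ?\<rho>) (cir A ! c)))"
      unfolding set_rotate set_map using ce(2) by (rule imageI)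
    then show "emap ?\<rho> e \<in> set (cir A' ! (?\<pi> ! c))" unfolding k .
  next
    fix c assume c: "c < length (cir A)"
    obtain k where k: "rotate k (map (emap ?\<rho>) (cir A ! c)) = cir A' ! (?\<pi> ! c)" using rot[OF c] by blast
    have "rotate k (map (gpos A' ?\<rho>) (cir A ! c)) = map (\<lambda>e. snd (epos A' e)) (rotate k (map (emap ?\<rho>) (cir A ! c)))"
      unfolding rotate_map by (simp add: gpos_def)
    also have "\<dots> = [0..<length (cir A' ! (?\<pi> ! c))]"
      unfolding k by (rule sorted_positions[OF wf(2) \<pi>(1)[OF c]])
    finally show "\<exists>r. sorted_wrt (<) (rotate r (map (gpos A' ?\<rho>) (cir A ! c)))"
      by (intro exI[of _ k]) simp
  qed
  have len: "length (bas A) = length (bas A')" "length (bas A) = length (bas B)" using hom unfolding hom_core_iff by auto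
  have "covers A A' ?\<pi> ?\<rho> (bas A ! i) (bas A' ! i)" if i: "i < length (bas A)" for i
  proof -
    obtain c t where ct: "bas A ! i = (c, t)" by fastforce
    obtain d s where ds: "bas A' ! i = (d, s)" by fastforce
    obtain c' t' where ct': "bas B ! i = (c', t')" by fastforce
    have a: "(c, t) \<in> arcs A" "(d, s) \<in> arcs A'" "(c', t') \<in> arcs B"
      using bas i len ct ds ct' by (metis nth_mem subsetD)+
    have cv: "covers A B \<pi> \<tau> (c, t) (c', t')" "covers A' B \<pi>' \<tau>' (d, s) (c', t')"
      using hom i len ct ds ct' unfolding hom_core_iff by metis+
    have c: "c < length (cir A)" and dl: "d < length (cir A')" using arcs_nth a by blast+
    have "\<pi>' ! d = \<pi>' ! (?\<pi> ! c)" using \<pi>(2)[OF c] h.covers_fst[OF cv(1)] h'.covers_fst[OF cv(2)] by simp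
    then have d: "d = ?\<pi> ! c" using h'.\<pi>_inj[OF dl \<pi>(1)[OF c]] by simp
    show ?thesis
    proof (cases "cir A ! c = []")
      case True then show ?thesis using ct ds d by (simp add: covers_def)
    next
      case False
      obtain k where k: "rotate k (map (emap ?\<rho>) (cir A ! c)) = cir A' ! (?\<pi> ! c)" using rot[OF c] by blast
      have "length (cir A' ! d) = length (cir A ! c)" unfolding d k[symmetric] by simp
      then have ne': "cir A' ! d \<noteq> []" using False by auto
      note p = h.covers_same[OF a(1) False a(3) cv(1)]
      note p' = h'.covers_same[OF a(2) ne' a(3) cv(2)]
      have "h.qs c ! t = h'.qs d ! s"
      \<comment> \<open>Each of the two starting marks is nearest among the common marks, so their
        distances bound each other.\<close>
      proof (rule cdist_inj[OF p(5) p'(5) p(4)], rule antisym)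
        show "cdist (length (cir B ! c')) (h.qs c ! t) t' \<le> cdist (length (cir B ! c')) (h'.qs d ! s) t'"
          using p(3) p'(1) qq[OF c] d by simp
        show "cdist (length (cir B ! c')) (h'.qs d ! s) t' \<le> cdist (length (cir B ! c')) (h.qs c ! t) t'"
          using p'(3) p(1) qq[OF c] d by simp
      qed
      then have "emap \<tau> (cir A ! c ! t) = emap \<tau>' (cir A' ! d ! s)"
        using h.cir_qs[OF c p(6)] h'.cir_qs[OF dl p'(6)] p(2) p'(2) by simp
      then have "emap \<tau>' (emap ?\<rho> (cir A ! c ! t)) = emap \<tau>' (cir A' ! d ! s)"
        using T[OF wf_adiag_nth[OF wf(1) c p(6)]] by simp
      moreover have "emap ?\<rho> (cir A ! c ! t) \<in> {..<narr A'} \<times> UNIV" "cir A' ! d ! s \<in> {..<narr A'} \<times> UNIV"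
        using \<rho>(1)[OF wf_adiag_nth[OF wf(1) c p(6)]] wf_adiag_nth[OF wf(2) dl p'(6)] by (auto simp: mem_Times_iff)
      ultimately have "emap ?\<rho> (cir A ! c ! t) = cir A' ! d ! s" by (rule inj_onD[OF T'inj])
      then have "gpos A' ?\<rho> (cir A ! c ! t) = s" using epos_nth[OF wf(2) dl p'(6)] by (simp add: gpos)
      moreover have "0 < length (cir A' ! d)" using ne' by simp
      ultimately show ?thesis using ct ds d by (auto simp: covers_def Let_def)
    qed
  qed
  then show "hom_core A A' ?\<pi> ?\<rho>" using core len unfolding hom_core_iff by blast
qed

lemma hom_core_refl:
  assumes wf: "wf_adiag A" and bas: "set (bas A) \<subseteq> arcs A"
  shows "hom_core A A [0..<length (cir A)] [0..<narr A]"
proof -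
  have e: "emap [0..<narr A] e = e" "gpos A [0..<narr A] e = snd (epos A e)"
    if "c < length (cir A)" "e \<in> set (cir A ! c)" for c e
  proof -
    have "fst e < narr A" using wf_adiag_mem[OF wf that] .
    then show "emap [0..<narr A] e = e" "gpos A [0..<narr A] e = snd (epos A e)" by (auto simp: gpos_def)
  qed
  have "precore A A [0..<length (cir A)] [0..<narr A]"
    unfolding precore_def
  proof (intro conjI allI impI ballI)
    fix c x assume "c < length (cir A)" "x \<in> set (cir A ! c)"
    then show "emap [0..<narr A] x \<in> set (cir A ! ([0..<length (cir A)] ! c))" using e(1) by simp
  next
    fix c assume c: "c < length (cir A)"
    have "map (gpos A [0..<narr A]) (cir A ! c) = [0..<length (cir A ! c)]"
      using sorted_positions[OF wf c] e(2)[OF c] by (metis (no_types, lifting) map_eq_conv)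
    then show "\<exists>r. sorted_wrt (<) (rotate r (map (gpos A [0..<narr A]) (cir A ! c)))"
      by (intro exI[of _ 0]) simp
  qed (auto simp: atLeast0LessThan)
  moreover have "covers A A [0..<length (cir A)] [0..<narr A] (bas A ! i) (bas A ! i)" if i: "i < length (bas A)" for i
  proof -
    obtain c t where ct: "bas A ! i = (c, t)" by fastforce
    have "(c, t) \<in> arcs A" using bas i ct by (metis nth_mem subsetD)
    then have c: "c < length (cir A)" "cir A ! c \<noteq> [] \<longrightarrow> t < length (cir A ! c)" using arcs_nth by auto
    show ?thesis
    proof (cases "cir A ! c = []")
      case True then show ?thesis using ct c by (simp add: covers_def)
    next
      case False
      then have t: "t < length (cir A ! c)" using c by simp
      have "gpos A [0..<narr A] (cir A ! c ! t) = t" using e(2)[OF c(1)] t epos_nth[OF wf c(1) t] by simp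
      then show ?thesis using ct c False by (auto simp: covers_def Let_def)
    qed
  qed
  ultimately show ?thesis unfolding hom_core_iff by blast
qed

text \<open>With equally many arrows the first map hits every arrow of \<open>A'\<close>, hence
  every position on its circles: it only rotates and relabels circle lists. The marks of the
  composite are therefore those of the second map.\<close>

lemma hom_core_comp:
  assumes wf: "wf_adiag A" "wf_adiag A'" "wf_adiag B"
    and hom: "hom_core A A' \<pi>1 \<tau>1" "hom_core A' B \<pi> \<tau>" and narr: "narr A = narr A'"
    and bas: "set (bas A) \<subseteq> arcs A" "set (bas A') \<subseteq> arcs A'" "set (bas B) \<subseteq> arcs B"
  shows "hom_core A B (map ((!) \<pi>) \<pi>1) (map ((!) \<tau>) \<tau>1)" "set (map ((!) \<tau>) \<tau>1) = set \<tau>"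
proof -
  interpret h1: prehom A A' \<pi>1 \<tau>1 using wf hom by unfold_locales (auto simp: hom_core_iff)
  interpret h: prehom A' B \<pi> \<tau> using wf hom by unfold_locales (auto simp: hom_core_iff)
  let ?\<pi> = "map ((!) \<pi>) \<pi>1" let ?\<tau> = "map ((!) \<tau>) \<tau>1"
  have full: "set \<tau>1 = {..<narr A'}"
    using h1.set_\<tau> h1.len_\<tau> h1.dist_\<tau> narr by (intro card_subset_eq) (auto simp: distinct_card)
  have \<tau>set: "set \<tau> = (!) \<tau> ` {..<narr A'}" using h.len_\<tau> by (auto simp: set_conv_nth)
  show st: "set ?\<tau> = set \<tau>" unfolding \<tau>set set_map full ..
  have \<pi>set: "set \<pi> = (!) \<pi> ` {..<length (cir A')}" using h.len_\<pi> by (auto simp: set_conv_nth)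
  have \<pi>nth: "?\<pi> ! c = \<pi> ! (\<pi>1 ! c)" if "c < length (cir A)" for c using that h1.len_\<pi> by simp
  have \<tau>nth: "emap ?\<tau> e = emap \<tau> (emap \<tau>1 e)" if "fst e < narr A" for e using that h1.len_\<tau> by simp
  have LA: "fst e < narr A" if "c < length (cir A)" "e \<in> set (cir A ! c)" for c e
    using wf_adiag_mem[OF wf(1) that] .
  have rot: "\<exists>k. rotate k (map (emap \<tau>1) (cir A ! c)) = cir A' ! (\<pi>1 ! c)" if c: "c < length (cir A)" for c
  proof -
    let ?d = "\<pi>1 ! c"
    have d: "?d < length (cir A')" using h1.\<pi>_lt[OF c] .
    obtain r where r: "sorted_wrt (<) (rotate r (h1.qs c))" using h1.core c unfolding precore_def h1.qs_def by blast
    have "set (h1.qs c) = set [0..<length (cir A' ! ?d)]"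
      unfolding h1.set_qs[OF c] full using wf_adiag_nth[OF wf(2) d] by auto
    then have "rotate r (h1.qs c) = [0..<length (cir A' ! ?d)]"
      using r by (intro strict_sorted_equal) auto
    then have "map ((!) (cir A' ! ?d)) (rotate r (h1.qs c)) = cir A' ! ?d" by (simp add: map_nth)
    then have "rotate r (map (emap \<tau>1) (cir A ! c)) = cir A' ! ?d"
      using h1.map_qs[OF c] by (simp flip: rotate_map)
    then show ?thesis by blast
  qed
  have gp: "gpos B ?\<tau> e = gpos B \<tau> (emap \<tau>1 e)" if "fst e < narr A" for e
    using \<tau>nth[OF that] unfolding gpos_def by simp
  have core: "precore A B ?\<pi> ?\<tau>"
    unfolding precore_def
  proof (intro conjI allI impI ballI)
    show "length ?\<pi> = length (cir A)" "length ?\<tau> = narr A" using h1.len_\<pi> h1.len_\<tau> by auto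
    show "set ?\<pi> = {..<length (cir B)}" using \<pi>set h1.set_\<pi> h.set_\<pi> by simp
    show "set ?\<tau> \<subseteq> {..<narr B}" unfolding st by (rule h.set_\<tau>)
    show "distinct ?\<pi>" using h1.dist_\<pi> h1.set_\<pi> h.dist_\<pi> h.len_\<pi>
      by (auto simp: distinct_map inj_on_def nth_eq_iff_index_eq)
    show "distinct ?\<tau>" using h1.dist_\<tau> full h.dist_\<tau> h.len_\<tau>
      by (auto simp: distinct_map inj_on_def nth_eq_iff_index_eq)
  next
    fix c e assume ce: "c < length (cir A)" "e \<in> set (cir A ! c)"
    have "emap \<tau>1 e \<in> set (cir A' ! (\<pi>1 ! c))" using h1.core ce unfolding precore_def by blast
    then have "emap \<tau> (emap \<tau>1 e) \<in> set (cir B ! (\<pi> ! (\<pi>1 ! c)))"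
      using h.core h1.\<pi>_lt[OF ce(1)] unfolding precore_def by blast
    then show "emap ?\<tau> e \<in> set (cir B ! (?\<pi> ! c))" unfolding \<pi>nth[OF ce(1)] \<tau>nth[OF LA[OF ce]] .
  next
    fix c assume c: "c < length (cir A)"
    obtain k where k: "rotate k (map (emap \<tau>1) (cir A ! c)) = cir A' ! (\<pi>1 ! c)" using rot[OF c] by blast
    obtain r where r: "sorted_wrt (<) (rotate r (map (gpos B \<tau>) (cir A' ! (\<pi>1 ! c))))"
      using h.core h1.\<pi>_lt[OF c] unfolding precore_def by blast
    have "map (gpos B ?\<tau>) (cir A ! c) = map (gpos B \<tau>) (map (emap \<tau>1) (cir A ! c))"
      using gp LA[OF c] by simp
    then have "rotate k (map (gpos B ?\<tau>) (cir A ! c)) = map (gpos B \<tau>) (cir A' ! (\<pi>1 ! c))"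
      unfolding k[symmetric] rotate_map by simp
    then have "sorted_wrt (<) (rotate (r + k) (map (gpos B ?\<tau>) (cir A ! c)))"
      using r by (simp flip: rotate_rotate)
    then show "\<exists>r. sorted_wrt (<) (rotate r (map (gpos B ?\<tau>) (cir A ! c)))" by blast
  qed
  interpret h2: prehom A B ?\<pi> ?\<tau> using wf core by unfold_locales
  have len: "length (bas A) = length (bas A')" "length (bas A) = length (bas B)" using hom unfolding hom_core_iff by auto
  have "covers A B ?\<pi> ?\<tau> (bas A ! i) (bas B ! i)" if i: "i < length (bas A)" for i
  proof -
    obtain c t where ct: "bas A ! i = (c, t)" by fastforce
    obtain d s where ds: "bas A' ! i = (d, s)" by fastforce
    obtain c' t' where ct': "bas B ! i = (c', t')" by fastforce
    have a: "(c, t) \<in> arcs A" "(d, s) \<in> arcs A'" "(c', t') \<in> arcs B"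
      using bas i len ct ds ct' by (metis nth_mem subsetD)+
    have cv: "covers A A' \<pi>1 \<tau>1 (c, t) (d, s)" "covers A' B \<pi> \<tau> (d, s) (c', t')"
      using hom i len ct ds ct' unfolding hom_core_iff by metis+
    have c: "c < length (cir A)" and dl: "d < length (cir A')" using arcs_nth a by blast+
    have d: "d = \<pi>1 ! c" using h1.covers_fst[OF cv(1)] by simp
    have c': "c' = ?\<pi> ! c" using h.covers_fst[OF cv(2)] d \<pi>nth[OF c] by simp
    show ?thesis
    proof (cases "cir A ! c = []")
      case True then show ?thesis using ct ct' c' by (simp add: covers_def)
    next
      case False
      obtain k where k: "rotate k (map (emap \<tau>1) (cir A ! c)) = cir A' ! (\<pi>1 ! c)" using rot[OF c] by blast
      have "length (cir A' ! d) = length (cir A ! c)" unfolding d k[symmetric] by simp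
      then have ne': "cir A' ! d \<noteq> []" using False by auto
      note p = h1.covers_same[OF a(1) False a(2) cv(1)]
      note p' = h.covers_same[OF a(2) ne' a(3) cv(2)]
      have "fst (cir A' ! (\<pi>1 ! c) ! s) \<in> set \<tau>1" using wf_adiag_nth[OF wf(2) dl p(4)] full d by simp
      then have "s \<in> set (h1.qs c)" unfolding h1.set_qs[OF c] using p(4) d by simp
      then have "cdist (length (cir A' ! d)) (h1.qs c ! t) s \<le> cdist (length (cir A' ! d)) s s" using p(3) by blast
      then have "h1.qs c ! t = s" using cdist_0[OF p(5) p(4)] p(4) by simp
      then have "emap \<tau>1 (cir A ! c ! t) = cir A' ! d ! s" using h1.cir_qs[OF c p(6)] d by simp
      then have q: "h2.qs c ! t = h.qs d ! s"
        using gp[OF wf_adiag_nth[OF wf(1) c p(6)]] p(6) p'(6) by (simp add: h2.qs_def h.qs_def)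
      have "set (h2.qs c) = set (h.qs d)"
        unfolding h2.set_qs[OF c] st \<pi>nth[OF c] using h.set_qs[OF dl] d by simp
      then have "\<forall>q\<in>set (h2.qs c). cdist (length (cir B ! c')) (h2.qs c ! t) t' \<le> cdist (length (cir B ! c')) q t'"
        using p'(3) q by simp
      then have "covers A B ?\<pi> ?\<tau> (c, t) (?\<pi> ! c, t')"
        using h2.covers_least[OF c p(6), of t'] p'(4) unfolding c' by blast
      then show ?thesis using ct ct' c' by simp
    qed
  qed
  then show "hom_core A B ?\<pi> ?\<tau>" using core len unfolding hom_core_iff by auto
qed

text \<open>The two factor maps agree at the base points and obey the same rule along the flow, so
  they agree wherever the bases lead, which is everywhere. Arrows are recovered from the arcs that
  end at them, circles from the arcs on them.\<close>

lemma hom_rigid: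
  assumes "braid_hom w m A B \<pi> \<tau>" "braid_hom w m A B \<pi>' \<tau>'" "set \<tau> = set \<tau>'"
    and b: "\<forall>j\<in>set J. braid_hom.pt w m A B \<pi> \<tau> (0, j) = braid_hom.pt w m A B \<pi>' \<tau>' (0, j)"
    and J: "set J \<subseteq> {1..m}"
    and cov: "\<forall>z\<in>states w m. \<exists>j\<in>set J. reach (fstep w (set \<tau>)) (0, j) z"
  shows "\<pi> = \<pi>' \<and> \<tau> = \<tau>'"
proof -
  interpret h: braid_hom w m A B \<pi> \<tau> by fact
  interpret h': braid_hom w m A B \<pi>' \<tau>' by fact
  have eq: "h.pt z = h'.pt z" if "z \<in> states w m" for z
  proof -
    obtain j where j: "j \<in> set J" "reach (fstep w (set \<tau>)) (0, j) z" using cov \<open>z \<in> states w m\<close> by blast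
    have "y \<in> states w m \<and> h.pt y = h'.pt y \<longrightarrow> h.pt z = h'.pt z" if "reach (fstep w (set \<tau>)) y z" for y
      using that
    proof (induction rule: reach_induct)
      case (step y)
      show ?case
      proof
        assume y: "y \<in> states w m \<and> h.pt y = h'.pt y"
        have "h.pt (fstep w (set \<tau>) y) = h'.pt (fstep w (set \<tau>) y)"
        proof (cases "y \<in> events w (set \<tau>)")
          case True
          then show ?thesis using h.event[of y] h'.event[of y] y assms(3) by simp
        next
          case False
          then show ?thesis using h.nonevent[of y] h'.nonevent[of y] y assms(3) by simp
        qed
        then show "h.pt z = h'.pt z" using step.IH h.fX[of y] y by blast
      qed
    qed simp
    moreover have "(0, j) \<in> states w m" using j J by (auto simp: states_def)
    ultimately show ?thesis using j b by blast
  qed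
  have "\<tau> ! a = \<tau>' ! a" if a: "a < narr A" for a
  proof -
    have "\<tau> ! a \<in> set \<tau>'" using a h.len_\<tau> assms(3) by (metis nth_mem)
    then obtain a' where a': "a' < narr A" "\<tau>' ! a' = \<tau> ! a" using h'.len_\<tau> by (metis in_set_conv_nth)
    have x: "entry w (\<tau> ! a) False \<in> {1..m}" "\<tau> ! a < length w"
      using h.entry_in h.\<tau>_lt[OF a] h.narrB by auto
    have "arc_ending A (a, False) = h.pt (\<tau> ! a, entry w (\<tau> ! a) False)"
      using h.pt_event(1)[OF x(1) a HOL.refl] by simp
    also have "\<dots> = h'.pt (\<tau>' ! a', entry w (\<tau>' ! a') False)"
      unfolding a'(2) by (rule eq) (use x in \<open>auto simp: states_def\<close>)
    also have "\<dots> = arc_ending A (a', False)"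
      using h'.pt_event(1)[OF _ a'(1) HOL.refl] x(1) a'(2) by simp
    finally have "a = a'" using arc_ending_inj[OF h.wfA a a'(1)] by blast
    then show ?thesis using a' by simp
  qed
  then have "\<tau> = \<tau>'" using h.len_\<tau> h'.len_\<tau> by (intro nth_equalityI) auto
  moreover have "\<pi> ! c = \<pi>' ! c" if c: "c < length (cir A)" for c
  proof -
    have "(c, 0) \<in> h.pt ` states w m" unfolding h.pt_image using c by (auto simp: arcs_def)
    then obtain z where z: "z \<in> states w m" "h.pt z = (c, 0)" by auto
    then show ?thesis using h.\<pi>_pt[OF z(1)] h'.\<pi>_pt[OF z(1)] eq[OF z(1)] by simp
  qed
  then have "\<pi> = \<pi>'" using h.len_\<pi> h'.len_\<pi> by (intro nth_equalityI) auto
  ultimately show ?thesis by simp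
qed

section \<open>The pairing as a sum over states\<close>

lemma colorings_facts:
  assumes "(J, col) \<in> colorings k m"
  shows "length J = k" "set J \<subseteq> {1..m}" "\<forall>j\<in>{1..m} - set J. col ! (j - 1) - 1 < length J" "1 \<le> k"
proof -
  show J: "length J = k" "set J \<subseteq> {1..m}" "1 \<le> k" using assms by (auto simp: colorings_def)
  show "\<forall>j\<in>{1..m} - set J. col ! (j - 1) - 1 < length J"
  proof
    fix j assume j: "j \<in> {1..m} - set J"
    have all: "\<forall>j\<in>{1..m}. if j \<in> set J then col ! (j-1) = 0
        else 1 \<le> col ! (j-1) \<and> col ! (j-1) \<le> card {l. l < k \<and> J ! l < j}"
      using assms unfolding colorings_def mem_Collect_eq prod.case by blast
    have "1 \<le> col ! (j-1)" "col ! (j-1) \<le> card {l. l < k \<and> J ! l < j}"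
      using bspec[OF all, of j] j by auto
    moreover have "card {l. l < k \<and> J ! l < j} \<le> card {..<k}" by (intro card_mono) auto
    ultimately show "col ! (j - 1) - 1 < length J" using J by simp
  qed
qed

lemma cir_cgd [simp]: "cir (cgd w m J) = bgd_cir w m"
  by (simp add: cgd_def)

lemma bas_cgd: "i < length J \<Longrightarrow> bas (cgd w m J) ! i = lab_arc w m (J ! i)" "length (bas (cgd w m J)) = length J"
  by (auto simp: cgd_def)

lemma (in braid) wf_cgd: "wf_adiag (cgd w m J)"
  by (rule wf_bgd) simp

lemma (in braid) bas_cgd_arcs: "set J \<subseteq> {1..m} \<Longrightarrow> set (bas (cgd w m J)) \<subseteq> arcs (cgd w m J)"
proof -
  assume J: "set J \<subseteq> {1..m}"
  have "lab_arc w m j \<in> arcs (cgd w m J)" if "j \<in> {1..m}" for j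
    using lev_arcs[OF that, of 0] by (simp add: arcs_def case_prod_beta)
  then show ?thesis using J by (auto simp: cgd_def)
qed

lemma braid_homI:
  assumes "braid_word m w" "wf_adiag A" "precore A (cgd w m J) \<pi> \<tau>"
  shows "braid_hom w m A (cgd w m J) \<pi> \<tau>"
proof -
  interpret braid w m by unfold_locales (rule assms)
  show ?thesis by unfold_locales (use assms wf_cgd in auto)
qed

lemma bas_pt:
  assumes "braid_hom w m A (cgd w m J) \<pi> \<tau>" "set J \<subseteq> {1..m}" "set (bas A) \<subseteq> arcs A"
    "hom_core A (cgd w m J) \<pi> \<tau>"
  shows "bas A = map (\<lambda>j. braid_hom.pt w m A (cgd w m J) \<pi> \<tau> (0, j)) J"
proof (rule nth_equalityI)
  interpret braid_hom w m A "cgd w m J" \<pi> \<tau> by fact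
  show len: "length (bas A) = length (map (\<lambda>j. pt (0, j)) J)" using assms(4) bas_cgd(2)[of w m J] unfolding hom_core_iff by simp
  fix i assume i: "i < length (bas A)"
  then have "covers A (cgd w m J) \<pi> \<tau> (bas A ! i) (bas (cgd w m J) ! i)"
    using assms(4) unfolding hom_core_iff by blast
  then have "covers A (cgd w m J) \<pi> \<tau> (bas A ! i) (lab_arc w m (J ! i))"
    using bas_cgd(1)[of i J w m] i len by simp
  moreover have "(0, J ! i) \<in> states w m" using subsetD[OF assms(2) nth_mem[of i J]] i len by (auto simp: states_def)
  then have "lab_arc w m (J ! i) \<in> arcs (cgd w m J)" using lev_in_arcs[of "(0, J ! i)"] by simp
  moreover have "bas A ! i \<in> arcs A" using i assms(3) by auto
  ultimately show "bas A ! i = map (\<lambda>j. pt (0, j)) J ! i"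
    using cov_iff i len by (simp add: pt_def)
qed

text \<open>All arcs named in the conditions are values of \<open>pt\<close>: the base arcs by
  \<open>bas_pt\<close>, the arc over a coloured label by uniqueness of the covering arc. Then
  \<open>good_iff\<close> removes \<open>A\<close>.\<close>

lemma hom_good:
  assumes bw: "braid_word m w" and J: "(J, col) \<in> colorings k m" and wf: "wf_adiag A"
    and bas: "set (bas A) \<subseteq> arcs A" and hom: "hom_core A (cgd w m J) \<pi> \<tau>"
  shows "multibased A k \<and> descending A \<and> (\<pi>, \<tau>) \<in> homs A w m J col \<longleftrightarrow> good w m (set \<tau>) J col"
proof -
  note Jf = colorings_facts[OF J]
  have "braid_hom w m A (cgd w m J) \<pi> \<tau>" using braid_homI[OF bw wf] hom unfolding hom_core_iff by blast
  then interpret braid_hom w m A "cgd w m J" \<pi> \<tau> .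
  have b: "bas A = map (\<lambda>j. pt (0, j)) J" using bas_pt[OF _ Jf(2) bas hom] braid_hom_axioms by blast
  have "(\<exists>\<alpha>\<in>arcs A. covers A (cgd w m J) \<pi> \<tau> \<alpha> (lab_arc w m j) \<and> same_comp A (bas A ! (col ! (j-1) - 1)) \<alpha>)
    \<longleftrightarrow> same_comp A (bas A ! (col ! (j - 1) - 1)) (pt (0, j))" if "j \<in> {1..m}" for j
  proof -
    have st: "(0, j) \<in> states w m" using that by (simp add: states_def)
    have l: "lab_arc w m j \<in> arcs (cgd w m J)" "pt (0, j) = cov (lab_arc w m j)"
      using lev_in_arcs[OF st] by (auto simp: pt_def)
    show ?thesis using cov_iff[OF l(1)] cov_arcs[OF l(1)] l(2) by auto
  qed
  then have "(\<pi>, \<tau>) \<in> homs A w m J col \<longleftrightarrow>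
    (\<forall>j\<in>{1..m}. j \<notin> set J \<longrightarrow> same_comp A (bas A ! (col ! (j - 1) - 1)) (pt (0, j)))"
    unfolding homs_def using hom by simp
  then show ?thesis using good_iff[OF Jf(2) b Jf(3)] unfolding Jf(1) by simp
qed

section \<open>The diagram of a state\<close>

definition subdiagram :: "adiag \<Rightarrow> nat list \<Rightarrow> arc list \<Rightarrow> adiag" where
  "subdiagram B xs bs = \<lparr>cir = map (\<lambda>L. map (\<lambda>e. (idx xs (fst e), snd e)) (filter (\<lambda>e. fst e \<in> set xs) L)) (cir B), bas = bs\<rparr>"

lemma subdiagram_facts:
  assumes wf: "wf_adiag B" and xs: "distinct xs" "set xs \<subseteq> {..<narr B}"
  shows "narr (subdiagram B xs bs) = length xs" "wf_adiag (subdiagram B xs bs)"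
    "precore (subdiagram B xs bs) B [0..<length (cir B)] xs"
proof -
  let ?A = "subdiagram B xs bs" let ?R = "\<lambda>e :: endpt. (idx xs (fst e), snd e)"
  have R: "emap xs (?R e) = e" if "fst e \<in> set xs" for e :: endpt
    using idx(2)[OF that] by simp
  have inj: "inj_on ?R (set xs \<times> UNIV)"
  proof (rule inj_onI)
    fix e e' :: endpt assume "e \<in> set xs \<times> UNIV" "e' \<in> set xs \<times> UNIV" "?R e = ?R e'"
    then show "e = e'" using R[of e] R[of e'] by auto
  qed
  have conc: "concat (cir ?A) = map ?R (filter (\<lambda>e. fst e \<in> set xs) (concat (cir B)))"
    by (simp add: subdiagram_def filter_concat map_concat comp_def)
  have setc: "set (filter (\<lambda>e. fst e \<in> set xs) (concat (cir B))) = set xs \<times> UNIV"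
    using wf xs(2) unfolding wf_adiag_def set_filter by auto
  have d: "distinct (concat (cir ?A))"
    unfolding conc distinct_map setc using wf inj by (simp add: wf_adiag_def)
  have "idx xs ` set xs = {..<length xs}" using map_idx(2)[OF xs(1) xs(1)] by simp
  then have s: "set (concat (cir ?A)) = {..<length xs} \<times> UNIV"
    unfolding conc set_map setc by (auto simp: image_iff) (metis imageE lessThan_iff)
  show n: "narr ?A = length xs"
    unfolding narr_def using distinct_card[OF d] s by (simp add: card_cartesian_product)
  show wfA: "wf_adiag ?A" unfolding wf_adiag_def n using d s by blast
  have len: "length (cir ?A) = length (cir B)" by (simp add: subdiagram_def)
  have nth: "cir ?A ! c = map ?R (filter (\<lambda>e. fst e \<in> set xs) (cir B ! c))" if "c < length (cir B)" for c
    using that by (simp add: subdiagram_def)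
  show "precore ?A B [0..<length (cir B)] xs"
    unfolding precore_def
  proof (intro conjI allI impI ballI)
    fix c e assume c: "c < length (cir ?A)" and e: "e \<in> set (cir ?A ! c)"
    obtain e' where e': "e' \<in> set (cir B ! c)" "fst e' \<in> set xs" "e = ?R e'"
      using c e nth[of c] len by auto
    then show "emap xs e \<in> set (cir B ! ([0..<length (cir B)] ! c))" using R[OF e'(2)] c len by simp
  next
    fix c assume "c < length (cir ?A)"
    then have c: "c < length (cir B)" using len by simp
    have "map (gpos B xs) (cir ?A ! c) = map (\<lambda>e. snd (epos B e)) (filter (\<lambda>e. fst e \<in> set xs) (cir B ! c))"
      unfolding nth[OF c] using R by (simp add: gpos_def)
    moreover have "sorted_wrt (<) (map (\<lambda>e. snd (epos B e)) (cir B ! c))"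
      unfolding sorted_positions[OF wf c] by simp
    then have "sorted_wrt (<) (map (\<lambda>e. snd (epos B e)) (filter (\<lambda>e. fst e \<in> set xs) (cir B ! c)))"
      unfolding sorted_wrt_map by (rule sorted_wrt_filter)
    ultimately show "\<exists>r. sorted_wrt (<) (rotate r (map (gpos B xs) (cir ?A ! c)))"
      by (intro exI[of _ 0]) simp
  qed (use len n xs in \<open>auto simp: atLeast0LessThan\<close>)
qed

lemma covers_cir_cong: "cir A = cir A' \<Longrightarrow> covers A B \<pi> \<tau> = covers A' B \<pi> \<tau>"
  by (intro ext) (simp add: covers_def)

lemma arcs_cir_cong: "cir A = cir A' \<Longrightarrow> arcs A = arcs A'"
  by (simp add: arcs_def)

lemma good_state_hom:
  assumes bw: "braid_word m w" and J: "(J, col) \<in> colorings k m" and S: "S \<subseteq> {..<length w}"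
    and good: "good w m S J col"
  shows "\<exists>A \<pi> \<tau>. multibased A k \<and> descending A \<and> narr A = card S \<and> hom_core A (cgd w m J) \<pi> \<tau> \<and> set \<tau> = S"
proof -
  interpret braid w m by unfold_locales (rule bw)
  let ?B = "cgd w m J" let ?xs = "sorted_list_of_set S" let ?\<pi> = "[0..<length (cir ?B)]"
  note Jf = colorings_facts[OF J]
  have fin: "finite S" using S finite_subset by blast
  have xs: "distinct ?xs" "set ?xs = S" "set ?xs \<subseteq> {..<narr ?B}"
    using fin S narr_bgd[of ?B] by auto
  \<comment> \<open>A version without base points: covering arcs depend on the circles only, and
    they determine the base arcs \<open>bs\<close> of the final diagram.\<close>
  let ?Z = "subdiagram ?B ?xs []"
  note A0 = subdiagram_facts[OF wf_cgd[of J] xs(1,3)]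
  interpret h0: prehom ?Z ?B ?\<pi> ?xs using A0 wf_cgd by unfold_locales auto
  define bs where "bs = map h0.cov (bas ?B)"
  let ?A = "subdiagram ?B ?xs bs"
  have cir: "cir ?A = cir ?Z" by (simp add: subdiagram_def)
  have bas: "bas ?A = bs" by (simp add: subdiagram_def)
  note Bb = bas_cgd_arcs[OF Jf(2)]
  have hom: "hom_core ?A ?B ?\<pi> ?xs"
    unfolding hom_core_iff covers_cir_cong[OF cir] bas
  proof (intro conjI allI impI)
    fix i assume i: "i < length bs"
    then have "bas ?B ! i \<in> arcs ?B" using Bb unfolding bs_def by auto
    then show "covers ?Z ?B ?\<pi> ?xs (bs ! i) (bas ?B ! i)"
      using h0.covers_cov i unfolding bs_def by simp
  qed (use A0 in \<open>auto simp: bs_def\<close>)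
  have "set bs \<subseteq> arcs ?Z" unfolding bs_def using h0.cov_arcs Bb by auto
  then have "set (bas ?A) \<subseteq> arcs ?A" unfolding bas arcs_cir_cong[OF cir] .
  then have "multibased ?A k \<and> descending ?A"
    using hom_good[OF bw J A0(2) _ hom] good xs(2) by simp
  moreover have "narr ?A = card S" using A0(1) fin by simp
  ultimately show ?thesis using hom xs(2) by blast
qed

section \<open>Finiteness of the sets of diagrams\<close>

lemma length_filter_nonempty: "length (filter (\<lambda>L. L \<noteq> []) xss) \<le> length (concat xss)"
proof (induction xss)
  case (Cons L xss)
  then show ?case by (cases L) auto
qed simp

text \<open>Every nonempty circle uses up one of the \<open>2 * narr A\<close> endpoints, and every
  empty circle is a boundary component of its own, of which there are \<open>k\<close>.\<close>

lemma multibased_length_cir: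
  assumes "multibased A k" shows "length (cir A) \<le> 2 * narr A + k"
proof -
  have wf: "wf_adiag A" and card: "card (bcomps A) = k" using assms by (auto simp: multibased_def)
  then have "card (set (concat (cir A))) = 2 * narr A"
    by (simp add: wf_adiag_def card_cartesian_product del: set_concat)
  then have "length (concat (cir A)) = 2 * narr A"
    using wf distinct_card[of "concat (cir A)"] unfolding wf_adiag_def by simp
  then have ne: "length (filter (\<lambda>L. L \<noteq> []) (cir A)) \<le> 2 * narr A"
    using length_filter_nonempty by metis
  let ?E = "{c. c < length (cir A) \<and> cir A ! c = []}"
  have stay: "\<beta> = (c, 0)" if c: "cir A ! c = []" and r: "reach (next_arc A) (c, 0) \<beta>" for c \<beta>
    using reach_closed[OF r, of "{(c, 0)}"] next_arc_Nil[OF c, of 0] by simp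
  have "comp_of A (c, 0) = {(c, 0)}" if "c \<in> ?E" for c
    using that stay by (auto simp: comp_of_def same_comp_reach arcs_def)
  then have "(\<lambda>c. {(c, 0)}) ` ?E \<subseteq> bcomps A"
    unfolding bcomps_eq by (auto simp: image_iff arcs_def) (metis less_Suc0 max_nat.right_neutral list.size(3))
  moreover have "finite (bcomps A)" unfolding bcomps_eq using finite_arcs by simp
  ultimately have "card ((\<lambda>c. {(c, 0::nat)}) ` ?E) \<le> k" unfolding card[symmetric] by (intro card_mono)
  moreover have "card ((\<lambda>c. {(c, 0::nat)}) ` ?E) = card ?E" by (intro card_image) (auto simp: inj_on_def)
  moreover have "length (filter (\<lambda>L. \<not> L \<noteq> []) (cir A)) = card ?E" by (simp add: length_filter_conv_card)
  ultimately show ?thesis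
    using ne sum_length_filter_compl[of "\<lambda>L. L \<noteq> []" "cir A"] by simp
qed

text \<open>A sum over an infinite set is 0 by convention, so finiteness is what gives the sum over
  classes its intended value.\<close>

lemma finite_multibased: "finite {A. multibased A k \<and> narr A = n}"
proof -
  let ?L = "{L. set L \<subseteq> {..<n} \<times> (UNIV :: bool set) \<and> length L \<le> 2 * n}"
  let ?C = "{c. set c \<subseteq> ?L \<and> length c \<le> 2 * n + k}"
  let ?b = "{b. set b \<subseteq> {..<2 * n + k} \<times> {..<2 * n + 1} \<and> length b \<le> k}"
  have "finite ?C" by (intro finite_lists_length_le) auto
  moreover have "finite ?b" by (intro finite_lists_length_le) auto
  ultimately have fin: "finite ((\<lambda>(c, b). \<lparr>cir = c, bas = b\<rparr>) ` (?C \<times> ?b))" by simp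
  have "A \<in> (\<lambda>(c, b). \<lparr>cir = c, bas = b\<rparr>) ` (?C \<times> ?b)" if A: "multibased A k" "narr A = n" for A :: adiag
  proof -
    have wf: "wf_adiag A" and b: "length (bas A) = k" "set (bas A) \<subseteq> arcs A" using A by (auto simp: multibased_def)
    have lc: "length (concat (cir A)) = 2 * n"
      using wf A(2) distinct_card[of "concat (cir A)"]
      by (simp add: wf_adiag_def card_cartesian_product del: set_concat)
    have sub: "length L \<le> 2 * n \<and> set L \<subseteq> {..<n} \<times> UNIV" if "L \<in> set (cir A)" for L
    proof -
      have "length L \<le> sum_list (map length (cir A))" using that by (intro member_le_sum_list) auto
      moreover have "set L \<subseteq> set (concat (cir A))" using that by auto
      ultimately show ?thesis using lc wf A(2) by (simp add: length_concat wf_adiag_def)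
    qed
    have "length (cir A) \<le> 2 * n + k" using multibased_length_cir A by blast
    then have "cir A \<in> ?C" using sub by blast
    moreover have "arcs A \<subseteq> {..<2 * n + k} \<times> {..<2 * n + 1}"
    proof
      fix \<alpha> assume "\<alpha> \<in> arcs A"
      then have c: "fst \<alpha> < length (cir A)" "snd \<alpha> < max 1 (length (cir A ! fst \<alpha>))" by (auto simp: arcs_def)
      then have "length (cir A ! fst \<alpha>) \<le> 2 * n" using sub by simp
      then show "\<alpha> \<in> {..<2 * n + k} \<times> {..<2 * n + 1}"
        using c \<open>length (cir A) \<le> 2 * n + k\<close> by (auto simp: mem_Times_iff)
    qed
    then have "bas A \<in> ?b" using b by auto
    ultimately show ?thesis by (intro image_eqI[of _ _ "(cir A, bas A)"]) auto
  qed
  then show ?thesis using fin by (intro finite_subset[OF _ fin]) auto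
qed

lemma finite_Dset: "finite (Dset N k)"
  by (rule finite_subset[OF _ finite_multibased[of k "nat N"]]) (auto simp: Dset_def)

lemma Dset_facts: "A \<in> Dset N k \<Longrightarrow> wf_adiag A \<and> set (bas A) \<subseteq> arcs A \<and> narr A = nat N \<and> multibased A k \<and> descending A"
  by (auto simp: Dset_def multibased_def split: if_splits)

section \<open>Isomorphism classes and the bijection with good states\<close>

abbreviation iso_rel :: "int \<Rightarrow> nat \<Rightarrow> (adiag \<times> adiag) set" where
  "iso_rel N k \<equiv> {(A, B). A \<in> Dset N k \<and> B \<in> Dset N k \<and> adiag_iso A B}"

lemma hom_full:
  assumes "hom_core A B \<pi> \<tau>" "narr A = narr B" shows "set \<tau> = {..<narr B}"
  using assms by (intro card_subset_eq) (auto simp: hom_core_def distinct_card)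

text \<open>Symmetry comes from the common target: an isomorphism from \<open>A\<close> to
  \<open>B\<close> and the identity of \<open>B\<close> have the same state, namely all arrows of
  \<open>B\<close>.\<close>

lemma equiv_iso: "equiv (Dset N k) (iso_rel N k)"
proof (rule equivI)
  show "refl_on (Dset N k) (iso_rel N k)"
    using hom_core_refl Dset_facts by (fastforce simp: refl_on_def adiag_iso_def)
  show "sym (iso_rel N k)"
  proof (rule symI)
    fix A B assume "(A, B) \<in> iso_rel N k"
    then have d: "A \<in> Dset N k" "B \<in> Dset N k" "adiag_iso A B" by auto
    then obtain \<pi> \<tau> where h: "narr A = narr B" "hom_core A B \<pi> \<tau>" by (auto simp: adiag_iso_def)
    have wf: "wf_adiag A" "wf_adiag B" "set (bas A) \<subseteq> arcs A" "set (bas B) \<subseteq> arcs B"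
      using Dset_facts[OF d(1)] Dset_facts[OF d(2)] by blast+
    have r: "hom_core B B [0..<length (cir B)] [0..<narr B]" using hom_core_refl[OF wf(2,4)] .
    have "set [0..<narr B] = set \<tau>" using hom_full[OF h(2,1)] by (simp add: atLeast0LessThan)
    from hom_core_common_target[OF wf(2,1,2) r h(2) this wf(4,3,4)]
    show "(B, A) \<in> iso_rel N k" using h(1) d(1,2) unfolding adiag_iso_def by auto
  qed
  show "trans (iso_rel N k)"
  proof (rule transI)
    fix A B C assume "(A, B) \<in> iso_rel N k" "(B, C) \<in> iso_rel N k"
    then have d: "A \<in> Dset N k" "B \<in> Dset N k" "C \<in> Dset N k" and AB: "adiag_iso A B" and BC: "adiag_iso B C"
      by auto
    obtain \<pi> \<tau> where h: "narr A = narr B" "hom_core A B \<pi> \<tau>" using AB by (auto simp: adiag_iso_def)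
    obtain \<pi>' \<tau>' where h': "narr B = narr C" "hom_core B C \<pi>' \<tau>'" using BC by (auto simp: adiag_iso_def)
    have wf: "wf_adiag A" "wf_adiag B" "wf_adiag C" "set (bas A) \<subseteq> arcs A" "set (bas B) \<subseteq> arcs B" "set (bas C) \<subseteq> arcs C"
      using Dset_facts[OF d(1)] Dset_facts[OF d(2)] Dset_facts[OF d(3)] by blast+
    from hom_core_comp(1)[OF wf(1-3) h(2) h'(2) h(1) wf(4-6)]
    show "(A, C) \<in> iso_rel N k" using h(1) h'(1) d(1,3) unfolding adiag_iso_def by auto
  qed
qed auto

definition good_states :: "bword \<Rightarrow> nat \<Rightarrow> nat \<Rightarrow> nat list \<Rightarrow> nat list \<Rightarrow> nat set set" where
  "good_states w m n J col = {S. S \<subseteq> {..<length w} \<and> card S = n \<and> good w m S J col}"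

text \<open>The state is good, so the bases reach every braid point, and the base arcs of
  \<open>A\<close> are the values of both factor maps at the base points; rigidity applies.\<close>

lemma homs_unique:
  assumes bw: "braid_word m w" and J: "(J, col) \<in> colorings k m" and A: "A \<in> Dset N k"
    and h: "(\<pi>, \<tau>) \<in> homs A w m J col" and h': "(\<pi>', \<tau>') \<in> homs A w m J col" and im: "set \<tau> = set \<tau>'"
  shows "\<pi> = \<pi>' \<and> \<tau> = \<tau>'"
proof -
  note Jf = colorings_facts[OF J]
  have a: "wf_adiag A" "set (bas A) \<subseteq> arcs A" "multibased A k" "descending A" using Dset_facts[OF A] by auto
  have hc: "hom_core A (cgd w m J) \<pi> \<tau>" "hom_core A (cgd w m J) \<pi>' \<tau>'" using h h' by (auto simp: homs_def)
  have bh: "braid_hom w m A (cgd w m J) \<pi> \<tau>" "braid_hom w m A (cgd w m J) \<pi>' \<tau>'"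
    using braid_homI[OF bw a(1)] hc unfolding hom_core_iff by blast+
  have "good w m (set \<tau>) J col" using hom_good[OF bw J a(1,2) hc(1)] a h by blast
  then have "\<forall>z\<in>states w m. \<exists>i<length (map (Pair (0::nat)) J). reach (fstep w (set \<tau>)) (map (Pair 0) J ! i) z"
    unfolding good_def dgood_def by (rule conjunct1)
  then have cov: "\<forall>z\<in>states w m. \<exists>j\<in>set J. reach (fstep w (set \<tau>)) (0, j) z"
    by (metis length_map nth_map nth_mem)
  show ?thesis
  proof (rule hom_rigid[OF bh im _ Jf(2) cov])
    have "map (\<lambda>j. braid_hom.pt w m A (cgd w m J) \<pi> \<tau> (0, j)) J = map (\<lambda>j. braid_hom.pt w m A (cgd w m J) \<pi>' \<tau>' (0, j)) J"
      using bas_pt[OF bh(1) Jf(2) a(2) hc(1)] bas_pt[OF bh(2) Jf(2) a(2) hc(2)] by simp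
    then show "\<forall>j\<in>set J. braid_hom.pt w m A (cgd w m J) \<pi> \<tau> (0, j) = braid_hom.pt w m A (cgd w m J) \<pi>' \<tau>' (0, j)"
      unfolding map_eq_conv .
  qed
qed

lemma Dcls_rep:
  assumes "X \<in> Dcls N k"
  shows "(SOME A. A \<in> X) \<in> X" "X \<subseteq> Dset N k"
proof -
  have X: "X \<in> Dset N k // iso_rel N k" using assms by (simp add: Dcls_def)
  then have "X \<noteq> {}" by (rule in_quotient_imp_non_empty[OF equiv_iso])
  then show "(SOME A. A \<in> X) \<in> X" by (simp add: some_in_eq)
  show "X \<subseteq> Dset N k" using in_quotient_imp_subset[OF equiv_iso X] .
qed

text \<open>Equal states give isomorphic representatives, hence equal classes, and then equal maps
  by rigidity. Conversely, the diagram of a good state is merely isomorphic to the representative of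
  its class, so its map is composed with an isomorphism. For negative \<open>N\<close> there are no
  classes, whereas \<open>nat N\<close> = 0 could still admit the empty state.\<close>

lemma hom_states_bij:
  assumes bw: "braid_word m w" and J: "(J, col) \<in> colorings k m" and N: "0 \<le> N"
  shows "bij_betw (\<lambda>(X, h). set (snd h)) (Sigma (Dcls N k) (\<lambda>X. homs (SOME A. A \<in> X) w m J col))
    (good_states w m (nat N) J col)"
proof -
  note Jf = colorings_facts[OF J]
  interpret braid w m by unfold_locales (rule bw)
  let ?B = "cgd w m J" let ?rep = "\<lambda>X. SOME A. A \<in> (X :: adiag set)"
  note wfB = wf_cgd[of J] note basB = bas_cgd_arcs[OF Jf(2)]
  have rep: "?rep X \<in> Dset N k" if "X \<in> Dcls N k" for X using Dcls_rep[OF that] by blast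
  show ?thesis
  proof (rule bij_betw_imageI)
    show "inj_on (\<lambda>(X, h). set (snd h)) (Sigma (Dcls N k) (\<lambda>X. homs (?rep X) w m J col))"
    proof (rule inj_onI)
      fix z z'
      assume z: "z \<in> Sigma (Dcls N k) (\<lambda>X. homs (?rep X) w m J col)"
        "z' \<in> Sigma (Dcls N k) (\<lambda>X. homs (?rep X) w m J col)"
        "(\<lambda>(X, h). set (snd h)) z = (\<lambda>(X, h). set (snd h)) z'"
      obtain X \<pi> \<tau> Y \<pi>' \<tau>' where zz: "z = (X, \<pi>, \<tau>)" "z' = (Y, \<pi>', \<tau>')" by (metis prod_cases3)
      have X: "X \<in> Dcls N k" and Y: "Y \<in> Dcls N k" and h: "(\<pi>, \<tau>) \<in> homs (?rep X) w m J col"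
        and h': "(\<pi>', \<tau>') \<in> homs (?rep Y) w m J col" and im: "set \<tau> = set \<tau>'"
        using z unfolding zz by auto
      have a: "wf_adiag (?rep X)" "set (bas (?rep X)) \<subseteq> arcs (?rep X)" using Dset_facts[OF rep[OF X]] by auto
      have a': "wf_adiag (?rep Y)" "set (bas (?rep Y)) \<subseteq> arcs (?rep Y)" using Dset_facts[OF rep[OF Y]] by auto
      have hc: "hom_core (?rep X) ?B \<pi> \<tau>" "hom_core (?rep Y) ?B \<pi>' \<tau>'" using h h' by (auto simp: homs_def)
      have "adiag_iso (?rep X) (?rep Y)"
        using hom_core_common_target[OF a(1) a'(1) wfB hc im a(2) a'(2) basB] unfolding adiag_iso_def by blast
      then have "(?rep X, ?rep Y) \<in> iso_rel N k" using rep X Y by blast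
      then have "X = Y"
        using quotient_eqI[OF equiv_iso] X Y Dcls_rep(1)[OF X] Dcls_rep(1)[OF Y] unfolding Dcls_def by blast
      then show "z = z'" using homs_unique[OF bw J rep[OF X] h _ im] h' zz by simp
    qed
    show "(\<lambda>(X, h). set (snd h)) ` Sigma (Dcls N k) (\<lambda>X. homs (?rep X) w m J col) = good_states w m (nat N) J col"
    proof (intro equalityI subsetI)
      fix S assume "S \<in> (\<lambda>(X, h). set (snd h)) ` Sigma (Dcls N k) (\<lambda>X. homs (?rep X) w m J col)"
      then obtain X \<pi> \<tau> where X: "X \<in> Dcls N k" "(\<pi>, \<tau>) \<in> homs (?rep X) w m J col" "S = set \<tau>" by auto
      have a: "wf_adiag (?rep X)" "set (bas (?rep X)) \<subseteq> arcs (?rep X)" "narr (?rep X) = nat N"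
        "multibased (?rep X) k" "descending (?rep X)" using Dset_facts[OF rep[OF X(1)]] by auto
      have hc: "hom_core (?rep X) ?B \<pi> \<tau>" using X(2) by (auto simp: homs_def)
      have "good w m S J col" using hom_good[OF bw J a(1,2) hc] a X by blast
      moreover have "S \<subseteq> {..<length w}" "card S = nat N"
        using hc a(3) narr_bgd[of ?B] unfolding hom_core_def X(3) by (auto simp: distinct_card)
      ultimately show "S \<in> good_states w m (nat N) J col" by (simp add: good_states_def)
    next
      fix S assume "S \<in> good_states w m (nat N) J col"
      then have S: "S \<subseteq> {..<length w}" "card S = nat N" "good w m S J col" by (auto simp: good_states_def)
      obtain A \<pi> \<tau> where A: "multibased A k" "descending A" "narr A = nat N" and hA: "hom_core A ?B \<pi> \<tau>" "set \<tau> = S"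
        using good_state_hom[OF bw J S(1,3)] S(2) by metis
      have AD: "A \<in> Dset N k" using A N by (simp add: Dset_def)
      define X where "X = iso_rel N k `` {A}"
      have X: "X \<in> Dcls N k" unfolding X_def Dcls_def using AD by (rule quotientI)
      have "(A, ?rep X) \<in> iso_rel N k" using Dcls_rep(1)[OF X] unfolding X_def by blast
      then have "(?rep X, A) \<in> iso_rel N k" using equiv_iso[of N k] by (meson equivE symD)
      then obtain \<pi>1 \<tau>1 where h1: "hom_core (?rep X) A \<pi>1 \<tau>1" "narr (?rep X) = narr A" by (auto simp: adiag_iso_def)
      have a: "wf_adiag (?rep X)" "set (bas (?rep X)) \<subseteq> arcs (?rep X)" using Dset_facts[OF rep[OF X]] by auto
      have a': "wf_adiag A" "set (bas A) \<subseteq> arcs A" using Dset_facts[OF AD] by auto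
      note c = hom_core_comp[OF a(1) a'(1) wfB h1(1) hA(1) h1(2) a(2) a'(2) basB]
      have "(map ((!) \<pi>) \<pi>1, map ((!) \<tau>) \<tau>1) \<in> homs (?rep X) w m J col"
        using hom_good[OF bw J a c(1)] S(3) c(2) hA(2) by simp
      then have "(X, map ((!) \<pi>) \<pi>1, map ((!) \<tau>) \<tau>1) \<in> Sigma (Dcls N k) (\<lambda>X. homs (?rep X) w m J col)" using X by blast
      moreover have "S = (\<lambda>(X, h). set (snd h)) (X, map ((!) \<pi>) \<pi>1, map ((!) \<tau>) \<tau>1)" using c(2) hA(2) by simp
      ultimately show "S \<in> (\<lambda>(X, h). set (snd h)) ` Sigma (Dcls N k) (\<lambda>X. homs (?rep X) w m J col)" by (rule rev_image_eqI)
    qed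
  qed
qed

lemma state_sum:
  assumes bw: "braid_word m w" and J: "(J, col) \<in> colorings k m" and N: "0 \<le> N"
  shows "(\<Sum>X\<in>Dcls N k. pairing (SOME A. A \<in> X) w m J col) =
    (\<Sum>S\<in>good_states w m (nat N) J col. \<Prod>p\<in>S. sgnw w p)"
proof -
  let ?rep = "\<lambda>X. SOME A. A \<in> (X :: adiag set)"
  let ?Sig = "Sigma (Dcls N k) (\<lambda>X. homs (?rep X) w m J col)"
  note bij = hom_states_bij[OF assms]
  have "finite (good_states w m (nat N) J col)"
    by (rule finite_subset[of _ "Pow {..<length w}"]) (auto simp: good_states_def)
  \<comment> \<open>Finiteness of the sets of homomorphisms is read off from the finitely many
    states.\<close>
  then have finS: "finite ?Sig" using bij bij_betw_finite by blast
  have finD: "finite (Dcls N k)" unfolding Dcls_def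
    by (rule finite_quotient[OF finite_Dset]) auto
  have finh: "finite (homs (?rep X) w m J col)" if "X \<in> Dcls N k" for X
  proof -
    have "homs (?rep X) w m J col \<subseteq> snd ` ?Sig" using that by force
    then show ?thesis using finS finite_subset by blast
  qed
  have weight: "(\<Prod>a<narr (?rep X). sgnw w (snd h ! a)) = (\<Prod>p\<in>set (snd h). sgnw w p)"
    if "X \<in> Dcls N k" "h \<in> homs (?rep X) w m J col" for X h
  proof -
    have "length (snd h) = narr (?rep X)" "distinct (snd h)"
      using that(2) by (auto simp: homs_def hom_core_def)
    then show ?thesis
      by (intro prod.reindex_bij_betw bij_betw_nth) auto
  qed
  have "(\<Sum>X\<in>Dcls N k. pairing (?rep X) w m J col) =
     (\<Sum>X\<in>Dcls N k. \<Sum>h\<in>homs (?rep X) w m J col. \<Prod>p\<in>set (snd h). sgnw w p)"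
    unfolding pairing_def using weight by (intro sum.cong refl) (auto simp: case_prod_beta)
  also have "\<dots> = (\<Sum>(X, h)\<in>?Sig. \<Prod>p\<in>set (snd h). sgnw w p)"
    using finD finh by (intro sum.Sigma) auto
  also have "\<dots> = (\<Sum>z\<in>?Sig. \<Prod>p\<in>(\<lambda>(X, h). set (snd h)) z. sgnw w p)"
    by (intro sum.cong refl) auto
  also have "\<dots> = (\<Sum>S\<in>good_states w m (nat N) J col. \<Prod>p\<in>S. sgnw w p)"
    by (rule sum.reindex_bij_betw[OF bij])
  finally show ?thesis .
qed

section \<open>The Conway triple\<close>

lemma dgood_insert:
  "dgood f X bs (insert (x, y) P) C \<longleftrightarrow> dgood f X bs P C \<and> desc_at f bs x y"
  by (auto simp: dgood_def)

locale conway =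
  fixes u v :: bword and m i :: nat
  assumes bu: "braid_word m u" and bv: "braid_word m v" and i: "1 \<le> i" "i < m"
begin

definition wd :: "bool \<Rightarrow> bword" where "wd b = u @ [(i, b)] @ v"

abbreviation "q \<equiv> length u"

text \<open>The letter with index \<open>p\<close> in \<open>u @ v\<close> has index
  \<open>sh p\<close> in \<open>wd b\<close>.\<close>

definition sh :: "nat \<Rightarrow> nat" where "sh p = (if p < q then p else Suc p)"

lemma bw: "braid_word m (wd b)" and bw0: "braid_word m (u @ v)"
  using bu bv i by (auto simp: wd_def braid_word_def)

lemma length_wd [simp]: "length (wd b) = Suc (length (u @ v))"
  by (simp add: wd_def)

lemma nth_q [simp]: "wd b ! q = (i, b)"
  by (simp add: wd_def)

lemma nth_sh: "wd b ! sh p = (u @ v) ! p"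
  by (auto simp: wd_def sh_def nth_append)

lemma sh_neq: "sh p \<noteq> q" and sh_eq_iff [simp]: "sh p = sh p' \<longleftrightarrow> p = p'"
  by (auto simp: sh_def)

lemma sh_lt: "sh p < length (wd b) \<longleftrightarrow> p < length (u @ v)"
  by (auto simp: sh_def)

lemma sh_surj: "p \<noteq> q \<Longrightarrow> \<exists>p'. p = sh p'"
proof -
  assume "p \<noteq> q"
  then have "p = sh (if p < q then p else p - 1)" by (auto simp: sh_def)
  then show ?thesis by blast
qed

lemma nth_other: "p \<noteq> q \<Longrightarrow> wd b ! p = wd c ! p"
  using sh_surj nth_sh by metis

lemma fst_wd: "fst (wd b ! p) = fst (wd c ! p)"
  using nth_other[of p b c] by (cases "p = q") auto

lemma fstep_wd: "fstep (wd b) = fstep (wd c)"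
  by (intro ext) (auto simp: fstep_def fst_wd[of b _ c])

lemma states_wd: "states (wd b) = states (wd c)"
  by (intro ext) (simp add: states_def)

lemma entry_other: "p \<noteq> q \<Longrightarrow> entry (wd b) p = entry (wd c) p"
  using nth_other[of p b c] by (intro ext) (simp add: entry_def)

lemma crossings_other: "q \<notin> S \<Longrightarrow> crossings (wd b) S = crossings (wd c) S"
proof -
  assume "q \<notin> S"
  then have "entry (wd b) p = entry (wd c) p" if "p \<in> S" for p
    using that entry_other[of p b c] by blast
  then show ?thesis by (simp add: crossings_def cong: image_cong)
qed

text \<open>The flow ignores signs of letters, and the tail and head ends away from \<open>q\<close>
  belong to unchanged letters.\<close>

lemma good_other: "q \<notin> S \<Longrightarrow> good (wd b) m S J col = good (wd c) m S J col"
  unfolding good_def using fstep_wd[of b c] states_wd[of b c] crossings_other[of S b c] by simp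

lemma sgnw_other: "p \<noteq> q \<Longrightarrow> sgnw (wd b) p = sgnw (wd c) p"
  using nth_other[of p b c] by (simp add: sgnw_def)

section \<open>Deleting the smoothed letter\<close>

definition merge :: "nat \<times> nat \<Rightarrow> nat \<times> nat" where
  "merge z = (if fst z \<le> q then fst z else fst z - 1, snd z)"

lemma merge_sh: "merge (sh p, x) = (p, x)"
  by (auto simp: merge_def sh_def)

lemma merge_image: "merge ` states (wd b) m = states (u @ v) m"
proof (intro equalityI subsetI)
  fix z assume "z \<in> states (u @ v) m"
  then obtain p x where z: "z = (p, x)" "p \<le> length (u @ v)" "x \<in> {1..m}" by (auto simp: states_def)
  then have "(sh p, x) \<in> states (wd b) m" by (auto simp: states_def sh_def)
  then show "z \<in> merge ` states (wd b) m" using z(1) merge_sh by (metis image_eqI)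
qed (auto simp: states_def merge_def)

text \<open>A smoothed letter only moves points down one level, so identifying the levels
  \<open>q\<close> and \<open>Suc q\<close> removes it. With level \<open>q\<close> as the only
  waiting level, each fibre keeps exactly one event.\<close>

lemma merge_factor:
  assumes S: "S = insert q (sh ` S')"
  shows "factor (fstep (wd b) S) (fstep (u @ v) S') merge (states (wd b) m) {z. fst z \<noteq> q}"
proof -
  interpret braid "wd b" m by unfold_locales (rule bw)
  have mem: "sh p \<in> S \<longleftrightarrow> p \<in> S'" for p using S sh_neq[of p] by (auto simp: image_iff)
  have ev: "merge (fstep (wd b) S z) = fstep (u @ v) S' (merge z)" if zs: "z \<in> states (wd b) m" and zq: "fst z \<noteq> q" for z
  proof -
    obtain p x where z: "z = (p, x)" by fastforce
    obtain p' where p': "p = sh p'" using sh_surj zq z by auto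
    consider "p < length (wd b)" | "p = length (wd b)" using zs z by (fastforce simp: states_def)
    then show ?thesis
    proof cases
      case 1
      then have lt: "p' < length (u @ v)" using sh_lt p' by metis
      have "fstep (wd b) S z = (Suc (sh p'), if p' \<in> S' then x else swp (fst ((u @ v) ! p')) x)"
        using 1 z p' mem nth_sh by (simp add: fstep_def)
      moreover have "merge (Suc (sh p'), y) = (Suc p', y)" for y by (auto simp: merge_def sh_def)
      ultimately show ?thesis using lt z p' merge_sh by (simp add: fstep_def)
    next
      case 2
      then have "p' = length (u @ v)" using p' by (auto simp: sh_def split: if_splits)
      then show ?thesis using 2 z p' merge_sh by (simp add: fstep_def merge_def)
    qed
  qed
  have stay: "fstep (wd b) S (q, x) = (Suc q, x)" for x using S by (simp add: fstep_def)
  show ?thesis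
  proof
    fix z assume z: "z \<in> states (wd b) m"
    show "fstep (wd b) S z \<in> states (wd b) m" using fstep_states z .
    show "reach (fstep (wd b) S) y z" if "reach (fstep (wd b) S) z y" for y using fstep_sym z that .
    show "merge (fstep (wd b) S z) = fstep (u @ v) S' (merge z)" if "z \<in> {z. fst z \<noteq> q}" using ev z that by simp
    show "merge (fstep (wd b) S z) = merge z" if "z \<notin> {z. fst z \<noteq> q}"
    proof -
      have "z = (q, snd z)" using that by (cases z) simp
      then have "fstep (wd b) S z = (Suc q, snd z)" using stay by metis
      then show ?thesis using that by (simp add: merge_def)
    qed
    show "z = y" if zq: "z \<in> {z. fst z \<noteq> q}" and "y \<in> states (wd b) m"
      and yq: "y \<in> {z. fst z \<noteq> q}" and eq: "merge z = merge y" for y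
    proof -
      obtain p where p: "fst z = sh p" using sh_surj zq by auto
      obtain p' where p': "fst y = sh p'" using sh_surj yq by auto
      have "merge (sh p, snd z) = merge (sh p', snd y)" using eq p p' by (metis prod.collapse)
      then show ?thesis using p p' merge_sh by (simp add: prod_eq_iff)
    qed
    show "(\<exists>y\<in>{z. fst z \<noteq> q}. reach (fstep (wd b) S) z y) \<or> (fstep (u @ v) S' (merge z) = merge z \<and>
       (\<forall>y\<in>states (wd b) m. merge y = merge z \<longrightarrow> reach (fstep (wd b) S) z y))"
    proof (cases "fst z = q")
      case True
      then have "fstep (wd b) S z = (Suc q, snd z)" using stay by (metis prod.collapse)
      then have "reach (fstep (wd b) S) z (Suc q, snd z)" using reach_step by metis
      moreover have "(Suc q, snd z) \<in> {z. fst z \<noteq> q}" by simp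
      ultimately show ?thesis by blast
    next
      case False
      then have "z \<in> {z. fst z \<noteq> q}" by simp
      then show ?thesis using reach_refl[of "fstep (wd b) S" z] by blast
    qed
  qed
qed

lemma dgood_merge:
  assumes S: "S = insert q (sh ` S')" and S': "S' \<subseteq> {..<length (u @ v)}" and J: "(J, col) \<in> colorings k m"
  shows "good (u @ v) m S' J col \<longleftrightarrow>
    dgood (fstep (wd b) S) (states (wd b) m) (map (Pair 0) J) (crossings (wd b) (sh ` S')) (colour_pts m J col)"
proof -
  interpret factor "fstep (wd b) S" "fstep (u @ v) S'" merge "states (wd b) m" "{z. fst z \<noteq> q}"
    by (rule merge_factor[OF S])
  interpret b: braid "wd b" m by unfold_locales (rule bw)
  note Jf = colorings_facts[OF J]
  have z: "(0, j) \<in> states (wd b) m" if "j \<in> {1..m}" for j using that by (simp add: states_def)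
  \<comment> \<open>If \<open>u\<close> is empty, the base points lie on the waiting level
    \<open>q\<close> = 0; this is harmless because bases need not be events.\<close>
  have m0: "merge (0, j) = (0, j)" for j by (simp add: merge_def)
  have "entry (wd b) (sh p) c = entry (u @ v) p c" for p c by (simp add: entry_def nth_sh)
  then have cr: "map_prod merge merge ` crossings (wd b) (sh ` S') = crossings (u @ v) S'"
    by (simp add: crossings_def image_image merge_sh)
  have sub: "crossings (wd b) (sh ` S') \<subseteq> (states (wd b) m \<inter> {z. fst z \<noteq> q}) \<times> (states (wd b) m \<inter> {z. fst z \<noteq> q})"
  proof -
    have "(sh p, entry (wd b) (sh p) c) \<in> states (wd b) m \<inter> {z. fst z \<noteq> q}" if "p \<in> S'" for p c
    proof -
      have "sh p < length (wd b)" using that S' sh_lt[of p b] by blast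
      then show ?thesis using b.entry_in[of "sh p" c] sh_neq[of p] by (simp add: states_def)
    qed
    then show ?thesis by (auto simp: crossings_def)
  qed
  have "dgood (fstep (u @ v) S') (merge ` states (wd b) m) (map merge (map (Pair 0) J))
      (map_prod merge merge ` crossings (wd b) (sh ` S')) (map_prod id merge ` colour_pts m J col) \<longleftrightarrow>
    dgood (fstep (wd b) S) (states (wd b) m) (map (Pair 0) J) (crossings (wd b) (sh ` S')) (colour_pts m J col)"
  proof (rule dgood_map_iff[OF _ sub])
    show "set (map (Pair 0) J) \<subseteq> states (wd b) m" using z Jf(2) by auto
    show "colour_pts m J col \<subseteq> {..<length (map (Pair (0::nat)) J)} \<times> states (wd b) m"
      using z Jf(3) by (auto simp: colour_pts_def)
  qed
  moreover have "map merge (map (Pair 0) J) = map (Pair 0) J" using m0 by simp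
  moreover have "map_prod id merge ` colour_pts m J col = colour_pts m J col"
    by (simp add: colour_pts_def image_image m0)
  ultimately show ?thesis unfolding good_def by (simp only: cr merge_image)
qed

text \<open>At the crossing \<open>q\<close> exactly one of the two signs makes the state descending.\<close>

lemma good_smoothed:
  assumes S: "S = insert q (sh ` S')" and S': "S' \<subseteq> {..<length (u @ v)}" and J: "(J, col) \<in> colorings k m"
  shows "good (u @ v) m S' J col \<longleftrightarrow> good (wd True) m S J col \<or> good (wd False) m S J col"
    "\<not> (good (wd True) m S J col \<and> good (wd False) m S J col)"
proof -
  let ?f = "fstep (wd True) S" let ?bs = "map (Pair (0::nat)) J"
  let ?K = "dgood ?f (states (wd True) m) ?bs (crossings (wd True) (sh ` S')) (colour_pts m J col)"
  have nq: "q \<notin> sh ` S'" using sh_neq by (metis imageE)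
  \<comment> \<open>Both signs have the same flow, so \<open>?K\<close> does not depend on
    \<open>b\<close>; the sign enters only through the order demanded at \<open>q\<close>.\<close>
  have g: "good (wd b) m S J col \<longleftrightarrow> ?K \<and> desc_at ?f ?bs (q, entry (wd b) q False) (q, entry (wd b) q True)" for b
  proof -
    have "crossings (wd b) S = insert ((q, entry (wd b) q False), (q, entry (wd b) q True)) (crossings (wd True) (sh ` S'))"
      using crossings_other[OF nq, of b True] unfolding S by (simp add: crossings_def)
    then show ?thesis unfolding good_def fstep_wd[of b True] states_wd[of b True] by (simp add: dgood_insert)
  qed
  \<comment> \<open>For a positive crossing the over strand, which carries the tail, comes in at
    position \<open>Suc i\<close>; for a negative one at \<open>i\<close>.\<close>
  have T: "good (wd True) m S J col \<longleftrightarrow> ?K \<and> desc_at ?f ?bs (q, Suc i) (q, i)"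
    and F: "good (wd False) m S J col \<longleftrightarrow> ?K \<and> desc_at ?f ?bs (q, i) (q, Suc i)"
    using g[of True] g[of False] by (simp_all add: entry_def)
  have K: "good (u @ v) m S' J col \<longleftrightarrow> ?K" using dgood_merge[OF assms] .
  have total: "desc_at ?f ?bs (q, Suc i) (q, i) \<or> desc_at ?f ?bs (q, i) (q, Suc i)" if ?K
  proof (rule desc_at_total)
    have "(q, x) \<in> states (wd True) m" if "x \<in> {1..m}" for x using that by (simp add: states_def)
    then show "\<exists>j<length ?bs. reach ?f (?bs ! j) (q, Suc i)" "\<exists>j<length ?bs. reach ?f (?bs ! j) (q, i)"
      using conjunct1[OF \<open>?K\<close>[unfolded dgood_def]] i by auto
  qed simp
  show "good (u @ v) m S' J col \<longleftrightarrow> good (wd True) m S J col \<or> good (wd False) m S J col"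
    using K T F total by blast
  show "\<not> (good (wd True) m S J col \<and> good (wd False) m S J col)"
  proof
    assume "good (wd True) m S J col \<and> good (wd False) m S J col"
    then have "desc_at ?f ?bs (q, Suc i) (q, i)" "desc_at ?f ?bs (q, i) (q, Suc i)" using T F by blast+
    then show False by (rule desc_at_asym)
  qed
qed

section \<open>Splitting the states at the distinguished crossing\<close>

definition lift :: "nat set \<Rightarrow> nat set" where "lift S' = insert q (sh ` S')"

text \<open>Indexing by states of \<open>u @ v\<close> puts both signs into one set, where they
  partition the good states.\<close>

definition through :: "bool \<Rightarrow> nat \<Rightarrow> nat list \<Rightarrow> nat list \<Rightarrow> nat set set" where
  "through b n J col = {S'. S' \<subseteq> {..<length (u @ v)} \<and> card S' = n \<and> good (wd b) m (lift S') J col}"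

lemma lift_states:
  "{S \<in> good_states (wd b) m (Suc n) J col. q \<in> S} = lift ` through b n J col"
proof (intro equalityI subsetI)
  have card: "card (lift S') = Suc (card S')" if "finite S'" for S'
  proof -
    have "q \<notin> sh ` S'" using sh_neq by (metis imageE)
    moreover have "card (sh ` S') = card S'" by (rule card_image) (simp add: inj_on_def)
    ultimately show ?thesis using that unfolding lift_def by simp
  qed
  {
    fix S assume "S \<in> {S \<in> good_states (wd b) m (Suc n) J col. q \<in> S}"
    then have S: "S \<subseteq> {..<length (wd b)}" "card S = Suc n" "good (wd b) m S J col" "q \<in> S"
      by (auto simp: good_states_def)
    define S' where "S' = {p. sh p \<in> S}"
    have sub: "S' \<subseteq> {..<length (u @ v)}" using S(1) sh_lt[of _ b] unfolding S'_def by blast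
    have "S = lift S'" using S(4) sh_surj unfolding lift_def S'_def by blast
    moreover have "finite S'" using sub finite_subset by blast
    ultimately have "S' \<in> through b n J col" using S sub card by (simp add: through_def)
    then show "S \<in> lift ` through b n J col" using \<open>S = lift S'\<close> by blast
  }
  fix S assume "S \<in> lift ` through b n J col"
  then obtain S' where S': "S = lift S'" "S' \<subseteq> {..<length (u @ v)}" "card S' = n" "good (wd b) m S J col"
    by (auto simp: through_def)
  have "finite S'" using S'(2) finite_subset by blast
  moreover have "S \<subseteq> {..<length (wd b)}" using S'(2) sh_lt[of _ b] by (auto simp: S'(1) lift_def simp del: length_wd) simp
  ultimately show "S \<in> {S \<in> good_states (wd b) m (Suc n) J col. q \<in> S}"
    using S' card by (auto simp: good_states_def lift_def)
qed

lemma prod_lift: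
  assumes "finite S'"
  shows "(\<Prod>p\<in>lift S'. sgnw (wd b) p) = (if b then 1 else -1) * (\<Prod>p\<in>S'. sgnw (u @ v) p)"
proof -
  have "q \<notin> sh ` S'" using sh_neq by (metis imageE)
  then have "(\<Prod>p\<in>lift S'. sgnw (wd b) p) = sgnw (wd b) q * (\<Prod>p\<in>sh ` S'. sgnw (wd b) p)"
    unfolding lift_def using assms by simp
  also have "(\<Prod>p\<in>sh ` S'. sgnw (wd b) p) = (\<Prod>p\<in>S'. sgnw (wd b) (sh p))"
    by (simp add: prod.reindex inj_on_def)
  also have "\<dots> = (\<Prod>p\<in>S'. sgnw (u @ v) p)" by (simp add: sgnw_def nth_sh)
  finally show ?thesis by (simp add: sgnw_def)
qed

lemma inj_lift: "inj lift"
proof (rule injI)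
  fix S T assume "lift S = lift T"
  then have "sh p \<in> lift S \<longleftrightarrow> sh p \<in> lift T" for p by simp
  then have "p \<in> S \<longleftrightarrow> p \<in> T" for p using sh_neq[of p] by (auto simp: lift_def image_iff)
  then show "S = T" by blast
qed

definition weight :: "bword \<Rightarrow> nat set \<Rightarrow> int" where
  "weight w S = (\<Prod>p\<in>S. sgnw w p)"

lemma finite_good_states: "finite (good_states w m n J col)"
  by (rule finite_subset[of _ "Pow {..<length w}"]) (auto simp: good_states_def)

text \<open>The factor -1 of the negative crossing turns the difference of the two sums through
  \<open>q\<close> into a sum over the disjoint union of the two families \<open>through\<close>. A
  state without arrows cannot pass through \<open>q\<close>, hence the value 0 for
  \<open>n = 0\<close>.\<close>

lemma conway_states:
  assumes J: "(J, col) \<in> colorings k m"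
  shows "sum (weight (wd True)) (good_states (wd True) m n J col)
       - sum (weight (wd False)) (good_states (wd False) m n J col)
       = (if n = 0 then 0 else sum (weight (u @ v)) (good_states (u @ v) m (n - 1) J col))"
proof -
  let ?G = "\<lambda>b. good_states (wd b) m n J col"
  have split: "sum (weight (wd b)) (?G b) = sum (weight (wd b)) {S \<in> ?G b. q \<in> S} + sum (weight (wd b)) {S \<in> ?G b. q \<notin> S}" for b
  proof -
    have "sum (weight (wd b)) ({S \<in> ?G b. q \<in> S} \<union> {S \<in> ?G b. q \<notin> S}) =
        sum (weight (wd b)) {S \<in> ?G b. q \<in> S} + sum (weight (wd b)) {S \<in> ?G b. q \<notin> S}"
      using finite_good_states by (intro sum.union_disjoint) auto
    moreover have "{S \<in> ?G b. q \<in> S} \<union> {S \<in> ?G b. q \<notin> S} = ?G b" by blast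
    ultimately show ?thesis by simp
  qed
  have avoid: "sum (weight (wd True)) {S \<in> ?G True. q \<notin> S} = sum (weight (wd False)) {S \<in> ?G False. q \<notin> S}"
  proof (rule sum.cong)
    show "{S \<in> ?G True. q \<notin> S} = {S \<in> ?G False. q \<notin> S}"
      using good_other[of _ True _ _ False] by (auto simp: good_states_def)
    fix S assume "S \<in> {S \<in> ?G False. q \<notin> S}"
    then have "p \<noteq> q" if "p \<in> S" for p using that by auto
    then show "weight (wd True) S = weight (wd False) S"
      unfolding weight_def using sgnw_other[of _ True False] by (intro prod.cong HOL.refl) metis
  qed
  show ?thesis
  proof (cases n)
    case 0
    have none: "{S \<in> ?G b. q \<in> S} = {}" for b
    proof -
      have "S = {}" if "S \<in> ?G b" for S
        using that 0 finite_subset[of S "{..<length (wd b)}"] by (auto simp: good_states_def)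
      then show ?thesis by blast
    qed
    have "sum (weight (wd b)) (?G b) = sum (weight (wd b)) {S \<in> ?G b. q \<notin> S}" for b
      using split[of b] unfolding none by simp
    then show ?thesis using avoid 0 by simp
  next
    case (Suc l)
    have thr: "sum (weight (wd b)) {S \<in> ?G b. q \<in> S} = (if b then 1 else -1) * sum (weight (u @ v)) (through b l J col)" for b
    proof -
      have "sum (weight (wd b)) {S \<in> ?G b. q \<in> S} = (\<Sum>S'\<in>through b l J col. weight (wd b) (lift S'))"
        unfolding Suc lift_states using inj_lift by (subst sum.reindex) (auto intro: inj_on_subset)
      also have "\<dots> = (\<Sum>S'\<in>through b l J col. (if b then 1 else -1) * weight (u @ v) S')"
      proof (rule sum.cong)
        fix S' assume "S' \<in> through b l J col"
        then have "finite S'" using finite_subset[of S' "{..<length (u @ v)}"] by (simp add: through_def)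
        then show "weight (wd b) (lift S') = (if b then 1 else -1) * weight (u @ v) S'"
          using prod_lift unfolding weight_def by simp
      qed simp
      finally show ?thesis by (simp add: sum_distrib_left)
    qed
    have un: "good_states (u @ v) m l J col = through True l J col \<union> through False l J col"
      using good_smoothed(1)[OF lift_def _ J] by (auto simp: good_states_def through_def)
    have disj: "through True l J col \<inter> through False l J col = {}"
      using good_smoothed(2)[OF lift_def _ J] by (auto simp: through_def)
    have fin: "finite (through b l J col)" for b
      by (rule finite_subset[of _ "Pow {..<length (u @ v)}"]) (auto simp: through_def)
    have "sum (weight (u @ v)) (good_states (u @ v) m l J col) =
        sum (weight (u @ v)) (through True l J col) + sum (weight (u @ v)) (through False l J col)"
      unfolding un using fin disj by (intro sum.union_disjoint) auto
    then show ?thesis using split[of True] split[of False] avoid thr[of True] thr[of False] Suc by simp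
  qed
qed

lemma Dcls_neg: "N < 0 \<Longrightarrow> Dcls N k = {}"
  by (simp add: Dcls_def Dset_def)

text \<open>Because \<open>nat\<close> truncates, \<open>N = 0\<close> is a case of its own: the
  right side then asks for -1 arrows and has no classes.\<close>

lemma conway_pairing:
  assumes J: "(J, col) \<in> colorings k m"
  shows "(\<Sum>X\<in>Dcls N k. pairing (SOME A. A \<in> X) (wd True) m J col)
       - (\<Sum>X\<in>Dcls N k. pairing (SOME A. A \<in> X) (wd False) m J col)
       = (\<Sum>X\<in>Dcls (N - 1) k. pairing (SOME A. A \<in> X) (u @ v) m J col)"
proof -
  consider "N < 0" | "N = 0" | "1 \<le> N" by linarith
  then show ?thesis
  proof cases
    case 1 then show ?thesis by (simp add: Dcls_neg)
  next
    case 2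
    then show ?thesis using state_sum[OF bw J, of 0] conway_states[OF J, of 0] by (simp add: Dcls_neg weight_def)
  next
    case 3
    then have "nat (N - 1) = nat N - 1" "nat N \<noteq> 0" by auto
    then show ?thesis
      using 3 state_sum[OF bw J, of N] state_sum[OF bw0 J, of "N - 1"] conway_states[OF J, of "nat N"]
      by (simp add: weight_def)
  qed
qed

end

theorem theorem3p2:
  fixes m i k j :: nat and n :: int and u v :: bword
  assumes "m \<ge> 1" and "braid_word m u" and "braid_word m v"
    and "1 \<le> i" and "i \<le> m - 1"
    and "1 \<le> k" and "1 \<le> j" and "j \<le> k" and "n \<ge> 0"
  shows "Dnkj n k j m (u @ [(i, True)] @ v) - Dnkj n k j m (u @ [(i, False)] @ v)
         = Dnkj (n - 1) k j m (u @ v)"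
proof -
  interpret conway u v m i by unfold_locales (use assms in auto)
  have N: "n - 1 + int j - int k = n + int j - int k - 1" by simp
  show ?thesis
    unfolding Dnkj_def N wd_def[symmetric] sum_subtractf[symmetric]
    using conway_pairing by (intro sum.cong) auto
qed

end
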